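(* Let $d\ge2$. There exist constants $c,c'$ depending only on $d$ such that for every $m\ge0$, the set $D_m\subset\mathbb{Z}^d$ of fully occupied sites of the divisible sandpile started from mass $m$ at the origin satisfies \[ B_{r-c}\subset D_m\subset B_{r+c'},\qquad r=(m/\omega_d)^{1/d}. \]
   Context: Divisible sandpile: starting mass distribution $\mu_0=m\delta_o$ on $\mathbb{Z}^d$; toppling a site $x$ with mass $\mu(x)>1$ keeps mass $1$ at $x$ and sends $(\mu(x)-1)/(2d)$ to each of the $2d$ lattice neighbors (no effect if $\mu(x)\le1$). Toppling along any sequence that visits every site infinitely often, the mass distributions converge to a final distribution $\mu\le1$, independent of the sequence. $D_m=\{x:\mu(x)=1\}$. $\omega_d$ is the volume of the unit ball in $\mathbb{R}^d$ and $B_\rho=\{x\in\mathbb{Z}^d:|x|<\rho\}$ (Euclidean norm). *)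

theory Defs
  imports "HOL-Analysis.Analysis"
begin

definition lattice_adj :: "int ^ 'n \<Rightarrow> int ^ 'n \<Rightarrow> bool" where
  "lattice_adj x y \<longleftrightarrow> (\<Sum>i\<in>UNIV. \<bar>x $ i - y $ i\<bar>) = 1"

definition topple :: "int ^ 'n \<Rightarrow> (int ^ 'n \<Rightarrow> real) \<Rightarrow> (int ^ 'n \<Rightarrow> real)" where
  "topple x \<mu> = (\<lambda>y. if \<mu> x \<le> 1 then \<mu> y
      else if y = x then 1
      else if lattice_adj x y then \<mu> y + (\<mu> x - 1) / (2 * real CARD('n))
      else \<mu> y)"

fun sandpile :: "real \<Rightarrow> (nat \<Rightarrow> int ^ 'n) \<Rightarrow> nat \<Rightarrow> (int ^ 'n \<Rightarrow> real)" where
  "sandpile m s 0 = (\<lambda>y. if y = 0 then m else 0)"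
| "sandpile m s (Suc k) = topple (s k) (sandpile m s k)"

definition visits_all :: "(nat \<Rightarrow> int ^ 'n) \<Rightarrow> bool" where
  "visits_all s \<longleftrightarrow> (\<forall>z. infinite {k. s k = z})"

definition to_real_vec :: "int ^ 'n \<Rightarrow> real ^ 'n" where
  "to_real_vec x = (\<chi> i. real_of_int (x $ i))"

definition lattice_ball :: "real \<Rightarrow> (int ^ 'n) set" where
  "lattice_ball \<rho> = {x. norm (to_real_vec x) < \<rho>}"

definition omega :: "'n::finite itself \<Rightarrow> real" where
  "omega _ = measure lborel (ball (0 :: real ^ 'n) 1)"

end

theory Submission
  imports Defs "HOL-Probability.Probability"
begin

text \<open>The odometer \<open>u\<close> (mass emitted) satisfies \<open>\<mu> = m \<delta>\<^sub>0 + lap u\<close> and is dominated by every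
  nonnegative \<open>V\<close> with \<open>m \<delta>\<^sub>0 + lap V \<le> 1\<close>. It is compared with \<open>\<gamma> x = |x|\<^sup>2 - m a x\<close>, where \<open>a\<close> is the
  potential kernel, \<open>lap a = \<delta>\<^sub>0\<close>: up to \<open>O(1)\<close> on \<open>|x| \<ge> r / 4\<close>, \<open>\<gamma>\<close> is a radial function that has its
  minimum at \<open>r = (m / \<omega>) powr (1 / d)\<close> and grows quadratically in \<open>|x| - r\<close> towards the origin. Dominating \<open>u\<close>
  by \<open>\<gamma> - min \<gamma>\<close> makes \<open>u\<close> bounded outside the ball of radius \<open>r\<close>, whence the outer inclusion;
  \<open>u - \<gamma>\<close> is superharmonic, and the minimum principle on that ball gives \<open>u > 0\<close> at distance at
  least \<open>c\<close> inside its boundary.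

  The \<open>O(|x| powr (-d))\<close> error needed for \<open>a\<close> comes from continuous time: \<open>a x\<close> is the time integral
  of \<open>p\<^sub>t 0 - p\<^sub>t x\<close>, and the heat kernel \<open>p\<^sub>t\<close> is a product of one-dimensional kernels. In one dimension
  Fourier inversion shows that the kernel agrees up to \<open>O(t powr (-5/2))\<close> with a mean of two Gaussians
  with the same fourth cumulant.\<close>

subsection \<open>The odometer of the divisible sandpile\<close>

text \<open>The obstacle is precision. In \<open>obstacle M\<close> the kernel \<open>a\<close> is
  multiplied by a mass of order \<open>R ^ d\<close>, so only an error of order
  \<open>|x| powr (-d)\<close> in \<open>a\<close> keeps the comparison within O(1) at distances
  comparable to \<open>R\<close>. A plain local limit theorem, with an error of relative size
  \<open>1 / t\<close> uniformly in \<open>x\<close>, falls short: large deviation bounds dispose of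
  times up to \<open>r powr (2 - eps)\<close> only, and that error integrated from there exceeds
  \<open>r powr (-d)\<close>. The two Gaussians split the error. The part without spatial decay has
  relative size \<open>1 / t^2\<close> and may be integrated from an earlier time. The part of
  relative size \<open>1 / t\<close> is a difference of Gaussian densities and keeps a factor
  \<open>exp (- |x|^2 / (8 t))\<close>, which suppresses it before time \<open>r^2\<close>. Only
  differences of values of \<open>a\<close> are compared, so its additive constant is never
  computed. Near the origin, where the expansion is too coarse, the maximum principle for
  \<open>a\<close> takes its place.\<close>

definition lap :: "(int ^ 'n \<Rightarrow> real) \<Rightarrow> int ^ 'n \<Rightarrow> real" where
  "lap f x = (\<Sum>i\<in>UNIV. f (x + axis i 1) + f (x - axis i 1)) / (2 * real CARD('n)) - f x"

abbreviation lnorm :: "int ^ 'n \<Rightarrow> real" where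
  "lnorm x \<equiv> norm (to_real_vec x)"

abbreviation point_mass :: "'a \<Rightarrow> 'a \<Rightarrow> real" where
  "point_mass x \<equiv> (\<lambda>y. if y = x then 1 else 0)"

section \<open>Linearity of the discrete Laplacian and its value on point masses\<close>

lemma lap_add: "lap (\<lambda>x. f x + g x) x = lap f x + lap g x"
  by (simp add: lap_def sum.distrib add_divide_distrib algebra_simps)

lemma lap_cmult: "lap (\<lambda>x. c * f x) x = c * lap f x"
  by (simp add: lap_def right_diff_distrib sum_distrib_left distrib_left)

lemma lap_diff: "lap (\<lambda>x. f x - g x) x = lap f x - lap g x"
  by (simp add: lap_def sum_subtractf sum.distrib diff_divide_distrib add_divide_distrib algebra_simps)

lemma lap_const: "lap (\<lambda>x. c) (x :: int ^ 'n) = 0"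
  by (simp add: lap_def)

lemma lattice_adj_iff:
  "lattice_adj (x :: int ^ 'n) y \<longleftrightarrow> (\<exists>i. y + axis i 1 = x \<or> y - axis i 1 = x)"
proof
  assume "lattice_adj x y"
  then have s: "(\<Sum>i\<in>UNIV. \<bar>x $ i - y $ i\<bar>) = 1"
    by (simp add: lattice_adj_def)
  have "\<exists>i. \<bar>x $ i - y $ i\<bar> \<noteq> 0"
  proof (rule ccontr)
    assume "\<not> ?thesis"
    with s show False by simp
  qed
  then obtain i where i: "\<bar>x $ i - y $ i\<bar> \<noteq> 0" ..
  have "(\<Sum>j\<in>UNIV. \<bar>x $ j - y $ j\<bar>) = \<bar>x $ i - y $ i\<bar> + (\<Sum>j\<in>UNIV - {i}. \<bar>x $ j - y $ j\<bar>)"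
    by (simp add: sum.remove)
  moreover have "(\<Sum>j\<in>UNIV - {i}. \<bar>x $ j - y $ j\<bar>) \<ge> 0"
    by (simp add: sum_nonneg)
  ultimately have 1: "\<bar>x $ i - y $ i\<bar> = 1" and "(\<Sum>j\<in>UNIV - {i}. \<bar>x $ j - y $ j\<bar>) = 0"
    using s i by linarith+
  then have 2: "x $ j = y $ j" if "j \<noteq> i" for j
    using that by (simp add: sum_nonneg_eq_0_iff)
  have "y + axis i 1 = x \<or> y - axis i 1 = x"
    using 1 2 by (auto simp: vec_eq_iff axis_def abs_if split: if_splits)
  then show "\<exists>i. y + axis i 1 = x \<or> y - axis i 1 = x" ..
next
  assume "\<exists>i. y + axis i 1 = x \<or> y - axis i 1 = x"
  then obtain i where "y + axis i 1 = x \<or> y - axis i 1 = x" ..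
  then have "\<bar>x $ j - y $ j\<bar> = (if j = i then 1 else 0)" for j
    by (auto simp: axis_def)
  then show "lattice_adj x y"
    by (simp add: lattice_adj_def)
qed

lemma axis_one_inject: "axis i (1::int) = axis j 1 \<longleftrightarrow> i = j"
  by (simp add: axis_eq_axis)

lemma axis_one_neq_minus: "axis i (1::int) \<noteq> - axis j 1"
  by (auto simp: vec_eq_iff axis_def intro!: exI[of _ i])

lemma lap_point_mass:
  fixes x y :: "int ^ 'n"
  shows "lap (point_mass x) y =
    (if y = x then -1 else if lattice_adj x y then 1 / (2 * real CARD('n)) else 0)"
proof -
  have neq: "y + axis i 1 \<noteq> y" "y - axis i 1 \<noteq> y" for i
    by (auto simp: vec_eq_iff axis_def)
  consider "y = x" | "y \<noteq> x" "lattice_adj x y" | "y \<noteq> x" "\<not> lattice_adj x y"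
    by blast
  then show ?thesis
  proof cases
    case 1
    then show ?thesis using neq by (simp add: lap_def)
  next
    case 2
    then obtain i where i: "y + axis i 1 = x \<or> y - axis i 1 = x"
      by (auto simp: lattice_adj_iff)
    then have i': "axis i 1 = x - y \<or> - axis i 1 = x - y"
      by (auto simp: algebra_simps)
    have f: "(y + axis j 1 = x) = (axis j 1 = x - y)" "(y - axis j 1 = x) = (- axis j 1 = x - y)"
      for j by (auto simp: algebra_simps)
    have "(if y + axis j 1 = x then 1 else 0) + (if y - axis j 1 = x then 1 else 0)
        = (if j = i then 1 else (0::real))" for j
    proof -
      have "(y + axis j 1 = x \<or> y - axis j 1 = x) \<longleftrightarrow> j = i"
        and "\<not> (y + axis j 1 = x \<and> y - axis j 1 = x)"
        using i' axis_one_neq_minus[of i j] axis_one_neq_minus[of j i] axis_one_neq_minus[of j j]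
        unfolding f by (auto simp: axis_one_inject dest: sym)
      then show ?thesis by auto
    qed
    then have "lap (point_mass x) y = (\<Sum>j\<in>UNIV. if j = i then 1 else 0) / (2 * real CARD('n)) - point_mass x y"
      unfolding lap_def by simp
    with 2 show ?thesis by simp
  next
    case 3
    then show ?thesis by (simp add: lap_def lattice_adj_iff)
  qed
qed

text \<open>The emitted mass \<open>max 0 (\<mu> x - 1)\<close> treats stable and unstable sites at
  once. Each toppling adds a multiple of a Laplacian, and summing over time gives the odometer
  identity.\<close>

lemma topple_eq: "topple x \<mu> y = \<mu> y + max 0 (\<mu> x - 1) * lap (point_mass x) y"
  by (auto simp: topple_def lap_point_mass)

lemma to_real_vec_add: "to_real_vec (x + y) = to_real_vec x + to_real_vec y"
  by (simp add: to_real_vec_def vec_eq_iff)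

lemma to_real_vec_diff: "to_real_vec (x - y) = to_real_vec x - to_real_vec y"
  by (simp add: to_real_vec_def vec_eq_iff)

lemma to_real_vec_zero: "to_real_vec 0 = 0"
  by (simp add: to_real_vec_def vec_eq_iff)

lemma to_real_vec_axis: "to_real_vec (axis i 1) = axis i 1"
  by (auto simp: to_real_vec_def vec_eq_iff axis_def)

lemma to_real_vec_inj: "to_real_vec x = to_real_vec y \<longleftrightarrow> x = y"
  by (auto simp: to_real_vec_def vec_eq_iff)

lemma lnorm_zero_iff: "lnorm x = 0 \<longleftrightarrow> x = 0"
  using to_real_vec_inj[of x 0] by (simp add: to_real_vec_zero)

lemmas to_real_vec_simps = to_real_vec_add to_real_vec_diff to_real_vec_zero to_real_vec_axis

lemma lnorm_step:
  assumes "z = y + axis i 1 \<or> z = y - axis i 1"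
  shows "\<bar>lnorm z - lnorm y\<bar> \<le> 1"
proof -
  have "lnorm (z - y) = 1" using assms by (auto simp: to_real_vec_simps)
  then show ?thesis
    using norm_triangle_ineq3[of "to_real_vec z" "to_real_vec y"] by (simp add: to_real_vec_diff)
qed

lemma norm_shift_squares:
  fixes x :: "real ^ 'n"
  shows "(norm (x + axis i 1))\<^sup>2 = (norm x)\<^sup>2 + 2 * (x $ i) + 1"
    and "(norm (x - axis i 1))\<^sup>2 = (norm x)\<^sup>2 - 2 * (x $ i) + 1"
  by (simp_all add: power2_norm_eq_inner inner_add_left inner_add_right inner_diff_left
      inner_diff_right inner_axis inner_axis' inner_axis_axis)

text \<open>Opposite unit steps cancel the linear term. The centre \<open>y\<close> is free because
  it is the origin in \<open>obstacle\<close> and an occupied site in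
  \<open>occupied_sites_near\<close>.\<close>

lemma lap_norm_square: "lap (\<lambda>x. (lnorm (x - y))\<^sup>2) x = 1" for x y :: "int ^ 'n"
proof -
  have "lnorm (x + axis i 1 - y) ^ 2 + lnorm (x - axis i 1 - y) ^ 2 = 2 * lnorm (x - y) ^ 2 + 2" for i
  proof -
    have 1: "to_real_vec (x + axis i 1 - y) = to_real_vec (x - y) + axis i 1"
      and 2: "to_real_vec (x - axis i 1 - y) = to_real_vec (x - y) - axis i 1"
      by (simp_all add: to_real_vec_simps)
    show ?thesis unfolding 1 2 norm_shift_squares by simp
  qed
  then show ?thesis by (simp add: lap_def field_simps)
qed

lemma finite_lattice_ball: "finite {x :: int ^ 'n. lnorm x \<le> \<rho>}"
proof -
  let ?B = "{- \<lceil>\<rho>\<rceil> .. \<lceil>\<rho>\<rceil>}"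
  have "finite (vec_nth ` {x :: int ^ 'n. lnorm x \<le> \<rho>})"
  proof (rule finite_subset)
    have "x $ i \<in> ?B" if "lnorm x \<le> \<rho>" for x :: "int ^ 'n" and i
    proof -
      have "\<bar>real_of_int (x $ i)\<bar> \<le> lnorm x"
        using component_le_norm_cart[of "to_real_vec x" i] by (simp add: to_real_vec_def)
      with that have "\<bar>real_of_int (x $ i)\<bar> \<le> \<rho>" by simp
      then show ?thesis unfolding atLeastAtMost_iff by linarith
    qed
    then show "vec_nth ` {x :: int ^ 'n. lnorm x \<le> \<rho>} \<subseteq> PiE UNIV (\<lambda>_. ?B)"
      unfolding PiE_UNIV_domain by blast
    show "finite (PiE (UNIV :: 'n set) (\<lambda>_. ?B))" by (intro finite_PiE) auto
  qed
  then show ?thesis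
    by (rule finite_imageD) (simp add: inj_on_def vec_nth_inject)
qed

section \<open>The maximum principle on finite lattice sets\<close>

lemma subharmonic_step:
  fixes f :: "int ^ 'n \<Rightarrow> real"
  assumes "lap f p \<ge> 0"
    and le: "\<And>i z. z = p + axis i 1 \<or> z = p - axis i 1 \<Longrightarrow> f z \<le> f p"
    and z: "z = p + axis i 1 \<or> z = p - axis i 1"
  shows "f z = f p"
proof (rule ccontr)
  assume "f z \<noteq> f p"
  with le[OF z] have lt: "f z < f p" by simp
  have "(\<Sum>j\<in>UNIV. f (p + axis j 1) + f (p - axis j 1)) < (\<Sum>j\<in>(UNIV :: 'n set). 2 * f p)"
  proof (rule sum_strict_mono_ex1)
    show "\<forall>j\<in>UNIV. f (p + axis j 1) + f (p - axis j 1) \<le> 2 * f p"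
    proof
      fix j
      show "f (p + axis j 1) + f (p - axis j 1) \<le> 2 * f p"
        using le[of "p + axis j 1" j] le[of "p - axis j 1" j] by simp
    qed
    have "f (p + axis i 1) + f (p - axis i 1) < 2 * f p"
      using z lt le[of "p + axis i 1" i] le[of "p - axis i 1" i] by auto
    then show "\<exists>j\<in>UNIV. f (p + axis j 1) + f (p - axis j 1) < 2 * f p" by blast
  qed simp
  then have "lap f p < 0" by (simp add: lap_def field_simps)
  with assms(1) show False by simp
qed

text \<open>If every exit site were below \<open>f x\<close>, all neighbours of a maximiser over
  \<open>A\<close> would be maximisers in \<open>A\<close>, which is impossible for one farthest
  from the origin. The exit site comes with a neighbour in \<open>A\<close> so that
  \<open>lnorm_step\<close> can locate it.\<close>

lemma maximum_principle:
  fixes f :: "int ^ 'n \<Rightarrow> real"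
  assumes "finite A" "x \<in> A" and sub: "\<And>y. y \<in> A \<Longrightarrow> lap f y \<ge> 0"
  obtains z y i where "z \<notin> A" "y \<in> A" "z = y + axis i 1 \<or> z = y - axis i 1" "f x \<le> f z"
proof (rule ccontr)
  note found = that
  assume "\<not> thesis"
  then have out: "f z < f x" if "z \<notin> A" "y \<in> A" "z = y + axis i 1 \<or> z = y - axis i 1" for z y i
    using found[OF that] by force
  define V where "V = Max (f ` A)"
  define A' where "A' = {y \<in> A. f y = V}"
  have fin: "finite A'" using assms by (simp add: A'_def)
  have "V \<in> f ` A" unfolding V_def by (rule Max_in) (use assms in auto)
  then have ne: "A' \<noteq> {}" by (auto simp: A'_def)
  have le: "f y \<le> V" if "y \<in> A" for y
    using that assms by (simp add: V_def)
  have "Max ((\<lambda>y. lnorm y) ` A') \<in> (\<lambda>y. lnorm y) ` A'"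
    by (rule Max_in) (use fin ne in auto)
  then obtain p where p: "p \<in> A'" and "lnorm p = Max ((\<lambda>y. lnorm y) ` A')" by auto
  then have pmax: "lnorm y \<le> lnorm p" if "y \<in> A'" for y
    using that fin by simp
  have pA: "p \<in> A" "f p = V" using p by (auto simp: A'_def)
  have nb: "f z \<le> f p" if "z = p + axis i 1 \<or> z = p - axis i 1" for z i
    using out[OF _ pA(1) that] le[of z] le[OF assms(2)] pA by (cases "z \<in> A") auto
  have eq: "f z = f p" if "z = p + axis i 1 \<or> z = p - axis i 1" for z i
    using subharmonic_step[OF sub[OF pA(1)] _ that] nb by blast
  have inA: "z \<in> A'" if "z = p + axis i 1 \<or> z = p - axis i 1" for z i
  proof -
    have "z \<in> A"
      using out[OF _ pA(1) that] eq[OF that] le[OF assms(2)] pA by force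
    then show ?thesis using eq[OF that] pA by (simp add: A'_def)
  qed
  fix i :: 'n
  \<comment> \<open>The squared norm changes by \<open>1 + 2 * p_i\<close> or
    \<open>1 - 2 * p_i\<close>, so the step along the sign of the coordinate increases it.\<close>
  have "\<exists>z \<in> {p + axis i 1, p - axis i 1}. (lnorm z)\<^sup>2 > (lnorm p)\<^sup>2"
    using norm_shift_squares[of "to_real_vec p" i]
    by (cases "to_real_vec p $ i \<ge> 0") (auto simp: to_real_vec_simps)
  then obtain z where z: "z = p + axis i 1 \<or> z = p - axis i 1" "(lnorm z)\<^sup>2 > (lnorm p)\<^sup>2"
    by blast
  from pmax[OF inA[OF z(1)]] have "(lnorm z)\<^sup>2 \<le> (lnorm p)\<^sup>2" by (simp add: power_mono)
  with z(2) show False by simp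
qed

section \<open>Odometer, least action and the limit of the topplings\<close>

fun odometer :: "real \<Rightarrow> (nat \<Rightarrow> int ^ 'n) \<Rightarrow> nat \<Rightarrow> (int ^ 'n \<Rightarrow> real)" where
  "odometer m s 0 = (\<lambda>x. 0)"
| "odometer m s (Suc k) =
    (\<lambda>x. odometer m s k x + max 0 (sandpile m s k (s k) - 1) * point_mass (s k) x)"

lemma sandpile_eq_lap_odometer:
  "sandpile m s k x = m * point_mass 0 x + lap (odometer m s k) x"
proof (induction k arbitrary: x)
  case 0
  then show ?case by (simp add: lap_const)
next
  case (Suc k)
  then show ?case by (simp add: topple_eq lap_add lap_cmult)
qed

lemma sandpile_nonneg: "m \<ge> 0 \<Longrightarrow> sandpile m s k x \<ge> 0"
  by (induction k arbitrary: x) (auto simp: topple_def)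

text \<open>A toppling resets its site to mass 1, and topplings elsewhere can only add to it
  afterwards.\<close>

lemma sandpile_ge_one:
  assumes "odometer m s k x > 0"
  shows "sandpile m s k x \<ge> 1"
  using assms
proof (induction k)
  case (Suc k)
  show ?case
  proof (cases "x = s k")
    case True
    then show ?thesis
      using Suc by (cases "sandpile m s k (s k) \<le> 1") (simp_all add: topple_def)
  next
    case False
    then have "lap (point_mass (s k)) x \<ge> 0" by (simp add: lap_point_mass)
    then have "sandpile m s (Suc k) x \<ge> sandpile m s k x" by (simp add: topple_eq)
    with False Suc show ?thesis by simp
  qed
qed auto

text \<open>The least action principle: a toppling at \<open>x\<close> leaves mass exactly 1 there, so
  the site \<open>x\<close> cannot be the first one at which the odometer exceeds \<open>U\<close>.\<close>

lemma odometer_le: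
  fixes s :: "nat \<Rightarrow> int ^ 'n"
  assumes U: "\<And>x. U x \<ge> 0" "\<And>x. m * point_mass 0 x + lap U x \<le> 1"
  shows "odometer m s k x \<le> U x"
proof (induction k arbitrary: x)
  case 0
  then show ?case by (simp add: U)
next
  case (Suc k)
  define v where "v = odometer m s (Suc k)"
  show ?case
  proof (cases "x = s k \<and> sandpile m s k x > 1")
    case False
    then have "x \<noteq> s k \<or> sandpile m s k (s k) \<le> 1" by auto
    then have "odometer m s (Suc k) x = odometer m s k x" by auto
    then show ?thesis using Suc[of x] by (simp only:)
  next
    case True
    have other: "v y \<le> U y" if "y \<noteq> x" for y
      using Suc[of y] True that by (auto simp: v_def)
    from True have "x = s k" "\<not> sandpile m s k (s k) \<le> 1" by auto
    then have "sandpile m s (Suc k) x = 1"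
      by (simp add: topple_def)
    then have one: "m * point_mass 0 x + lap v x = 1"
      unfolding v_def sandpile_eq_lap_odometer .
    have "(\<Sum>i\<in>UNIV. v (x + axis i 1) + v (x - axis i 1)) \<le> (\<Sum>i\<in>UNIV. U (x + axis i 1) + U (x - axis i 1))"
      by (intro sum_mono add_mono other) (auto simp: vec_eq_iff axis_def)
    then have "lap v x + v x \<le> lap U x + U x"
      by (simp add: lap_def divide_right_mono)
    then show ?thesis using one U(2)[of x] by (simp add: v_def)
  qed
qed

text \<open>Each of the \<open>2 d\<close> shifts meets \<open>x\<close> exactly once inside
  \<open>A\<close>, which balances the \<open>-1\<close> at \<open>x\<close> itself.\<close>

lemma sum_lap_point_mass:
  fixes x :: "int ^ 'n"
  assumes "finite A" "x \<in> A" "\<And>i. x + axis i 1 \<in> A" "\<And>i. x - axis i 1 \<in> A"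
  shows "(\<Sum>y\<in>A. lap (point_mass x) y) = 0"
proof -
  have 1: "(y + axis i 1 = x) = (y = x - axis i 1)" "(y - axis i 1 = x) = (y = x + axis i 1)" for y and i :: 'n
    by (auto simp: algebra_simps)
  have "(\<Sum>y\<in>A. \<Sum>i\<in>UNIV. point_mass x (y + axis i 1) + point_mass x (y - axis i 1))
      = (\<Sum>i\<in>(UNIV :: 'n set). 2)"
    by (subst sum.swap) (use assms in \<open>simp add: 1 sum.distrib\<close>)
  then show ?thesis
    using assms by (simp add: lap_def sum_subtractf flip: sum_divide_distrib)
qed

text \<open>Conservation of mass with a finite support. It serves to make the set of fully occupied
  sites finite, as the maximum principle requires.\<close>

lemma sandpile_total:
  fixes s :: "nat \<Rightarrow> int ^ 'n"
  shows "\<exists>A. finite A \<and> (\<forall>x. x \<notin> A \<longrightarrow> sandpile m s k x = 0) \<and> sum (sandpile m s k) A = m"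
proof (induction k)
  case 0
  show ?case by (rule exI[of _ "{0}"]) auto
next
  case (Suc k)
  then obtain A where A: "finite A" "\<And>x. x \<notin> A \<Longrightarrow> sandpile m s k x = 0" "sum (sandpile m s k) A = m"
    by blast
  define A' where "A' = A \<union> {s k} \<union> range (\<lambda>i. s k + axis i 1) \<union> range (\<lambda>i. s k - axis i 1)"
  have fin: "finite A'" using A by (simp add: A'_def)
  have "sum (sandpile m s k) A' = m"
    using A by (subst sum.mono_neutral_right[OF fin, of A]) (auto simp: A'_def)
  moreover have "(\<Sum>y\<in>A'. lap (point_mass (s k)) y) = 0"
    by (rule sum_lap_point_mass[OF fin]) (auto simp: A'_def)
  ultimately have "sum (sandpile m s (Suc k)) A' = m"
    by (simp add: topple_eq[abs_def] sum.distrib flip: sum_distrib_left)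
  moreover have "sandpile m s (Suc k) x = 0" if "x \<notin> A'" for x
  proof -
    have "\<not> lattice_adj (s k) x"
      using that by (auto simp: lattice_adj_iff A'_def image_iff algebra_simps)
    then show ?thesis using that A by (auto simp: A'_def topple_eq lap_point_mass)
  qed
  ultimately show ?case using fin by blast
qed

lemma sum_sandpile_le:
  assumes "m \<ge> 0" "finite F"
  shows "sum (sandpile m s k) F \<le> m"
proof -
  obtain A where A: "finite A" "\<And>x. x \<notin> A \<Longrightarrow> sandpile m s k x = 0" "sum (sandpile m s k) A = m"
    using sandpile_total[of m s k] by blast
  have "sum (sandpile m s k) F \<le> sum (sandpile m s k) (F \<union> A)"
    by (intro sum_mono2) (use assms A in \<open>auto simp: sandpile_nonneg\<close>)
  also have "\<dots> = sum (sandpile m s k) A"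
    by (rule sum.mono_neutral_right) (use assms A in auto)
  finally show ?thesis using A by simp
qed

text \<open>The limit solves an obstacle problem: \<open>u\<close> is the least nonnegative function
  whose Laplacian keeps the mass at most 1. The competitor \<open>U\<close> bounds the increasing
  odometers, which makes their limit exist.\<close>

lemma sandpile_limit:
  fixes s :: "nat \<Rightarrow> int ^ 'n"
  assumes m: "m \<ge> 0" and vis: "visits_all s"
    and lim: "\<And>x. (\<lambda>k. sandpile m s k x) \<longlonglongrightarrow> \<mu> x"
    and U: "\<And>x :: int ^ 'n. U x \<ge> 0" "\<And>x. m * point_mass 0 x + lap U x \<le> 1"
  obtains u where "\<And>x. 0 \<le> u x" "\<And>x. \<mu> x = m * point_mass 0 x + lap u x"
    "\<And>x. 0 \<le> \<mu> x" "\<And>x. \<mu> x \<le> 1" "\<And>x. 0 < u x \<Longrightarrow> \<mu> x = 1"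
    "\<And>V x. (\<And>x. V x \<ge> 0) \<Longrightarrow> (\<And>x. m * point_mass 0 x + lap V x \<le> 1) \<Longrightarrow> u x \<le> V x"
    "finite {x. \<mu> x = 1}"
proof -
  define u where "u x = (SUP k. odometer m s k x)" for x
  have bdd: "bdd_above (range (\<lambda>k. odometer m s k x))" for x
    by (rule bdd_aboveI2[of _ _ "U x"]) (rule odometer_le[OF U])
  have inc: "incseq (\<lambda>k. odometer m s k x)" for x
    by (rule incseq_SucI) simp
  have ulim: "(\<lambda>k. odometer m s k x) \<longlonglongrightarrow> u x" for x
    unfolding u_def using LIMSEQ_incseq_SUP[OF bdd inc] .
  have ge: "odometer m s k x \<le> u x" for k x
    unfolding u_def by (rule cSUP_upper[OF _ bdd]) simp
  have mu: "\<mu> x = m * point_mass 0 x + lap u x" for x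
  proof (rule LIMSEQ_unique[OF lim])
    show "(\<lambda>k. sandpile m s k x) \<longlonglongrightarrow> m * point_mass 0 x + lap u x"
      unfolding sandpile_eq_lap_odometer lap_def
      by (intro tendsto_intros ulim) simp
  qed
  have mu0: "0 \<le> \<mu> x" for x
    by (rule LIMSEQ_le_const[OF lim]) (auto intro: sandpile_nonneg m)
  \<comment> \<open>A limit above 1 would keep the mass above 1 from some time on, but a later visit
    leaves at most 1 at the site.\<close>
  have mu1: "\<mu> x \<le> 1" for x
  proof (rule ccontr)
    assume "\<not> \<mu> x \<le> 1"
    then have "eventually (\<lambda>k. sandpile m s k x > 1) sequentially"
      using order_tendstoD(1)[OF lim] by simp
    then obtain N where N: "\<And>k. k \<ge> N \<Longrightarrow> sandpile m s k x > 1"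
      by (auto simp: eventually_sequentially)
    have "infinite {k. s k = x}" using vis by (simp add: visits_all_def)
    then obtain k where k: "k \<ge> N" "s k = x"
      by (metis (mono_tags, lifting) finite_nat_set_iff_bounded mem_Collect_eq not_le_imp_less nle_le)
    then have "sandpile m s (Suc k) x \<le> 1" by (auto simp: topple_def)
    with N[of "Suc k"] k show False by simp
  qed
  have one: "\<mu> x = 1" if "u x > 0" for x
  proof (rule antisym[OF mu1])
    from order_tendstoD(1)[OF ulim that]
    have "eventually (\<lambda>k. sandpile m s k x \<ge> 1) sequentially"
      by eventually_elim (rule sandpile_ge_one)
    then show "1 \<le> \<mu> x"
      by (rule tendsto_lowerbound[OF lim]) simp
  qed
  \<comment> \<open>On a finite set of occupied sites the limiting mass equals the cardinality, and
    it is at most \<open>m\<close>.\<close>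
  have "card F \<le> nat \<lfloor>m\<rfloor>" if "F \<subseteq> {x. \<mu> x = 1}" "finite F" for F
  proof -
    have "(\<lambda>k. sum (sandpile m s k) F) \<longlonglongrightarrow> sum \<mu> F"
      by (intro tendsto_sum lim)
    then have "sum \<mu> F \<le> m"
      by (rule LIMSEQ_le_const2) (auto intro: sum_sandpile_le m that)
    moreover have "sum \<mu> F = real (card F)"
      using that by (simp add: subset_eq)
    ultimately show ?thesis by (simp add: le_nat_floor)
  qed
  then have fin: "finite {x. \<mu> x = 1}"
    using finite_if_finite_subsets_card_bdd by blast
  have least: "u x \<le> V x"
    if "\<And>x. V x \<ge> 0" "\<And>x. m * point_mass 0 x + lap V x \<le> 1" for V x
    by (rule LIMSEQ_le_const2[OF ulim]) (use odometer_le[OF that] in auto)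
  have nn: "0 \<le> u x" for x
    using ge[of 0 x] by simp
  show ?thesis
    by (rule that[of u]) (fact nn mu mu0 mu1 fin | erule one | rule least; assumption)+
qed

subsection \<open>The heat kernel of the one-dimensional walk\<close>

lemma has_bochner_integral_has_integral:
  fixes f :: "real \<Rightarrow> real"
  assumes "has_bochner_integral lborel f I"
  shows "(f has_integral I) UNIV"
  using has_integral_integral_lborel[of f] assms by (simp add: has_bochner_integral_iff)

text \<open>The substitution \<open>sqrt c * x\<close> reduces to \<open>c = 1\<close>. Only the
  scaling in \<open>c\<close> matters later, so the moment stays an unspecified
  \<open>K\<close>.\<close>

lemma gaussian_moment_integral:
  fixes n :: nat
  obtains K where "K > 0"
    "\<And>c. c > 0 \<Longrightarrow> ((\<lambda>x::real. x ^ (2 * n) * exp (- (c * x\<^sup>2))) has_integral K / sqrt c ^ (2 * n + 1)) UNIV"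
proof
  define K where "K = sqrt pi * (fact (2 * n) / (2 ^ (2 * n) * fact n))"
  show "K > 0" by (simp add: K_def)
  fix c :: real assume c: "c > 0"
  have "has_bochner_integral lborel (\<lambda>x::real. exp (-x\<^sup>2) * x ^ (2 * n)) K"
    using has_bochner_integral_even_function[OF gaussian_moment_even_pos[where k = n]] by (simp add: K_def)
  then have "has_bochner_integral lborel (\<lambda>x::real. exp (-(0 + sqrt c * x)\<^sup>2) * (0 + sqrt c * x) ^ (2 * n)) (K / sqrt c)"
    using c by (subst (asm) lborel_has_bochner_integral_real_affine_iff[where c = "sqrt c" and t = 0])
      (auto simp: divide_inverse mult.commute)
  then have "has_bochner_integral lborel
      (\<lambda>x::real. (1 / sqrt c ^ (2 * n)) * (exp (-(0 + sqrt c * x)\<^sup>2) * (0 + sqrt c * x) ^ (2 * n)))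
      ((1 / sqrt c ^ (2 * n)) * (K / sqrt c))"
    by (rule has_bochner_integral_mult_right)
  also have "(\<lambda>x::real. (1 / sqrt c ^ (2 * n)) * (exp (-(0 + sqrt c * x)\<^sup>2) * (0 + sqrt c * x) ^ (2 * n)))
      = (\<lambda>x. x ^ (2 * n) * exp (- (c * x\<^sup>2)))"
    using c by (auto simp: fun_eq_iff power_mult_distrib)
  also have "(1 / sqrt c ^ (2 * n)) * (K / sqrt c) = K / sqrt c ^ (2 * n + 1)"
    by (simp add: field_simps)
  finally show "((\<lambda>x::real. x ^ (2 * n) * exp (- (c * x\<^sup>2))) has_integral K / sqrt c ^ (2 * n + 1)) UNIV"
    by (rule has_bochner_integral_has_integral)
qed

text \<open>The real part of the characteristic function of the standard normal law at
  \<open>k / sqrt s\<close>, rescaled by \<open>sqrt s\<close>.\<close>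

lemma gaussian_fourier:
  fixes k s :: real
  assumes s: "s > 0"
  shows "((\<lambda>x. exp (- (s * x\<^sup>2 / 2)) * cos (k * x)) has_integral sqrt (2 * pi / s) * exp (- (k\<^sup>2 / (2 * s)))) UNIV"
proof -
  define t where "t = k / sqrt s"
  have int: "integrable lborel (\<lambda>x. std_normal_density x *\<^sub>R iexp (t * x))"
    by (rule Bochner_Integration.integrable_bound[OF integrable_normal_density[of 1 0]]) auto
  have "char std_normal_distribution t = (LINT x|lborel. std_normal_density x *\<^sub>R iexp (t * x))"
    unfolding char_def by (subst integral_density) auto
  then have "has_bochner_integral lborel (\<lambda>x. std_normal_density x *\<^sub>R iexp (t * x)) (complex_of_real (exp (- (t\<^sup>2) / 2)))"
    using int by (simp add: has_bochner_integral_iff char_std_normal_distribution)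
  from has_bochner_integral_bounded_linear[OF bounded_linear_Re this]
  have "has_bochner_integral lborel (\<lambda>x. std_normal_density x * cos (t * x)) (exp (- (t\<^sup>2) / 2))"
    by (simp add: Re_exp)
  then have "has_bochner_integral lborel (\<lambda>x. std_normal_density (0 + sqrt s * x) * cos (t * (0 + sqrt s * x))) (exp (- (t\<^sup>2) / 2) /\<^sub>R \<bar>sqrt s\<bar>)"
    by (rule lborel_has_bochner_integral_real_affine_iff[THEN iffD1, rotated]) (use s in simp)
  then have "has_bochner_integral lborel
      (\<lambda>x. sqrt (2 * pi) * (std_normal_density (0 + sqrt s * x) * cos (t * (0 + sqrt s * x))))
      (sqrt (2 * pi) * (exp (- (t\<^sup>2) / 2) /\<^sub>R \<bar>sqrt s\<bar>))"
    by (rule has_bochner_integral_mult_right)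
  also have "(\<lambda>x. sqrt (2 * pi) * (std_normal_density (0 + sqrt s * x) * cos (t * (0 + sqrt s * x))))
      = (\<lambda>x. exp (- (s * x\<^sup>2 / 2)) * cos (k * x))"
    using s by (simp add: fun_eq_iff std_normal_density_def t_def power_mult_distrib)
  also have "sqrt (2 * pi) * (exp (- (t\<^sup>2) / 2) /\<^sub>R \<bar>sqrt s\<bar>) = sqrt (2 * pi / s) * exp (- (k\<^sup>2 / (2 * s)))"
  proof -
    have 1: "- (t\<^sup>2) / 2 = - (k\<^sup>2 / (2 * s))" using s by (simp add: t_def power_divide)
    show ?thesis unfolding 1 real_sqrt_divide using s by (simp add: field_simps del: real_sqrt_mult)
  qed
  finally show ?thesis
    by (rule has_bochner_integral_has_integral)
qed

text \<open>For \<open>symbol_difference\<close>, these control the defect of \<open>cos\<close>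
  against its quadratic part: its sign, its size of order 4, and its leading term up to order
  6.\<close>

lemma cos_bounds_quartic:
  fixes x :: real
  shows "cos x \<le> 1 - x\<^sup>2 / 2 + x ^ 4 / 24" "\<bar>cos x - (1 - x\<^sup>2 / 2 + x ^ 4 / 24)\<bar> \<le> x ^ 6 / 720"
    "1 - x\<^sup>2 / 2 \<le> cos x"
proof -
  obtain t where "cos x = (\<Sum>m<4. cos_coeff m * x ^ m) + (cos (t + 1/2 * real 4 * pi) / fact 4) * x ^ 4"
    using Maclaurin_cos_expansion[of x 4] by blast
  moreover have "(\<Sum>m<4. cos_coeff m * x ^ m) = cos_coeff 0 + cos_coeff 1 * x + cos_coeff 2 * x\<^sup>2 + cos_coeff 3 * x ^ 3"
    by (simp add: eval_nat_numeral)
  moreover have fact4: "fact 4 = (24 :: real)" by (simp add: eval_nat_numeral)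
  ultimately have 1: "cos x = 1 - x\<^sup>2 / 2 + cos (t + 2 * pi) / 24 * x ^ 4"
    by (simp add: cos_coeff_def)
  have "cos (t + 2 * pi) / 24 * x ^ 4 \<le> 1 / 24 * x ^ 4"
    by (intro mult_right_mono divide_right_mono) auto
  with 1 show "cos x \<le> 1 - x\<^sup>2 / 2 + x ^ 4 / 24" by simp
  obtain t where "cos x = (\<Sum>m<6. cos_coeff m * x ^ m) + (cos (t + 1/2 * real 6 * pi) / fact 6) * x ^ 6"
    using Maclaurin_cos_expansion[of x 6] by blast
  moreover have "(\<Sum>m<6. cos_coeff m * x ^ m) = cos_coeff 0 + cos_coeff 1 * x + cos_coeff 2 * x\<^sup>2
      + cos_coeff 3 * x ^ 3 + cos_coeff 4 * x ^ 4 + cos_coeff 5 * x ^ 5"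
    by (simp add: eval_nat_numeral)
  moreover have "fact 6 = (720 :: real)" by (simp add: eval_nat_numeral)
  ultimately have "cos x - (1 - x\<^sup>2 / 2 + x ^ 4 / 24) = cos (t + 3 * pi) / 720 * x ^ 6"
    using fact4 by (simp add: cos_coeff_def)
  moreover have "\<bar>cos (t + 3 * pi) / 720 * x ^ 6\<bar> \<le> 1 / 720 * x ^ 6"
    unfolding abs_mult by (intro mult_mono) (auto simp: power_even_abs)
  ultimately show "\<bar>cos x - (1 - x\<^sup>2 / 2 + x ^ 4 / 24)\<bar> \<le> x ^ 6 / 720" by (simp only:)
  have "1 - cos x = 2 * (sin (x / 2))\<^sup>2"
    using cos_double_sin[of "x / 2"] by simp
  moreover have "(sin (x / 2))\<^sup>2 \<le> (x / 2)\<^sup>2"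
    using abs_sin_x_le_abs_x[of "x / 2"] by (rule abs_le_square_iff[THEN iffD1])
  ultimately show "1 - x\<^sup>2 / 2 \<le> cos x" by (simp add: power_divide)
qed

text \<open>Since \<open>pi^2 <= 10\<close>, the quartic term costs at most \<open>10 / 24\<close>
  of the square and leaves \<open>1/2 - 10/24 = 1/12\<close>. This is the source of the exponents
  \<open>t / 12\<close> below.\<close>

lemma one_minus_cos_ge:
  fixes x :: real
  assumes "\<bar>x\<bar> \<le> pi"
  shows "x\<^sup>2 / 12 \<le> 1 - cos x"
proof -
  have "\<bar>x\<bar> \<le> 3.15" using assms pi_approx by simp
  then have "\<bar>x\<bar>\<^sup>2 \<le> 3.15\<^sup>2" by (intro power_mono) auto
  then have "x\<^sup>2 \<le> 10" by (simp add: power2_eq_square)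
  then have "x\<^sup>2 * x\<^sup>2 \<le> 10 * x\<^sup>2" by (intro mult_right_mono) auto
  then have "x ^ 4 \<le> 10 * x\<^sup>2" by (simp flip: power_add)
  with cos_bounds_quartic(1)[of x] show ?thesis by simp
qed

text \<open>Fourier form of the transition kernel of the continuous-time simple random walk on the
  integers with total jump rate 1, that is, \<open>exp (-t)\<close> times the modified Bessel
  function \<open>I_k t\<close>.\<close>

definition heat1 :: "real \<Rightarrow> int \<Rightarrow> real" where
  "heat1 t k = integral {-pi..pi} (\<lambda>\<theta>. exp (- (t * (1 - cos \<theta>))) * cos (of_int k * \<theta>)) / (2 * pi)"

definition gauss1 :: "real \<Rightarrow> real \<Rightarrow> real" where
  "gauss1 t x = exp (- (x\<^sup>2 / (2 * t))) / sqrt (2 * pi * t)"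

lemma gaussian_fourier':
  fixes k :: real
  assumes "s > 0"
  shows "((\<lambda>x. exp (- (s * x\<^sup>2 / 2)) * cos (k * x)) has_integral 2 * pi * gauss1 s k) UNIV"
proof -
  have "sqrt (2 * pi / s) = 2 * pi / sqrt (2 * pi * s)"
    using assms by (simp add: real_sqrt_divide real_sqrt_mult field_simps)
  then show ?thesis using gaussian_fourier[OF assms, of k] by (simp add: gauss1_def)
qed

lemma heat1_integrable:
  "(\<lambda>\<theta>. exp (- (t * (1 - cos \<theta>))) * cos (of_int k * \<theta>)) integrable_on {-pi..pi}"
  by (intro integrable_continuous_interval continuous_intros)

text \<open>Averaging the expansions of \<open>exp\<close> at \<open>z\<close> and \<open>-z\<close>
  cancels the odd terms.\<close>

lemma cosh_minus_taylor_le: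
  fixes z :: real
  assumes "z \<ge> 0"
  shows "cosh z - 1 - z\<^sup>2 / 2 \<le> z ^ 4 / 24 * exp z" "0 \<le> cosh z - 1 - z\<^sup>2 / 2"
proof -
  obtain t where t: "\<bar>t\<bar> \<le> \<bar>z\<bar>" "exp z = (\<Sum>m<4. z ^ m / fact m) + exp t / fact 4 * z ^ 4"
    using Maclaurin_exp_le[of z 4] by blast
  obtain s where s: "\<bar>s\<bar> \<le> \<bar>-z\<bar>" "exp (-z) = (\<Sum>m<4. (-z) ^ m / fact m) + exp s / fact 4 * (-z) ^ 4"
    using Maclaurin_exp_le[of "-z" 4] by blast
  have eq: "cosh z - 1 - z\<^sup>2 / 2 = (exp t + exp s) / 48 * z ^ 4"
    unfolding cosh_field_def t(2) s(2) by (simp add: eval_nat_numeral algebra_simps)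
  have "exp t \<le> exp z" "exp s \<le> exp z" using t(1) s(1) assms by auto
  moreover have "(a + b) / 48 \<le> c / 24" if "a \<le> c" "b \<le> c" for a b c :: real
    using that by simp
  ultimately have "(exp t + exp s) / 48 \<le> exp z / 24" by blast
  then have "(exp t + exp s) / 48 * z ^ 4 \<le> (exp z / 24) * z ^ 4"
    by (rule mult_right_mono) auto
  then show "cosh z - 1 - z\<^sup>2 / 2 \<le> z ^ 4 / 24 * exp z" using eq by (simp add: mult.commute)
  show "0 \<le> cosh z - 1 - z\<^sup>2 / 2" unfolding eq by simp
qed

lemma exp_minus_taylor_le:
  fixes y :: real
  assumes "y \<ge> 0"
  shows "exp y - 1 - y \<le> y\<^sup>2 / 2 * exp y" "0 \<le> exp y - 1 - y"
proof -
  obtain t where t: "\<bar>t\<bar> \<le> \<bar>y\<bar>" "exp y = (\<Sum>m<2. y ^ m / fact m) + exp t / fact 2 * y ^ 2"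
    using Maclaurin_exp_le[of y 2] by blast
  then have eq: "exp y - 1 - y = exp t / 2 * y\<^sup>2"
    by (simp add: eval_nat_numeral)
  have "exp t \<le> exp y" using t(1) assms by auto
  then have "exp t / 2 * y\<^sup>2 \<le> exp y / 2 * y\<^sup>2"
    by (intro mult_right_mono) auto
  then show "exp y - 1 - y \<le> y\<^sup>2 / 2 * exp y" using eq by (simp add: mult.commute)
  show "0 \<le> exp y - 1 - y" unfolding eq by simp
qed

text \<open>With \<open>h = sqrt (t / 3)\<close> this ensures \<open>t - h >= t / 6\<close>, so that
  both variances \<open>t \<plusminus> h\<close> are positive and comparable to
  \<open>t\<close>.\<close>

lemma sqrt_third_bounds:
  assumes "t \<ge> (1::real)"
  shows "0 < sqrt (t / 3)" "sqrt (t / 3) \<le> 5 * t / 6" "(sqrt (t / 3))\<^sup>2 = t / 3"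
proof -
  show sq: "(sqrt (t / 3))\<^sup>2 = t / 3" using assms by simp
  have "(5 * t / 6)\<^sup>2 - (sqrt (t / 3))\<^sup>2 = t * (25 * t - 12) / 36"
    unfolding sq by (simp add: power2_eq_square field_simps)
  also have "\<dots> \<ge> 0" using assms by (intro divide_nonneg_nonneg mult_nonneg_nonneg) auto
  finally show "sqrt (t / 3) \<le> 5 * t / 6" using assms by (intro power2_le_imp_le[of "sqrt (t / 3)"]) auto
  show "0 < sqrt (t / 3)" using assms by simp
qed

text \<open>The step \<open>h = sqrt (t / 3)\<close> is chosen so that the mean of the Gaussians with variances \<open>t \<plusminus> h\<close>
  has the same fourth cumulant as the simple random walk at time \<open>t\<close>.\<close>

lemma symbol_difference:
  fixes t \<theta> :: real
  assumes t: "t \<ge> 1"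
  defines "h \<equiv> sqrt (t / 3)"
  shows "\<bar>(if \<bar>\<theta>\<bar> \<le> pi then exp (- (t * (1 - cos \<theta>))) else 0) - exp (- (t * \<theta>\<^sup>2 / 2)) * cosh (h * \<theta>\<^sup>2 / 2)\<bar>
     \<le> (t * \<theta> ^ 6 + t\<^sup>2 * \<theta> ^ 8) * exp (- (t / 12 * \<theta>\<^sup>2))"
proof -
  have h0: "h \<ge> 0" and hsq: "h\<^sup>2 = t / 3" and ht: "h \<le> 5 * t / 6"
    using sqrt_third_bounds[OF t] by (simp_all add: h_def)
  define b where "b = t * \<theta>\<^sup>2 / 2"
  define z where "z = h * \<theta>\<^sup>2 / 2"
  have z0: "z \<ge> 0" using h0 by (simp add: z_def)
  \<comment> \<open>The choice of \<open>h\<close> enters here: the second-order term of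
    \<open>cosh z\<close> is exactly the quartic term of
    \<open>t * (cos \<theta> - 1 + \<theta>^2 / 2)\<close>.\<close>
  have z2: "z\<^sup>2 / 2 = t * \<theta> ^ 4 / 24"
    using hsq by (simp add: z_def power_mult_distrib power_divide flip: power_mult)
  have z4: "z ^ 4 / 24 = t\<^sup>2 * \<theta> ^ 8 / 3456"
  proof -
    have "z ^ 4 = (z\<^sup>2)\<^sup>2" by (simp flip: power_mult)
    also have "z\<^sup>2 = t * \<theta> ^ 4 / 12" using z2 by simp
    finally show ?thesis by (simp add: power_mult_distrib power_divide flip: power_mult)
  qed
  \<comment> \<open>\<open>exp (- b + z)\<close> is the symbol of the Gaussian with variance
    \<open>t - h\<close>, the more slowly decaying of the two.\<close>
  have "(t - h) * \<theta>\<^sup>2 \<ge> (t / 6) * \<theta>\<^sup>2" using ht by (intro mult_right_mono) auto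
  then have ebz: "exp (- b + z) \<le> exp (- (t / 12 * \<theta>\<^sup>2))"
    by (simp add: b_def z_def algebra_simps)
  have eb: "exp (- b) \<le> exp (- (t / 12 * \<theta>\<^sup>2))"
    using ebz z0 by (smt (verit) exp_le_cancel_iff)
  let ?E = "exp (- (t / 12 * \<theta>\<^sup>2))"
  show ?thesis
  proof (cases "\<bar>\<theta>\<bar> \<le> pi")
    case False
    have "cosh z \<le> exp z" using z0 by (simp add: cosh_field_def)
    then have "exp (- b) * cosh z \<le> exp (-b) * exp z" by (intro mult_left_mono) auto
    then have 1: "exp (- b) * cosh z \<le> ?E" using ebz unfolding exp_add by (rule order_trans)
    \<comment> \<open>The lattice symbol is absent here. Since \<open>|\<theta>| >= 1\<close>, the
      polynomial factor is at least 1 and the Gaussian tail fits under the bound.\<close>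
    have "\<bar>\<theta>\<bar> \<ge> 1" using False pi_ge_two by linarith
    then have "1 \<le> \<bar>\<theta>\<bar> ^ 6" by (rule one_le_power)
    then have "1 * 1 \<le> t * \<theta> ^ 6" using t by (intro mult_mono) (auto simp: power_even_abs)
    moreover have "t\<^sup>2 * \<theta> ^ 8 \<ge> 0" by simp
    ultimately have "1 \<le> t * \<theta> ^ 6 + t\<^sup>2 * \<theta> ^ 8" by linarith
    then have le: "1 * ?E \<le> (t * \<theta> ^ 6 + t\<^sup>2 * \<theta> ^ 8) * ?E" by (rule mult_right_mono) simp
    have "\<bar>0 - exp (- b) * cosh z\<bar> \<le> 1 * ?E" using 1 by (simp add: abs_mult)
    also note le
    finally show ?thesis using False unfolding b_def z_def by (simp only: if_False)
  next
    case True
    define a where "a = t * (1 - cos \<theta>)"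
    define y where "y = b - a"
    have ea: "exp (- a) \<le> ?E"
      using mult_left_mono[OF one_minus_cos_ge[OF True], of t] t by (simp add: a_def)
    have y_eq: "y = t * (cos \<theta> - (1 - \<theta>\<^sup>2 / 2))" by (simp add: y_def a_def b_def algebra_simps)
    have y0: "y \<ge> 0" unfolding y_eq using cos_bounds_quartic(3)[of \<theta>] t by simp
    have y1: "y \<le> t * (\<theta> ^ 4 / 24)" unfolding y_eq using cos_bounds_quartic(1)[of \<theta>] t by (intro mult_left_mono) auto
    have "y - t * \<theta> ^ 4 / 24 = t * (cos \<theta> - (1 - \<theta>\<^sup>2 / 2 + \<theta> ^ 4 / 24))"
      by (simp add: y_eq algebra_simps)
    then have y2: "\<bar>y - z\<^sup>2 / 2\<bar> \<le> t * (\<theta> ^ 6 / 720)"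
      unfolding z2 using mult_left_mono[OF cos_bounds_quartic(2)[of \<theta>], of t] t by (simp add: abs_mult)
    have "exp (- a) = exp (- b) * exp y" by (simp add: y_def flip: exp_add)
    \<comment> \<open>After factoring out \<open>exp (- b)\<close> the constants cancel,
      \<open>y\<close> and \<open>z^2 / 2\<close> agree up to order \<open>t \<theta>^6\<close>, and
      both Taylor remainders are of order \<open>t^2 \<theta>^8\<close>.\<close>
    then have split: "exp (- a) - exp (- b) * cosh z =
       exp (- b) * (exp y - 1 - y) + exp (- b) * (y - z\<^sup>2 / 2) - exp (- b) * (cosh z - 1 - z\<^sup>2 / 2)"
      by (simp add: algebra_simps)
    have "y\<^sup>2 / 2 \<le> t\<^sup>2 * \<theta> ^ 8 / 2"
    proof -
      have "y\<^sup>2 \<le> (t * (\<theta> ^ 4 / 24))\<^sup>2" by (rule power_mono[OF y1 y0])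
      also have "\<dots> \<le> t\<^sup>2 * \<theta> ^ 8" by (simp add: power_mult_distrib power_divide flip: power_mult)
      finally show ?thesis by simp
    qed
    then have "exp (- b) * (exp y - 1 - y) \<le> t\<^sup>2 * \<theta> ^ 8 / 2 * ?E"
    proof -
      have "exp (- b) * (exp y - 1 - y) \<le> exp (- b) * (y\<^sup>2 / 2 * exp y)"
        using exp_minus_taylor_le(1)[OF y0] by (intro mult_left_mono) auto
      also have "\<dots> = y\<^sup>2 / 2 * exp (- a)" by (simp add: \<open>exp (- a) = exp (- b) * exp y\<close>)
      also have "\<dots> \<le> t\<^sup>2 * \<theta> ^ 8 / 2 * ?E"
        using \<open>y\<^sup>2 / 2 \<le> _\<close> ea by (intro mult_mono) auto
      finally show ?thesis .
    qed
    moreover have "exp (- b) * (exp y - 1 - y) \<ge> 0" using exp_minus_taylor_le(2)[OF y0] by simp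
    moreover have "\<bar>exp (- b) * (y - z\<^sup>2 / 2)\<bar> \<le> t * \<theta> ^ 6 * ?E"
    proof -
      have "\<bar>exp (- b) * (y - z\<^sup>2 / 2)\<bar> \<le> ?E * (t * (\<theta> ^ 6 / 720))"
        unfolding abs_mult using eb y2 by (intro mult_mono) auto
      also have "\<dots> \<le> ?E * (t * \<theta> ^ 6)" using t by (intro mult_left_mono) auto
      finally show ?thesis by (simp add: mult_ac)
    qed
    moreover have "exp (- b) * (cosh z - 1 - z\<^sup>2 / 2) \<le> t\<^sup>2 * \<theta> ^ 8 / 2 * ?E"
    proof -
      have "exp (- b) * (cosh z - 1 - z\<^sup>2 / 2) \<le> exp (- b) * (z ^ 4 / 24 * exp z)"
        using cosh_minus_taylor_le(1)[OF z0] by (intro mult_left_mono) auto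
      also have "\<dots> = z ^ 4 / 24 * exp (- b + z)" by (simp only: exp_add mult_ac)
      also have "\<dots> \<le> t\<^sup>2 * \<theta> ^ 8 / 2 * ?E"
        unfolding z4 using ebz by (intro mult_mono) auto
      finally show ?thesis .
    qed
    moreover have "exp (- b) * (cosh z - 1 - z\<^sup>2 / 2) \<ge> 0" using cosh_minus_taylor_le(2)[OF z0] by simp
    ultimately have "\<bar>exp (- a) - exp (- b) * cosh z\<bar> \<le> t\<^sup>2 * \<theta> ^ 8 / 2 * ?E + t * \<theta> ^ 6 * ?E + t\<^sup>2 * \<theta> ^ 8 / 2 * ?E"
      unfolding split by linarith
    also have "\<dots> = (t * \<theta> ^ 6 + t\<^sup>2 * \<theta> ^ 8) * ?E" by (simp add: algebra_simps)
    finally show ?thesis using True by (simp add: a_def b_def z_def)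
  qed
qed

text \<open>The majorant is integrated over the whole line, where it is a Gaussian moment with
  \<open>c = t / 12\<close>; the powers of \<open>sqrt 12\<close> go into \<open>K\<close>.\<close>

lemma integral_gaussian_bound:
  fixes n :: nat
  obtains K where "K > 0"
    "\<And>f c (t::real). f integrable_on {-pi..pi} \<Longrightarrow> t > 0 \<Longrightarrow> c \<ge> 0 \<Longrightarrow>
      (\<And>\<theta>. \<bar>\<theta>\<bar> \<le> pi \<Longrightarrow> \<bar>f \<theta>\<bar> \<le> c * (\<theta> ^ (2 * n) * exp (- (t / 12 * \<theta>\<^sup>2)))) \<Longrightarrow>
      \<bar>integral {-pi..pi} f\<bar> \<le> c * (K / sqrt t ^ (2 * n + 1))"
proof -
  obtain K where K: "K > 0" and
    int: "\<And>c. c > 0 \<Longrightarrow> ((\<lambda>x::real. x ^ (2 * n) * exp (- (c * x\<^sup>2))) has_integral K / sqrt c ^ (2 * n + 1)) UNIV"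
    using gaussian_moment_integral by blast
  have "\<bar>integral {-pi..pi} f\<bar> \<le> c * ((K * sqrt 12 ^ (2 * n + 1)) / sqrt t ^ (2 * n + 1))"
    if f: "f integrable_on {-pi..pi}" and t: "t > 0" and c: "c \<ge> 0"
      and le: "\<And>\<theta>. \<bar>\<theta>\<bar> \<le> pi \<Longrightarrow> \<bar>f \<theta>\<bar> \<le> c * (\<theta> ^ (2 * n) * exp (- (t / 12 * \<theta>\<^sup>2)))" for f c t
  proof -
    let ?g = "\<lambda>\<theta>. c * (\<theta> ^ (2 * n) * exp (- (t / 12 * \<theta>\<^sup>2)))"
    have g: "(?g has_integral c * (K / sqrt (t / 12) ^ (2 * n + 1))) UNIV"
      by (intro has_integral_mult_right int) (use t in simp)
    have g': "?g integrable_on {-pi..pi}"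
      by (intro integrable_continuous_interval continuous_intros)
    have "\<bar>integral {-pi..pi} f\<bar> \<le> integral {-pi..pi} ?g"
      using integral_norm_bound_integral[OF f g'] le by force
    also have "\<dots> \<le> integral UNIV ?g"
      by (rule integral_subset_le) (use g g' c in \<open>auto simp: has_integral_integrable\<close>)
    also have "\<dots> = c * (K / sqrt (t / 12) ^ (2 * n + 1))"
      using g by (rule integral_unique)
    finally show ?thesis by (simp add: real_sqrt_divide power_divide)
  qed
  moreover have "K * sqrt 12 ^ (2 * n + 1) > 0" using K by simp
  ultimately show ?thesis using that by blast
qed

lemma exp_one_minus_cos_le:
  assumes "\<bar>\<theta>\<bar> \<le> pi" "t \<ge> (0::real)"
  shows "exp (- (t * (1 - cos \<theta>))) \<le> exp (- (t / 12 * \<theta>\<^sup>2))"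
  using mult_left_mono[OF one_minus_cos_ge[OF assms(1)] assms(2)] by simp

text \<open>Moments 0 and 2 of the Gaussian majorant of the symbol, the second after
  \<open>1 - cos (k \<theta>) <= k^2 \<theta>^2\<close>.\<close>

lemma heat1_le:
  obtains C where "C > 0" "\<And>t k. t > 0 \<Longrightarrow> \<bar>heat1 t k\<bar> \<le> C / sqrt t"
    "\<And>t k. t > 0 \<Longrightarrow> \<bar>heat1 t 0 - heat1 t k\<bar> \<le> C * (of_int k)\<^sup>2 / sqrt t ^ 3"
proof -
  obtain K where K: "K > 0" and
    int: "\<And>f c (t::real). f integrable_on {-pi..pi} \<Longrightarrow> t > 0 \<Longrightarrow> c \<ge> 0 \<Longrightarrow>
      (\<And>\<theta>. \<bar>\<theta>\<bar> \<le> pi \<Longrightarrow> \<bar>f \<theta>\<bar> \<le> c * (\<theta> ^ (2 * 0) * exp (- (t / 12 * \<theta>\<^sup>2)))) \<Longrightarrow>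
      \<bar>integral {-pi..pi} f\<bar> \<le> c * (K / sqrt t ^ (2 * 0 + 1))"
    using integral_gaussian_bound[of 0] by metis
  obtain L where L: "L > 0" and
    int': "\<And>f c (t::real). f integrable_on {-pi..pi} \<Longrightarrow> t > 0 \<Longrightarrow> c \<ge> 0 \<Longrightarrow>
      (\<And>\<theta>. \<bar>\<theta>\<bar> \<le> pi \<Longrightarrow> \<bar>f \<theta>\<bar> \<le> c * (\<theta> ^ (2 * 1) * exp (- (t / 12 * \<theta>\<^sup>2)))) \<Longrightarrow>
      \<bar>integral {-pi..pi} f\<bar> \<le> c * (L / sqrt t ^ (2 * 1 + 1))"
    using integral_gaussian_bound[of 1] by metis
  have three: "2 * 1 + 1 = (3 :: nat)" by simp
  have 1: "\<bar>heat1 t k\<bar> \<le> (K + L) / sqrt t" if t: "t > 0" for t k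
  proof -
    have "\<bar>integral {-pi..pi} (\<lambda>\<theta>. exp (- (t * (1 - cos \<theta>))) * cos (of_int k * \<theta>))\<bar> \<le> 1 * (K / sqrt t ^ (2 * 0 + 1))"
    proof (rule int[OF heat1_integrable t])
      fix \<theta> :: real assume th: "\<bar>\<theta>\<bar> \<le> pi"
      have "exp (- (t * (1 - cos \<theta>))) * \<bar>cos (of_int k * \<theta>)\<bar> \<le> exp (- (t / 12 * \<theta>\<^sup>2)) * 1"
        using exp_one_minus_cos_le[OF th, of t] t by (intro mult_mono) auto
      then show "\<bar>exp (- (t * (1 - cos \<theta>))) * cos (of_int k * \<theta>)\<bar> \<le> 1 * (\<theta> ^ (2 * 0) * exp (- (t / 12 * \<theta>\<^sup>2)))"
        by (simp add: abs_mult)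
    qed simp
    then have "\<bar>heat1 t k\<bar> \<le> (K / sqrt t) / (2 * pi)"
      using divide_right_mono[of _ "K / sqrt t" "2 * pi"] by (simp add: heat1_def abs_divide)
    also have "\<dots> \<le> (K / sqrt t) / 1"
      by (rule divide_left_mono) (use K t pi_ge_two in auto)
    also have "\<dots> \<le> (K + L) / sqrt t" using t L by (simp add: divide_right_mono)
    finally show ?thesis .
  qed
  have 2: "\<bar>heat1 t 0 - heat1 t k\<bar> \<le> (K + L) * (of_int k)\<^sup>2 / sqrt t ^ 3" if t: "t > 0" for t k
  proof -
    let ?f = "\<lambda>\<theta>. exp (- (t * (1 - cos \<theta>))) * cos (of_int 0 * \<theta>) - exp (- (t * (1 - cos \<theta>))) * cos (of_int k * \<theta>)"
    have eq: "heat1 t 0 - heat1 t k = integral {-pi..pi} ?f / (2 * pi)"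
      unfolding heat1_def by (subst integral_diff[OF heat1_integrable heat1_integrable]) (simp add: diff_divide_distrib)
    have "\<bar>integral {-pi..pi} ?f\<bar> \<le> (of_int k)\<^sup>2 * (L / sqrt t ^ 3)"
    proof (rule int'[OF _ t, unfolded three])
      show "?f integrable_on {-pi..pi}" by (intro integrable_diff heat1_integrable)
      fix \<theta> :: real assume th: "\<bar>\<theta>\<bar> \<le> pi"
      have "1 - cos (of_int k * \<theta>) \<le> (of_int k)\<^sup>2 * \<theta>\<^sup>2"
        using cos_bounds_quartic(3)[of "of_int k * \<theta>"] zero_le_power2[of "of_int k * \<theta>"]
        unfolding power_mult_distrib by linarith
      then have "exp (- (t * (1 - cos \<theta>))) * (1 - cos (of_int k * \<theta>)) \<le> exp (- (t / 12 * \<theta>\<^sup>2)) * ((of_int k)\<^sup>2 * \<theta>\<^sup>2)"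
        using exp_one_minus_cos_le[OF th, of t] t by (intro mult_mono) auto
      moreover have "\<bar>?f \<theta>\<bar> = exp (- (t * (1 - cos \<theta>))) * (1 - cos (of_int k * \<theta>))"
      proof -
        have "?f \<theta> = exp (- (t * (1 - cos \<theta>))) * (1 - cos (of_int k * \<theta>))" by (simp add: algebra_simps)
        then show ?thesis by (simp add: abs_mult)
      qed
      ultimately show "\<bar>?f \<theta>\<bar> \<le> (of_int k)\<^sup>2 * (\<theta> ^ (2 * 1) * exp (- (t / 12 * \<theta>\<^sup>2)))"
        by (simp add: mult_ac)
    qed simp
    then have "\<bar>integral {-pi..pi} ?f\<bar> / (2 * pi) \<le> ((of_int k)\<^sup>2 * (L / sqrt t ^ 3)) / (2 * pi)"
      by (rule divide_right_mono) simp
    then have "\<bar>heat1 t 0 - heat1 t k\<bar> \<le> ((of_int k)\<^sup>2 * (L / sqrt t ^ 3)) / (2 * pi)"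
      unfolding eq abs_divide by simp
    also have "\<dots> \<le> ((of_int k)\<^sup>2 * (L / sqrt t ^ 3)) / 1"
      by (rule divide_left_mono) (use L t pi_ge_two in auto)
    also have "\<dots> \<le> (K + L) * (of_int k)\<^sup>2 / sqrt t ^ 3"
      using t K by (simp add: divide_right_mono mult.commute[of L] mult_left_mono mult.commute[of "K + L"])
    finally show ?thesis .
  qed
  show ?thesis by (rule that[of "K + L", OF _ 1 2]) (use K L in auto)
qed

lemma heat1_le_one:
  assumes "t \<ge> 0"
  shows "\<bar>heat1 t k\<bar> \<le> 1"
proof -
  have "norm (integral {-pi..pi} (\<lambda>\<theta>. exp (- (t * (1 - cos \<theta>))) * cos (of_int k * \<theta>))) \<le> integral {-pi..pi} (\<lambda>\<theta>. 1)"
  proof (rule integral_norm_bound_integral[OF heat1_integrable])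
    fix \<theta> :: real
    have "exp (- (t * (1 - cos \<theta>))) * \<bar>cos (of_int k * \<theta>)\<bar> \<le> 1 * 1"
      using assms by (intro mult_mono) auto
    then show "norm (exp (- (t * (1 - cos \<theta>))) * cos (of_int k * \<theta>)) \<le> 1" by (simp add: abs_mult)
  qed (intro integrable_continuous_interval continuous_intros)
  then show ?thesis by (simp add: heat1_def abs_divide)
qed

text \<open>Differentiation multiplies the symbol by \<open>cos \<theta> - 1\<close>, and
  multiplication by \<open>2 cos \<theta>\<close> shifts the frequency \<open>k\<close> to
  \<open>k + 1\<close> and \<open>k - 1\<close>.\<close>

lemma heat1_has_derivative:
  "((\<lambda>t. heat1 t k) has_real_derivative (heat1 t (k + 1) + heat1 t (k - 1) - 2 * heat1 t k) / 2) (at t)"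
proof -
  let ?f = "\<lambda>t \<theta>. exp (- (t * (1 - cos \<theta>))) * cos (of_int k * \<theta>)"
  let ?g = "\<lambda>t \<theta>. - (1 - cos \<theta>) * exp (- (t * (1 - cos \<theta>))) * cos (of_int k * \<theta>)"
  have "((\<lambda>t. integral (cbox (-pi) pi) (?f t)) has_field_derivative integral (cbox (-pi) pi) (?g t)) (at t within UNIV)"
  proof (rule leibniz_rule_field_derivative)
    show "((\<lambda>t. ?f t \<theta>) has_field_derivative ?g t \<theta>) (at t within UNIV)" for t \<theta>
      by (auto intro!: derivative_eq_intros)
    show "?f t integrable_on cbox (-pi) pi" for t
      by (simp add: heat1_integrable)
    show "continuous_on (UNIV \<times> cbox (-pi) pi) (\<lambda>(t, \<theta>). ?g t \<theta>)"
      unfolding split_beta by (intro continuous_intros)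
  qed auto
  then have D: "((\<lambda>t. heat1 t k) has_real_derivative integral {-pi..pi} (?g t) / (2 * pi)) (at t)"
    unfolding heat1_def by (auto intro!: DERIV_cdivide)
  let ?h = "\<lambda>j \<theta>. exp (- (t * (1 - cos \<theta>))) * cos (of_int j * \<theta>)"
  have alg: "((a + b) / 2 - c) / (2 * pi) = (a / (2 * pi) + b / (2 * pi) - 2 * (c / (2 * pi))) / 2" for a b c
    by (simp add: field_simps)
  have "?g t = (\<lambda>\<theta>. (?h (k + 1) \<theta> + ?h (k - 1) \<theta>) / 2 - ?h k \<theta>)"
  proof
    fix \<theta> :: real
    have "cos (of_int (k + 1) * \<theta>) + cos (of_int (k - 1) * \<theta>) = 2 * cos \<theta> * cos (of_int k * \<theta>)"
      by (simp add: distrib_right left_diff_distrib cos_add cos_diff)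
    then have "(?h (k + 1) \<theta> + ?h (k - 1) \<theta>) = exp (- (t * (1 - cos \<theta>))) * (2 * cos \<theta> * cos (of_int k * \<theta>))"
      by (metis distrib_left)
    then show "?g t \<theta> = (?h (k + 1) \<theta> + ?h (k - 1) \<theta>) / 2 - ?h k \<theta>"
      by (simp add: algebra_simps)
  qed
  then have "integral {-pi..pi} (?g t) =
      integral {-pi..pi} (\<lambda>\<theta>. (?h (k + 1) \<theta> + ?h (k - 1) \<theta>) / 2 - ?h k \<theta>)"
    by simp
  also have "\<dots> = (integral {-pi..pi} (?h (k + 1)) + integral {-pi..pi} (?h (k - 1))) / 2 - integral {-pi..pi} (?h k)"
    by (intro integral_unique has_integral_diff has_integral_divide has_integral_add integrable_integral heat1_integrable)
  finally have eq: "integral {-pi..pi} (?g t) / (2 * pi) = (heat1 t (k + 1) + heat1 t (k - 1) - 2 * heat1 t k) / 2"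
    unfolding heat1_def by (simp only: alg)
  show ?thesis using D unfolding eq .
qed

section \<open>Initial value and large deviations of the one-dimensional kernel\<close>

lemma integral_cos_int: "integral {-pi..pi} (\<lambda>\<theta>. cos (of_int k * \<theta>)) = (if k = 0 then 2 * pi else 0)"
proof (cases "k = 0")
  case False
  have "((\<lambda>\<theta>. cos (of_int k * \<theta>)) has_integral (sin (of_int k * pi) / of_int k - sin (of_int k * (-pi)) / of_int k)) {-pi..pi}"
    using False
    by (intro fundamental_theorem_of_calculus)
       (auto intro!: derivative_eq_intros simp flip: has_real_derivative_iff_has_vector_derivative)
  moreover have "sin (of_int k * pi) = 0" by (simp add: sin_zero_iff_int2)
  ultimately show ?thesis using False by (simp add: integral_unique)
qed simp

lemma heat1_zero: "heat1 0 k = (if k = 0 then 1 else 0)"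
  using integral_cos_int[of k] by (simp add: heat1_def)

text \<open>The integral is \<open>2 pi\<close> times the probability that the discrete walk is at
  \<open>k\<close> after \<open>n\<close> steps, and the bound is Markov's inequality for its
  exponential moment. The recursion of the walk proves it without a probability space.\<close>

lemma integral_cos_power_le:
  "\<bar>integral {-pi..pi} (\<lambda>\<theta>. cos \<theta> ^ n * cos (of_int k * \<theta>))\<bar> \<le> 2 * pi * (cosh l ^ n * exp (- (l * of_int k)))"
proof (induction n arbitrary: k)
  case 0
  then show ?case by (simp add: integral_cos_int)
next
  case (Suc n)
  let ?I = "\<lambda>j (\<theta>::real). cos \<theta> ^ n * cos (of_int j * \<theta>)"
  have int: "?I j integrable_on {-pi..pi}" for j
    by (intro integrable_continuous_interval continuous_intros)
  have "(\<lambda>\<theta>::real. cos \<theta> ^ Suc n * cos (of_int k * \<theta>)) = (\<lambda>\<theta>. (?I (k + 1) \<theta> + ?I (k - 1) \<theta>) / 2)"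
  proof
    fix \<theta> :: real
    have "cos (of_int (k + 1) * \<theta>) + cos (of_int (k - 1) * \<theta>) = 2 * cos \<theta> * cos (of_int k * \<theta>)"
      by (simp add: distrib_right left_diff_distrib cos_add cos_diff)
    then have "?I (k + 1) \<theta> + ?I (k - 1) \<theta> = cos \<theta> ^ n * (2 * cos \<theta> * cos (of_int k * \<theta>))"
      by (metis distrib_left)
    then show "cos \<theta> ^ Suc n * cos (of_int k * \<theta>) = (?I (k + 1) \<theta> + ?I (k - 1) \<theta>) / 2"
      by simp
  qed
  then have "integral {-pi..pi} (\<lambda>\<theta>. cos \<theta> ^ Suc n * cos (of_int k * \<theta>))
     = integral {-pi..pi} (\<lambda>\<theta>. (?I (k + 1) \<theta> + ?I (k - 1) \<theta>) / 2)"
    by simp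
  also have "\<dots> = (integral {-pi..pi} (?I (k + 1)) + integral {-pi..pi} (?I (k - 1))) / 2"
    by (intro integral_unique has_integral_divide has_integral_add integrable_integral int)
  also have "\<bar>\<dots>\<bar> \<le> (2 * pi * (cosh l ^ n * exp (- (l * of_int (k + 1)))) + 2 * pi * (cosh l ^ n * exp (- (l * of_int (k - 1))))) / 2"
  proof -
    have "\<bar>(a + b) / 2\<bar> \<le> (c + d) / 2" if "\<bar>a\<bar> \<le> c" "\<bar>b\<bar> \<le> d" for a b c d :: real
    proof -
      have "\<bar>a + b\<bar> \<le> c + d" using that by linarith
      then show ?thesis by simp
    qed
    then show ?thesis using Suc[of "k + 1"] Suc[of "k - 1"] by blast
  qed
  also have "\<dots> = 2 * pi * (cosh l ^ Suc n * exp (- (l * of_int k)))"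
    by (simp add: cosh_field_def exp_add exp_diff exp_minus field_simps)
  finally show ?case .
qed

text \<open>Expanding \<open>exp (t cos \<theta>)\<close> turns an exponential moment of simple random walk into one of \<open>heat1\<close>.\<close>

lemma heat1_chernoff:
  assumes t: "t \<ge> 0"
  shows "\<bar>heat1 t k\<bar> \<le> exp (- (l * of_int k) + t * (cosh l - 1))"
proof -
  let ?s = "\<lambda>N \<theta>. \<Sum>n<N. (t ^ n / fact n) * (cos \<theta> ^ n * cos (of_int k * \<theta>))"
  let ?lim = "\<lambda>\<theta>. exp (t * cos \<theta>) * cos (of_int k * \<theta>)"
  have lim: "?lim \<theta> = (\<Sum>n. (t ^ n / fact n) * (cos \<theta> ^ n * cos (of_int k * \<theta>)))" for \<theta>
  proof -
    have "(\<lambda>n. (t * cos \<theta>) ^ n /\<^sub>R fact n) sums exp (t * cos \<theta>)" by (rule exp_converges)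
    from sums_mult2[OF this, of "cos (of_int k * \<theta>)"] show ?thesis
      by (intro sums_unique) (simp add: power_mult_distrib divide_inverse mult_ac)
  qed
  have u: "uniform_limit {-pi..pi} ?s ?lim sequentially"
    unfolding lim
  proof (rule Weierstrass_m_test)
    show "summable (\<lambda>n. t ^ n / fact n)" using summable_exp[of t] by (simp add: divide_inverse mult.commute)
    fix n :: nat and \<theta> :: real
    have "\<bar>cos \<theta> ^ n\<bar> * \<bar>cos (of_int k * \<theta>)\<bar> \<le> 1 * 1"
      by (intro mult_mono) (auto simp: power_abs power_le_one)
    then have "(t ^ n / fact n) * (\<bar>cos \<theta> ^ n\<bar> * \<bar>cos (of_int k * \<theta>)\<bar>) \<le> (t ^ n / fact n) * 1"
      using t by (intro mult_left_mono) auto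
    then show "norm ((t ^ n / fact n) * (cos \<theta> ^ n * cos (of_int k * \<theta>))) \<le> t ^ n / fact n"
      using t by (simp add: abs_mult)
  qed
  obtain I J where IJ: "\<And>N. (?s N has_integral I N) {-pi..pi}" "(?lim has_integral J) {-pi..pi}" "I \<longlonglongrightarrow> J"
    by (rule uniform_limit_integral[OF u]) (auto intro!: continuous_intros)
  have I: "\<bar>I N\<bar> \<le> 2 * pi * exp (- (l * of_int k)) * exp (t * cosh l)" for N
  proof -
    have "(?s N has_integral (\<Sum>n<N. (t ^ n / fact n) * integral {-pi..pi} (\<lambda>\<theta>. cos \<theta> ^ n * cos (of_int k * \<theta>)))) {-pi..pi}"
      by (intro has_integral_sum has_integral_mult_right integrable_integral integrable_continuous_interval continuous_intros) auto
    then have "I N = (\<Sum>n<N. (t ^ n / fact n) * integral {-pi..pi} (\<lambda>\<theta>. cos \<theta> ^ n * cos (of_int k * \<theta>)))"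
      using IJ(1)[of N] by (simp add: has_integral_unique)
    also have "\<bar>\<dots>\<bar> \<le> (\<Sum>n<N. \<bar>(t ^ n / fact n) * integral {-pi..pi} (\<lambda>\<theta>. cos \<theta> ^ n * cos (of_int k * \<theta>))\<bar>)"
      by (rule sum_abs)
    also have "\<dots> \<le> (\<Sum>n<N. (t ^ n / fact n) * (2 * pi * (cosh l ^ n * exp (- (l * of_int k)))))"
      unfolding abs_mult using t by (intro sum_mono mult_mono integral_cos_power_le) auto
    also have "\<dots> = 2 * pi * exp (- (l * of_int k)) * (\<Sum>n<N. (t * cosh l) ^ n /\<^sub>R fact n)"
      by (simp add: sum_distrib_left power_mult_distrib divide_inverse mult_ac)
    also have "(\<Sum>n<N. (t * cosh l) ^ n /\<^sub>R fact n) \<le> exp (t * cosh l)"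
      using exp_converges[of "t * cosh l"] t cosh_real_nonneg[of l]
      by (metis (no_types, lifting) sum_le_suminf finite_lessThan sums_iff zero_le_mult_iff zero_le_power scaleR_nonneg_nonneg inverse_nonnegative_iff_nonnegative fact_ge_zero)
    finally show ?thesis by (simp add: mult_left_mono)
  qed
  have "(\<lambda>N. \<bar>I N\<bar>) \<longlonglongrightarrow> \<bar>J\<bar>" by (intro tendsto_intros IJ)
  then have J: "\<bar>J\<bar> \<le> 2 * pi * exp (- (l * of_int k)) * exp (t * cosh l)"
    by (rule LIMSEQ_le_const2) (use I in auto)
  have "(\<lambda>\<theta>. exp (- (t * (1 - cos \<theta>))) * cos (of_int k * \<theta>)) = (\<lambda>\<theta>. exp (- t) * ?lim \<theta>)"
    by (simp add: fun_eq_iff algebra_simps flip: exp_add)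
  then have "heat1 t k = exp (- t) * J / (2 * pi)"
    using IJ(2) by (simp add: heat1_def integral_unique)
  also have "\<bar>\<dots>\<bar> = exp (- t) * \<bar>J\<bar> / (2 * pi)" by (simp add: abs_mult)
  also have "\<dots> \<le> exp (- t) * (2 * pi * exp (- (l * of_int k)) * exp (t * cosh l)) / (2 * pi)"
    using J by (intro divide_right_mono mult_left_mono) auto
  also have "\<dots> = exp (- (l * of_int k) + t * (cosh l - 1))"
    by (simp add: exp_add exp_minus exp_diff algebra_simps field_simps)
  finally show ?thesis .
qed

text \<open>Optimises \<open>l\<close> in \<open>heat1_chernoff\<close> with
  \<open>cosh l - 1 <= l^2\<close> on \<open>[0, 1]\<close>: the choice is
  \<open>l = |k| / (2 t)\<close> while this is at most 1, and \<open>l = 1\<close> beyond, where the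
  decay is only exponential in \<open>|k|\<close>.\<close>

lemma heat1_tail:
  assumes t: "t > 0"
  shows "\<bar>heat1 t k\<bar> \<le> exp (- ((of_int k)\<^sup>2 / (4 * t))) + exp (- (\<bar>of_int k\<bar> / 2))"
proof -
  define K where "K = \<bar>of_int k :: real\<bar>"
  have K0: "K \<ge> 0" by (simp add: K_def)
  have le: "\<bar>heat1 t k\<bar> \<le> exp (- (l * K) + t * l\<^sup>2)" if "0 \<le> l" "l \<le> 1" for l
  proof -
    define l' where "l' = (if k \<ge> 0 then l else - l)"
    have "exp l \<le> 1 + l + l\<^sup>2" using that by (intro exp_bound) auto
    moreover have "exp (-l) \<le> 1 - l + l\<^sup>2"
    proof -
      have "1 \<le> (1 - l + l\<^sup>2) * (1 + l)"
        using that by (simp add: algebra_simps power2_eq_square)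
      also have "\<dots> \<le> (1 - l + l\<^sup>2) * exp l"
        using that exp_ge_add_one_self[of l] sum_power2_ge_zero[of "l - 1/2" 0]
        by (intro mult_left_mono) (auto simp: power2_eq_square algebra_simps)
      finally show ?thesis by (simp add: exp_minus field_simps)
    qed
    moreover have mean: "(a + b) / 2 - 1 \<le> c" if "a \<le> 1 + l + c" "b \<le> 1 - l + c" for a b c :: real
      using that by (simp add: field_simps)
    ultimately have "cosh l - 1 \<le> l\<^sup>2"
      using mean unfolding cosh_field_def by blast
    then have "t * (cosh l' - 1) \<le> t * l\<^sup>2" using t by (simp add: l'_def)
    moreover have "l' * of_int k = l * K" by (simp add: l'_def K_def)
    ultimately show ?thesis using heat1_chernoff[of t k l'] t by (smt (verit) exp_le_cancel_iff)
  qed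
  show ?thesis
  proof (cases "K \<le> 2 * t")
    case True
    have "\<bar>heat1 t k\<bar> \<le> exp (- (K / (2 * t) * K) + t * (K / (2 * t))\<^sup>2)"
      by (rule le) (use True t K0 in auto)
    also have "- (K / (2 * t) * K) + t * (K / (2 * t))\<^sup>2 = - ((of_int k)\<^sup>2 / (4 * t))"
    proof -
      have "(of_int k)\<^sup>2 = K\<^sup>2" by (simp add: K_def)
      then show ?thesis using t by (simp add: field_simps power2_eq_square)
    qed
    finally show ?thesis by (smt (verit) exp_ge_zero)
  next
    case False
    have "\<bar>heat1 t k\<bar> \<le> exp (- (1 * K) + t * 1\<^sup>2)"
      by (rule le) auto
    also have "\<dots> \<le> exp (- (K / 2))" using False by simp
    finally show ?thesis unfolding K_def by (smt (verit) exp_ge_zero)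
  qed
qed

definition gauss1_mean :: "real \<Rightarrow> real \<Rightarrow> real" where
  "gauss1_mean t x = (gauss1 (t + sqrt (t / 3)) x + gauss1 (t - sqrt (t / 3)) x) / 2"

text \<open>Both terms of \<open>symbol_difference\<close>, \<open>t\<close> times a sixth moment
  and \<open>t^2\<close> times an eighth moment, scale as \<open>t powr (-5/2)\<close>.\<close>

lemma heat1_approx:
  obtains C where "C > 0" "\<And>t k. t \<ge> 1 \<Longrightarrow> \<bar>heat1 t k - gauss1_mean t (of_int k)\<bar> \<le> C / sqrt t ^ 5"
proof -
  obtain K3 where K3: "K3 > 0" and
    int3: "\<And>c. c > 0 \<Longrightarrow> ((\<lambda>x::real. x ^ (2 * 3) * exp (- (c * x\<^sup>2))) has_integral K3 / sqrt c ^ (2 * 3 + 1)) UNIV"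
    using gaussian_moment_integral by blast
  obtain K4 where K4: "K4 > 0" and
    int4: "\<And>c. c > 0 \<Longrightarrow> ((\<lambda>x::real. x ^ (2 * 4) * exp (- (c * x\<^sup>2))) has_integral K4 / sqrt c ^ (2 * 4 + 1)) UNIV"
    using gaussian_moment_integral by blast
  define C where "C = K3 * sqrt 12 ^ 7 + K4 * sqrt 12 ^ 9"
  have "\<bar>heat1 t k - gauss1_mean t (of_int k)\<bar> \<le> C / sqrt t ^ 5" if t: "t \<ge> 1" for t k
  proof -
    define h where "h = sqrt (t / 3)"
    have h: "0 < h" "h \<le> 5 * t / 6" using sqrt_third_bounds[OF t] by (simp_all add: h_def)
    let ?f = "\<lambda>\<theta>::real. (if \<bar>\<theta>\<bar> \<le> pi then exp (- (t * (1 - cos \<theta>))) else 0) * cos (of_int k * \<theta>)"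
    let ?g = "\<lambda>\<theta>::real. (exp (- (t * \<theta>\<^sup>2 / 2)) * cosh (h * \<theta>\<^sup>2 / 2)) * cos (of_int k * \<theta>)"
    let ?E = "\<lambda>\<theta>::real. (t * \<theta> ^ 6 + t\<^sup>2 * \<theta> ^ 8) * exp (- (t / 12 * \<theta>\<^sup>2))"
    have "((\<lambda>\<theta>. if \<theta> \<in> {-pi..pi} then exp (- (t * (1 - cos \<theta>))) * cos (of_int k * \<theta>) else 0) has_integral 2 * pi * heat1 t k) UNIV"
      unfolding has_integral_restrict_UNIV heat1_def using integrable_integral[OF heat1_integrable] by simp
    also have "(\<lambda>\<theta>. if \<theta> \<in> {-pi..pi} then exp (- (t * (1 - cos \<theta>))) * cos (of_int k * \<theta>) else 0) = ?f"
      by (auto simp: fun_eq_iff abs_le_iff)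
    finally have f: "(?f has_integral 2 * pi * heat1 t k) UNIV" .
    have "((\<lambda>\<theta>. (exp (- ((t + h) * \<theta>\<^sup>2 / 2)) * cos (of_int k * \<theta>) + exp (- ((t - h) * \<theta>\<^sup>2 / 2)) * cos (of_int k * \<theta>)) / 2)
        has_integral (2 * pi * gauss1 (t + h) (of_int k) + 2 * pi * gauss1 (t - h) (of_int k)) / 2) UNIV"
      by (intro has_integral_divide has_integral_add gaussian_fourier') (use h t in auto)
    also have "(\<lambda>\<theta>. (exp (- ((t + h) * \<theta>\<^sup>2 / 2)) * cos (of_int k * \<theta>) + exp (- ((t - h) * \<theta>\<^sup>2 / 2)) * cos (of_int k * \<theta>)) / 2) = ?g"
    proof
      fix \<theta> :: real
      have e: "exp (- ((t + h) * \<theta>\<^sup>2 / 2)) = exp (- (t * \<theta>\<^sup>2 / 2)) * exp (- (h * \<theta>\<^sup>2 / 2))"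
        "exp (- ((t - h) * \<theta>\<^sup>2 / 2)) = exp (- (t * \<theta>\<^sup>2 / 2)) * exp (h * \<theta>\<^sup>2 / 2)"
        by (simp_all flip: exp_add add: field_simps)
      show "(exp (- ((t + h) * \<theta>\<^sup>2 / 2)) * cos (of_int k * \<theta>) + exp (- ((t - h) * \<theta>\<^sup>2 / 2)) * cos (of_int k * \<theta>)) / 2 = ?g \<theta>"
        unfolding e cosh_field_def by (simp add: field_simps)
    qed
    finally have g: "(?g has_integral 2 * pi * gauss1_mean t (of_int k)) UNIV"
      by (simp add: gauss1_mean_def h_def algebra_simps)
    have "((\<lambda>\<theta>. t * (\<theta> ^ (2 * 3) * exp (- (t / 12 * \<theta>\<^sup>2))) + t\<^sup>2 * (\<theta> ^ (2 * 4) * exp (- (t / 12 * \<theta>\<^sup>2))))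
      has_integral (t * (K3 / sqrt (t / 12) ^ (2 * 3 + 1)) + t\<^sup>2 * (K4 / sqrt (t / 12) ^ (2 * 4 + 1)))) UNIV"
      by (intro has_integral_add has_integral_mult_right int3 int4) (use t in auto)
    also have "(\<lambda>\<theta>. t * (\<theta> ^ (2 * 3) * exp (- (t / 12 * \<theta>\<^sup>2))) + t\<^sup>2 * (\<theta> ^ (2 * 4) * exp (- (t / 12 * \<theta>\<^sup>2)))) = ?E"
      by (auto simp: fun_eq_iff algebra_simps)
    also have "t * (K3 / sqrt (t / 12) ^ (2 * 3 + 1)) + t\<^sup>2 * (K4 / sqrt (t / 12) ^ (2 * 4 + 1)) = C / sqrt t ^ 5"
    proof -
      define w where "w = sqrt t"
      have w: "w > 0" "t = w\<^sup>2" using t by (auto simp: w_def)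
      have w': "sqrt (t / 12) = w / sqrt 12" by (simp add: w_def real_sqrt_divide)
      define v where "v = sqrt (12::real)"
      have v: "v > 0" by (simp add: v_def)
      show ?thesis unfolding w' C_def w_def[symmetric] v_def[symmetric] unfolding w(2)
        using w(1) v by (simp add: field_simps flip: power_add power_mult) (simp add: eval_nat_numeral algebra_simps)
    qed
    finally have E: "(?E has_integral C / sqrt t ^ 5) UNIV" .
    have fg: "((\<lambda>\<theta>. ?f \<theta> - ?g \<theta>) has_integral (2 * pi * heat1 t k - 2 * pi * gauss1_mean t (of_int k))) UNIV"
      by (rule has_integral_diff[OF f g])
    have "norm (integral UNIV (\<lambda>\<theta>. ?f \<theta> - ?g \<theta>)) \<le> integral UNIV ?E"
    proof (rule integral_norm_bound_integral)
      fix \<theta> :: real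
      have "?f \<theta> - ?g \<theta> = ((if \<bar>\<theta>\<bar> \<le> pi then exp (- (t * (1 - cos \<theta>))) else 0) - exp (- (t * \<theta>\<^sup>2 / 2)) * cosh (h * \<theta>\<^sup>2 / 2)) * cos (of_int k * \<theta>)"
        by (simp only: left_diff_distrib)
      also have "\<bar>\<dots>\<bar> \<le> ?E \<theta> * 1"
        unfolding abs_mult h_def by (intro mult_mono symbol_difference t) (use t in \<open>auto intro!: mult_nonneg_nonneg add_nonneg_nonneg\<close>)
      finally show "norm (?f \<theta> - ?g \<theta>) \<le> ?E \<theta>" by simp
    qed (use fg E in \<open>auto simp: has_integral_integrable\<close>)
    then have "\<bar>2 * pi * heat1 t k - 2 * pi * gauss1_mean t (of_int k)\<bar> \<le> C / sqrt t ^ 5"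
      using integral_unique[OF fg] integral_unique[OF E] by simp
    moreover have "2 * pi * heat1 t k - 2 * pi * gauss1_mean t (of_int k) = (2 * pi) * (heat1 t k - gauss1_mean t (of_int k))"
      by (simp add: algebra_simps)
    moreover have "1 * \<bar>heat1 t k - gauss1_mean t (of_int k)\<bar> \<le> (2 * pi) * \<bar>heat1 t k - gauss1_mean t (of_int k)\<bar>"
      using pi_ge_two by (intro mult_right_mono) auto
    ultimately show ?thesis by (simp add: abs_mult)
  qed
  moreover have "C > 0" using K3 K4 by (simp add: C_def add_pos_pos)
  ultimately show ?thesis using that by blast
qed

section \<open>Gaussian densities as functions of the variance\<close>

lemma gauss1_pos: "t > 0 \<Longrightarrow> gauss1 t x > 0"
  by (simp add: gauss1_def)

lemma gauss1_le: 
  assumes "t > 0"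
  shows "gauss1 t x \<le> exp (- (x\<^sup>2 / (2 * t))) / sqrt t"
proof -
  have "1 * t \<le> 2 * pi * t" using assms pi_ge_two by (intro mult_right_mono) auto
  then have le: "sqrt t \<le> sqrt (2 * pi * t)" by (intro real_sqrt_le_mono) (simp only: mult_1_left)
  have "0 < 2 * pi * t" by (intro mult_pos_pos pi_gt_zero assms) simp
  then have "0 < sqrt (2 * pi * t) * sqrt t"
    by (intro mult_pos_pos[of "sqrt (2 * pi * t)"] real_sqrt_gt_zero assms)
  then show ?thesis unfolding gauss1_def by (intro divide_left_mono[OF le]) simp_all
qed

text \<open>\<open>d/dt\<close> and \<open>d\<^sup>2/dt\<^sup>2\<close> of \<open>gauss1 t x\<close> are \<open>gauss1 t x\<close> times \<open>w t\<close> and \<open>w t ^ 2 + w' t\<close>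
  with \<open>w t = x\<^sup>2/(2t\<^sup>2) - 1/(2t)\<close>.\<close>

lemma gauss1_derivative:
  assumes "t > 0"
  shows "((\<lambda>t. gauss1 t x) has_real_derivative gauss1 t x * (x\<^sup>2 / (2 * t\<^sup>2) - 1 / (2 * t))) (at t)"
proof -
  have s: "sqrt (2 * pi * t) > 0" "sqrt (2 * pi * t) * sqrt (2 * pi * t) = 2 * pi * t" using assms by auto
  have "((\<lambda>t. exp (- (x\<^sup>2 / (2 * t))) / sqrt (2 * pi * t)) has_real_derivative
     ((exp (- (x\<^sup>2 / (2 * t))) * (x\<^sup>2 * 2 / (2 * t * (2 * t)))) * sqrt (2 * pi * t)
       - exp (- (x\<^sup>2 / (2 * t))) * (2 * pi * (inverse (sqrt (2 * pi * t)) / 2))) / (sqrt (2 * pi * t) * sqrt (2 * pi * t))) (at t)"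
    using assms by (auto intro!: derivative_eq_intros simp: mult_less_0_iff)
  also have "((exp (- (x\<^sup>2 / (2 * t))) * (x\<^sup>2 * 2 / (2 * t * (2 * t)))) * sqrt (2 * pi * t)
       - exp (- (x\<^sup>2 / (2 * t))) * (2 * pi * (inverse (sqrt (2 * pi * t)) / 2))) / (sqrt (2 * pi * t) * sqrt (2 * pi * t))
     = gauss1 t x * (x\<^sup>2 / (2 * t\<^sup>2) - 1 / (2 * t))"
  proof -
    define S where "S = sqrt (2 * pi * t)"
    have S: "S > 0" "S * S = 2 * pi * t" using s by (auto simp: S_def)
    have "2 * pi * (inverse S / 2) = S / (2 * t)" using S assms by (simp add: field_simps)
    then show ?thesis unfolding gauss1_def S_def[symmetric]
      using S(1) assms by (simp add: field_simps power2_eq_square)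
  qed
  finally show ?thesis unfolding gauss1_def .
qed

definition gauss1_tt :: "real \<Rightarrow> real \<Rightarrow> real" where
  "gauss1_tt t x = gauss1 t x * ((x\<^sup>2 / (2 * t\<^sup>2) - 1 / (2 * t))\<^sup>2 + (1 / (2 * t\<^sup>2) - x\<^sup>2 / t ^ 3))"

lemma gauss1_second_derivative:
  assumes "t > 0"
  shows "((\<lambda>t. gauss1 t x * (x\<^sup>2 / (2 * t\<^sup>2) - 1 / (2 * t))) has_real_derivative gauss1_tt t x) (at t)"
proof -
  have "((\<lambda>t. x\<^sup>2 / (2 * t\<^sup>2) - 1 / (2 * t)) has_real_derivative (1 / (2 * t\<^sup>2) - x\<^sup>2 / t ^ 3)) (at t)"
    using assms by (auto intro!: derivative_eq_intros simp: field_simps power2_eq_square power3_eq_cube)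
  from DERIV_mult[OF gauss1_derivative[OF assms, of x] this] show ?thesis
    by (simp add: gauss1_tt_def algebra_simps power2_eq_square)
qed

text \<open>In terms of \<open>v = x^2 / (2 t)\<close> the factor of \<open>gauss1\<close> is a
  quadratic polynomial over \<open>t^2\<close>, which half of the Gaussian exponent absorbs.\<close>

lemma gauss1_tt_le:
  assumes t: "t > 0"
  shows "\<bar>gauss1_tt t x\<bar> \<le> 8 / sqrt t ^ 5 * exp (- (x\<^sup>2 / (4 * t)))"
proof -
  define v where "v = x\<^sup>2 / (2 * t)"
  have v: "v \<ge> 0" using t by (simp add: v_def)
  have "(x\<^sup>2 / (2 * t\<^sup>2) - 1 / (2 * t))\<^sup>2 + (1 / (2 * t\<^sup>2) - x\<^sup>2 / t ^ 3) = ((v - 1 / 2)\<^sup>2 + 1 / 2 - 2 * v) / t\<^sup>2"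
    using t by (simp add: v_def field_simps power2_eq_square power3_eq_cube)
  moreover have "\<bar>(v - 1 / 2)\<^sup>2 + 1 / 2 - 2 * v\<bar> \<le> 8 * exp (v / 2)"
  proof -
    \<comment> \<open>Eight times this Taylor polynomial is \<open>8 + 4 v + v^2\<close>, which
      dominates the quadratic in absolute value.\<close>
    have "1 + v / 2 + (v / 2)\<^sup>2 / 2 \<le> exp (v / 2)"
      using exp_lower_Taylor_quadratic[of "v / 2"] v by simp
    then have "8 + 4 * v + v\<^sup>2 \<le> 8 * exp (v / 2)" by (simp add: power2_eq_square)
    moreover have "\<bar>(v - 1 / 2)\<^sup>2 + 1 / 2 - 2 * v\<bar> \<le> 8 + 4 * v + v\<^sup>2"
      by (simp add: abs_le_iff power2_diff power_divide) (use v zero_le_power2[of v] in linarith)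
    ultimately show ?thesis by linarith
  qed
  ultimately have "\<bar>gauss1_tt t x\<bar> \<le> gauss1 t x * (8 * exp (v / 2) / t\<^sup>2)"
    unfolding gauss1_tt_def abs_mult using gauss1_pos[OF t, of x]
    by (intro mult_mono) (auto simp: abs_divide intro!: divide_right_mono)
  also have "\<dots> \<le> (exp (- v) / sqrt t) * (8 * exp (v / 2) / t\<^sup>2)"
    using gauss1_le[OF t, of x] by (intro mult_right_mono) (auto simp: v_def)
  also have "\<dots> = 8 / (sqrt t * t\<^sup>2) * exp (- v + v / 2)"
    by (simp only: exp_add) simp
  also have "- v + v / 2 = - (x\<^sup>2 / (4 * t))" by (simp add: v_def)
  also have "sqrt t * t\<^sup>2 = sqrt t ^ 5"
    using t by (simp add: eval_nat_numeral power2_eq_square mult_ac)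
  finally show ?thesis .
qed

text \<open>A symmetric second difference in the variance: first-order terms cancel, and
  \<open>h^2 = t / 3\<close> times a second derivative of order \<open>t powr (-5/2)\<close> leaves
  \<open>t powr (-3/2)\<close>. A Gaussian factor with \<open>8 t\<close> survives because all
  variances involved are at most \<open>2 t\<close>.\<close>

lemma gauss1_mean_bounds:
  obtains C where "C > 0"
    "\<And>t x. t \<ge> 1 \<Longrightarrow> \<bar>gauss1_mean t x - gauss1 t x\<bar> \<le> C / sqrt t ^ 3 * exp (- (x\<^sup>2 / (8 * t)))"
    "\<And>t x. t \<ge> 1 \<Longrightarrow> \<bar>gauss1_mean t x\<bar> \<le> C / sqrt t * exp (- (x\<^sup>2 / (8 * t)))"
proof -
  have near: "1 / sqrt s \<le> sqrt 6 / sqrt t" "exp (- (x\<^sup>2 / (4 * s))) \<le> exp (- (x\<^sup>2 / (8 * t)))" "s > 0"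
    if t: "t \<ge> 1" and s: "\<bar>s - t\<bar> \<le> sqrt (t / 3)" for s t x
  proof -
    have s1: "s \<ge> t / 6" "s \<le> 2 * t"
      using sqrt_third_bounds(2)[OF t] s t by (auto simp: abs_le_iff)
    then show "s > 0" using t by simp
    have "sqrt (t / 6) \<le> sqrt s" using s1 by simp
    then have "1 / sqrt s \<le> 1 / sqrt (t / 6)" using t by (intro divide_left_mono) auto
    then show "1 / sqrt s \<le> sqrt 6 / sqrt t" by (simp add: real_sqrt_divide)
    have "x\<^sup>2 / (8 * t) \<le> x\<^sup>2 / (4 * s)" using s1 \<open>s > 0\<close> t by (intro divide_left_mono) auto
    then show "exp (- (x\<^sup>2 / (4 * s))) \<le> exp (- (x\<^sup>2 / (8 * t)))" by simp
  qed
  \<comment> \<open>The 8 is that of \<open>gauss1_tt_le\<close>; each \<open>sqrt 6\<close> stems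
    from a variance that may be as small as \<open>t / 6\<close>.\<close>
  define C where "C = 8 * sqrt 6 ^ 5"
  have C1: "C \<ge> sqrt 6" "C > 0"
  proof -
    have "sqrt 6 ^ 1 \<le> sqrt 6 ^ 5" by (rule power_increasing) auto
    also have "\<dots> \<le> 8 * sqrt 6 ^ 5" by simp
    finally show "C \<ge> sqrt 6" by (simp add: C_def)
    show "C > 0" by (simp add: C_def)
  qed
  have 1: "\<bar>gauss1_mean t x - gauss1 t x\<bar> \<le> C / sqrt t ^ 3 * exp (- (x\<^sup>2 / (8 * t)))" if t: "t \<ge> 1" for t x
  proof -
    define h where "h = sqrt (t / 3)"
    have h: "0 < h" "h \<le> 5 * t / 6" "h\<^sup>2 = t / 3" using sqrt_third_bounds[OF t] by (simp_all add: h_def)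
    let ?e = "exp (- (x\<^sup>2 / (8 * t)))"
    let ?d = "\<lambda>s. gauss1 s x * (x\<^sup>2 / (2 * s\<^sup>2) - 1 / (2 * s))"
    let ?diff = "\<lambda>(n::nat) s. if n = 0 then gauss1 (t + s) x + gauss1 (t - s) x
        else if n = 1 then ?d (t + s) - ?d (t - s) else gauss1_tt (t + s) x + gauss1_tt (t - s) x"
    have "\<exists>s>0. s < h \<and> gauss1 (t + h) x + gauss1 (t - h) x = (\<Sum>m<2. ?diff m 0 / fact m * h ^ m) + ?diff 2 s / fact 2 * h ^ 2"
    proof (rule Maclaurin[where diff = ?diff and f = "\<lambda>s. gauss1 (t + s) x + gauss1 (t - s) x"])
      show "\<forall>m s. m < 2 \<and> 0 \<le> s \<and> s \<le> h \<longrightarrow> (?diff m has_real_derivative ?diff (Suc m) s) (at s)"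
      proof (intro allI impI)
        fix m :: nat and s assume ms: "m < 2 \<and> 0 \<le> s \<and> s \<le> h"
        then have pos: "t + s > 0" "t - s > 0" using h t by auto
        have d: "((\<lambda>s. t + s) has_real_derivative 1) (at s)" "((\<lambda>s. t - s) has_real_derivative -1) (at s)"
          by (auto intro!: derivative_eq_intros)
        have p1: "((\<lambda>s. f (t + s)) has_real_derivative f') (at s)"
          if "(f has_real_derivative f') (at (t + s))" for f f'
          using DERIV_chain2[where f = f, OF that d(1)] by simp
        have p2: "((\<lambda>s. f (t - s)) has_real_derivative - f') (at s)"
          if "(f has_real_derivative f') (at (t - s))" for f f'
          using DERIV_chain2[where f = f, OF that d(2)] by simp
        consider "m = 0" | "m = 1" using ms by linarith
        then show "(?diff m has_real_derivative ?diff (Suc m) s) (at s)"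
        proof cases
          case 1
          have "((\<lambda>s. gauss1 (t + s) x + gauss1 (t - s) x) has_real_derivative ?d (t + s) + - ?d (t - s)) (at s)"
            by (intro DERIV_add p1[where f = "\<lambda>r. gauss1 r x"] p2[where f = "\<lambda>r. gauss1 r x"] gauss1_derivative pos)
          then show ?thesis using 1 by simp
        next
          case 2
          have "((\<lambda>s. ?d (t + s) - ?d (t - s)) has_real_derivative gauss1_tt (t + s) x - - gauss1_tt (t - s) x) (at s)"
            by (intro DERIV_diff p1[where f = ?d] p2[where f = ?d] gauss1_second_derivative pos)
          then show ?thesis using 2 by simp
        qed
      qed
    qed (use h in auto)
    then obtain s where s: "s > 0" "s < h" and
      eq: "gauss1 (t + h) x + gauss1 (t - h) x = 2 * gauss1 t x + (gauss1_tt (t + s) x + gauss1_tt (t - s) x) / 2 * (t / 3)"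
      by (auto simp: eval_nat_numeral h(3)[unfolded power2_eq_square])
    have tt: "\<bar>gauss1_tt r x\<bar> \<le> C / sqrt t ^ 5 * ?e" if "\<bar>r - t\<bar> \<le> h" for r
    proof -
      note n = near[OF t that[unfolded h_def]]
      have "\<bar>gauss1_tt r x\<bar> \<le> 8 / sqrt r ^ 5 * exp (- (x\<^sup>2 / (4 * r)))" by (rule gauss1_tt_le[OF n(3)])
      also have "8 / sqrt r ^ 5 = 8 * (1 / sqrt r) ^ 5" by (simp add: power_divide)
      also have "\<dots> * exp (- (x\<^sup>2 / (4 * r))) \<le> (8 * (sqrt 6 / sqrt t) ^ 5) * ?e"
        using n t by (intro mult_mono power_mono) auto
      finally show ?thesis by (simp add: C_def power_divide)
    qed
    have le: "\<bar>gauss1_tt (t + s) x + gauss1_tt (t - s) x\<bar> \<le> 2 * (C / sqrt t ^ 5 * ?e)"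
      using tt[of "t + s"] tt[of "t - s"] s by linarith
    have eq': "gauss1_mean t x - gauss1 t x = (gauss1_tt (t + s) x + gauss1_tt (t - s) x) * (t / 12)"
      using eq by (simp add: gauss1_mean_def h_def field_simps)
    have "\<bar>gauss1_mean t x - gauss1 t x\<bar> = \<bar>gauss1_tt (t + s) x + gauss1_tt (t - s) x\<bar> * (t / 12)"
      unfolding eq' abs_mult using t by simp
    also have "\<dots> \<le> 2 * (C / sqrt t ^ 5 * ?e) * (t / 12)"
      using t by (intro mult_right_mono le) simp
    also have "2 * (C / sqrt t ^ 5 * ?e) * (t / 12) = (1 / 6) * (C / sqrt t ^ 3 * ?e)"
    proof -
      define w where "w = sqrt t"
      have "w > 0" "t = w\<^sup>2" using t by (auto simp: w_def)
      then show ?thesis unfolding w_def[symmetric] by (simp add: field_simps eval_nat_numeral)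
    qed
    also have "\<dots> \<le> 1 * (C / sqrt t ^ 3 * ?e)"
      using C1 t by (intro mult_right_mono) auto
    finally show ?thesis by simp
  qed
  have 2: "\<bar>gauss1_mean t x\<bar> \<le> C / sqrt t * exp (- (x\<^sup>2 / (8 * t)))" if t: "t \<ge> 1" for t x
  proof -
    define h where "h = sqrt (t / 3)"
    have h: "0 < h" using sqrt_third_bounds[OF t] by (simp_all add: h_def)
    have g: "\<bar>gauss1 r x\<bar> \<le> C / sqrt t * exp (- (x\<^sup>2 / (8 * t)))" if "\<bar>r - t\<bar> \<le> h" for r
    proof -
      note n = near[OF t that[unfolded h_def]]
      have "\<bar>gauss1 r x\<bar> \<le> exp (- (x\<^sup>2 / (2 * r))) / sqrt r" using gauss1_le[OF n(3)] gauss1_pos[OF n(3)] by (simp add: abs_of_pos)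
      also have "\<dots> = (1 / sqrt r) * exp (- (x\<^sup>2 / (2 * r)))" by simp
      also have "\<dots> \<le> (sqrt 6 / sqrt t) * exp (- (x\<^sup>2 / (8 * t)))"
      proof (intro mult_mono n(1))
        have "x\<^sup>2 / (4 * r) \<le> x\<^sup>2 / (2 * r)" using n(3) by (intro divide_left_mono) auto
        then have "exp (- (x\<^sup>2 / (2 * r))) \<le> exp (- (x\<^sup>2 / (4 * r)))" by simp
        then show "exp (- (x\<^sup>2 / (2 * r))) \<le> exp (- (x\<^sup>2 / (8 * t)))" using n(2)[of x] by linarith
      qed (use t in auto)
      also have "\<dots> \<le> (C / sqrt t) * exp (- (x\<^sup>2 / (8 * t)))"
        using C1 t by (intro mult_right_mono divide_right_mono) auto
      finally show ?thesis .
    qed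
    have "\<bar>gauss1 (t + h) x + gauss1 (t - h) x\<bar> \<le> 2 * (C / sqrt t * exp (- (x\<^sup>2 / (8 * t))))"
      using g[of "t + h"] g[of "t - h"] h by linarith
    moreover have "\<bar>a / 2\<bar> \<le> b" if "\<bar>a\<bar> \<le> 2 * b" for a b :: real
      using that by simp
    ultimately show ?thesis unfolding gauss1_mean_def h_def[symmetric] by blast
  qed
  show ?thesis using that[OF C1(2) 1 2] by blast
qed

subsection \<open>Radial Gaussian potentials\<close>

lemma powr_exp_bound:
  fixes a c :: real
  assumes "a > 0" "c > 0"
  obtains K where "K > 0" "\<And>y. y > 0 \<Longrightarrow> y powr a * exp (- (c * y)) \<le> K"
proof
  \<comment> \<open>The witness is the maximum of the function, attained at
    \<open>y = a / c\<close>.\<close>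
  show "exp (a * (- 1 - ln (c / a))) > 0" by simp
  fix y :: real assume y: "y > 0"
  have "ln (c / a * y) \<le> c / a * y - 1" using assms y by (intro ln_le_minus_one) simp
  then have "ln y \<le> c / a * y - 1 - ln (c / a)"
    using ln_mult_pos[of "c / a" y] assms y by simp
  then have "a * ln y \<le> a * (c / a * y - 1 - ln (c / a))" using assms by (intro mult_left_mono) auto
  then have "a * ln y - c * y \<le> a * (- 1 - ln (c / a))" using assms by (simp add: algebra_simps)
  then show "y powr a * exp (- (c * y)) \<le> exp (a * (- 1 - ln (c / a)))"
    using y by (simp add: powr_def flip: exp_add)
qed

text \<open>Telescoping after dividing each factor by its bound \<open>b i\<close>. Errors relative
  to \<open>b i\<close> let the Gaussian weights of the single coordinates multiply to the radial
  weight.\<close>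

lemma prod_diff_le:
  fixes z w b :: "'i \<Rightarrow> real"
  assumes "finite I" and b: "\<And>i. i \<in> I \<Longrightarrow> b i > 0"
    and z: "\<And>i. i \<in> I \<Longrightarrow> \<bar>z i\<bar> \<le> b i" and w: "\<And>i. i \<in> I \<Longrightarrow> \<bar>w i\<bar> \<le> b i"
    and zw: "\<And>i. i \<in> I \<Longrightarrow> \<bar>z i - w i\<bar> \<le> \<eta> * b i"
  shows "\<bar>(\<Prod>i\<in>I. z i) - (\<Prod>i\<in>I. w i)\<bar> \<le> real (card I) * \<eta> * (\<Prod>i\<in>I. b i)"
proof -
  have B: "(\<Prod>i\<in>I. b i) > 0" using b by (simp add: prod_pos)
  have "\<bar>(\<Prod>i\<in>I. z i / b i) - (\<Prod>i\<in>I. w i / b i)\<bar> \<le> (\<Sum>i\<in>I. \<bar>z i / b i - w i / b i\<bar>)"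
  proof -
    have "norm (z i / b i) \<le> 1" "norm (w i / b i) \<le> 1" if "i \<in> I" for i
      using b[OF that] z[OF that] w[OF that] by (auto simp: abs_divide)
    then show ?thesis using norm_prod_diff[of I "\<lambda>i. z i / b i" "\<lambda>i. w i / b i"] by simp
  qed
  also have "\<dots> \<le> (\<Sum>i\<in>I. \<eta>)"
  proof (intro sum_mono)
    fix i assume i: "i \<in> I"
    have "\<bar>z i / b i - w i / b i\<bar> = \<bar>z i - w i\<bar> / b i"
      using b[OF i] by (simp add: abs_divide flip: diff_divide_distrib)
    also have "\<dots> \<le> \<eta> * b i / b i" using zw[OF i] b[OF i] by (intro divide_right_mono) auto
    finally show "\<bar>z i / b i - w i / b i\<bar> \<le> \<eta>" using b[OF i] by simp
  qed
  also have "(\<Prod>i\<in>I. z i / b i) - (\<Prod>i\<in>I. w i / b i) = ((\<Prod>i\<in>I. z i) - (\<Prod>i\<in>I. w i)) / (\<Prod>i\<in>I. b i)"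
    by (simp add: prod_dividef diff_divide_distrib)
  finally show ?thesis using B by (simp add: abs_divide pos_divide_le_eq)
qed

lemma continuous_bounded_integral:
  fixes f g :: "real \<Rightarrow> real"
  assumes f: "continuous_on {0<..} f" and g: "g integrable_on {0<..}"
    and le: "\<And>t. t > 0 \<Longrightarrow> \<bar>f t\<bar> \<le> g t"
  shows "f absolutely_integrable_on {0<..}" "\<bar>integral {0<..} f\<bar> \<le> integral {0<..} g"
proof -
  show *: "f absolutely_integrable_on {0<..}"
    by (rule measurable_bounded_by_integrable_imp_absolutely_integrable[OF _ _ g])
      (use f le in \<open>auto intro: continuous_imp_measurable_on_sets_lebesgue\<close>)
  show "\<bar>integral {0<..} f\<bar> \<le> integral {0<..} g"
    using integral_norm_bound_integral[OF set_lebesgue_integral_eq_integral(1)[OF *] g] le by simp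
qed

lemma integral_derivative_to_inf:
  fixes F f :: "real \<Rightarrow> real"
  assumes F: "\<And>t. t \<ge> 0 \<Longrightarrow> (F has_real_derivative f t) (at t)"
    and f: "f absolutely_integrable_on {0<..}" and lim: "(F \<longlongrightarrow> 0) at_top"
  shows "integral {0<..} f = - F 0"
proof -
  have spike: "negligible {x \<in> {0<..} - {0..}. f x \<noteq> 0}" "negligible {x \<in> {0..} - {0<..}. f x \<noteq> 0}"
    by (auto intro: negligible_subset[of "{0}"])
  have f': "f absolutely_integrable_on {0..}"
    using f absolutely_integrable_spike_set_eq[OF spike] by blast
  have "((\<lambda>b. set_lebesgue_integral lebesgue {0..b} f) \<longlongrightarrow> set_lebesgue_integral lebesgue {0..} f) at_top"
    by (rule tendsto_set_lebesgue_integral_at_top[OF _ f']) auto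
  moreover have "set_lebesgue_integral lebesgue {0..} f = integral {0<..} f"
    using set_lebesgue_integral_eq_integral(2)[OF f'] integral_spike_set[OF spike] by simp
  moreover have "eventually (\<lambda>b. set_lebesgue_integral lebesgue {0..b} f = F b - F 0) at_top"
    using eventually_ge_at_top[of 0]
  proof eventually_elim
    fix b :: real assume b: "b \<ge> 0"
    have "f absolutely_integrable_on {0..b}"
      by (rule set_integrable_subset[OF f']) auto
    then have "set_lebesgue_integral lebesgue {0..b} f = integral {0..b} f"
      by (rule set_lebesgue_integral_eq_integral(2))
    also have "\<dots> = F b - F 0"
      by (intro integral_unique fundamental_theorem_of_calculus b)
         (use F in \<open>auto simp flip: has_real_derivative_iff_has_vector_derivative intro: has_field_derivative_at_within\<close>)
    finally show "set_lebesgue_integral lebesgue {0..b} f = F b - F 0" .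
  qed
  ultimately have "((\<lambda>b. F b - F 0) \<longlongrightarrow> integral {0<..} f) at_top"
    using tendsto_cong by fastforce
  moreover have "((\<lambda>b. F b - F 0) \<longlongrightarrow> 0 - F 0) at_top"
    by (intro tendsto_diff lim tendsto_const)
  ultimately show ?thesis using tendsto_unique[OF trivial_limit_at_top_linorder] by fastforce
qed

definition gauss_radial :: "nat \<Rightarrow> real \<Rightarrow> real \<Rightarrow> real" where
  "gauss_radial d t s = exp (- (s\<^sup>2 / (2 * t))) / sqrt (2 * pi * t) ^ d"

lemma sqrt_power_powr: "t > 0 \<Longrightarrow> sqrt t ^ d = t powr (real d / 2)"
  by (simp add: powr_half_sqrt[symmetric] powr_power)

text \<open>The substitution \<open>t = s^2 / (2 v)\<close> leads to Euler's integral for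
  \<open>Gamma (d / 2)\<close>. The nonnegative integral is the form that Tonelli's theorem needs in
  \<open>gauss_radial_potential\<close>.\<close>

lemma gauss_radial_flux:
  assumes d: "d \<ge> 1" and s: "s > 0"
  shows "(\<integral>\<^sup>+t. ennreal (indicator {0<..} t * (s / t * gauss_radial d t s)) \<partial>lborel)
      = ennreal (Gamma (real d / 2) / pi powr (real d / 2) * s powr (1 - real d))"
proof -
  define p where "p = real d / 2"
  have p: "p > 0" using d by (simp add: p_def)
  define g where "g v = s\<^sup>2 / (2 * v)" for v
  let ?g' = "\<lambda>v. - (s\<^sup>2 / (2 * v\<^sup>2))"
  define f where "f t = s / t * gauss_radial d t s" for t
  have img: "g ` {0<..} = {0<..}"
  proof safe
    fix t :: real assume "t > 0"
    then have "t = g (s\<^sup>2 / (2 * t))" "s\<^sup>2 / (2 * t) > 0" using s by (auto simp: g_def)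
    then show "t \<in> g ` {0<..}" by blast
  qed (use s in \<open>auto simp: g_def\<close>)
  have D: "(g has_field_derivative ?g' v) (at v within {0<..})" if "v \<in> {0<..}" for v
    using that s unfolding g_def by (auto intro!: derivative_eq_intros simp: field_simps power2_eq_square)
  have inj: "inj_on g {0<..}" using s by (auto simp: inj_on_def g_def)
  have eq: "\<bar>?g' v\<bar> * f (g v) = s powr (1 - real d) / pi powr p * (v powr (p - 1) / exp v)" if "v > 0" for v
  proof -
    have gv: "g v > 0" using that s by (simp add: g_def)
    have "sqrt (2 * pi * g v) ^ d = (pi * s\<^sup>2 / v) powr p"
      using that s by (subst sqrt_power_powr) (auto simp: g_def p_def)
    also have "\<dots> = pi powr p * s powr (real d) / v powr p"
    proof -
      have "s\<^sup>2 = s powr 2" using s by simp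
      then have "(s\<^sup>2) powr p = s powr real d" by (simp only: powr_powr) (simp add: p_def)
      then show ?thesis using that s by (simp add: powr_divide powr_mult)
    qed
    finally have 1: "sqrt (2 * pi * g v) ^ d = pi powr p * s powr (real d) / v powr p" .
    have 2: "s\<^sup>2 / (2 * g v) = v" using that s by (simp add: g_def)
    have "\<bar>?g' v\<bar> * (s / g v) = s / v" using that s by (simp add: g_def power2_eq_square)
    then have "\<bar>?g' v\<bar> * f (g v) = s / v * (exp (- v) / (pi powr p * s powr (real d) / v powr p))"
      unfolding f_def gauss_radial_def 1 2 by (metis mult.assoc)
    also have "\<dots> = s powr (1 - real d) / pi powr p * (v powr (p - 1) / exp v)"
      using that s by (simp add: powr_diff exp_minus field_simps)
    finally show ?thesis .
  qed
  have gam: "((\<lambda>t. t powr (p - 1) / exp t) has_integral Gamma p) {0<..}"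
  proof -
    have "((\<lambda>t. if t \<in> {0<..} then t powr (p - 1) / exp t else 0) has_integral Gamma p) {0..}"
      by (rule has_integral_spike[OF _ _ Gamma_integral_real[OF p], of "{0}"]) auto
    then show ?thesis by (subst (asm) has_integral_restrict) auto
  qed
  let ?h = "\<lambda>v. s powr (1 - real d) / pi powr p * (v powr (p - 1) / exp v)"
  have h: "(?h has_integral s powr (1 - real d) / pi powr p * Gamma p) {0<..}"
    by (rule has_integral_mult_right[OF gam])
  then have h': "?h absolutely_integrable_on {0<..}"
    by (intro nonnegative_absolutely_integrable_1) (auto simp: has_integral_integrable)
  have "(\<lambda>v. \<bar>?g' v\<bar> * f (g v)) absolutely_integrable_on {0<..} \<and>
        integral {0<..} (\<lambda>v. \<bar>?g' v\<bar> * f (g v)) = s powr (1 - real d) / pi powr p * Gamma p"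
  proof
    show "(\<lambda>v. \<bar>?g' v\<bar> * f (g v)) absolutely_integrable_on {0<..}"
      using h' by (rule set_integrable_cong[THEN iffD1, rotated -1]) (use eq in auto)
    show "integral {0<..} (\<lambda>v. \<bar>?g' v\<bar> * f (g v)) = s powr (1 - real d) / pi powr p * Gamma p"
      using integral_cong[of "{0<..}" "\<lambda>v. \<bar>?g' v\<bar> * f (g v)" ?h] eq integral_unique[OF h] by simp
  qed
  then have "f absolutely_integrable_on g ` {0<..} \<and> integral (g ` {0<..}) f = s powr (1 - real d) / pi powr p * Gamma p"
    by (subst (asm) has_absolute_integral_change_of_variables_1'[OF _ D inj]) auto
  then have "(f has_integral Gamma p / pi powr p * s powr (1 - real d)) {0<..}"
    unfolding img by (metis (no_types, lifting) has_integral_integral set_lebesgue_integral_eq_integral(1) times_divide_eq_left mult.commute)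
  moreover have "f t \<ge> 0" if "t \<in> {0<..}" for t
    using that s by (simp add: f_def gauss_radial_def)
  ultimately show ?thesis
    using nn_integral_has_integral_lebesgue[of "{0<..}" f] unfolding f_def p_def by simp
qed

lemma gauss_radial_derivative:
  assumes "t > 0"
  shows "((\<lambda>s. gauss_radial d t s) has_real_derivative - (s / t * gauss_radial d t s)) (at s)"
  unfolding gauss_radial_def using assms
  by (auto intro!: derivative_eq_intros simp: field_simps)

text \<open>An antiderivative of the flux in \<open>gauss_radial_flux\<close>. Its additive constant
  is arbitrary, as only differences are compared.\<close>

definition radial_potential :: "nat \<Rightarrow> real \<Rightarrow> real" where
  "radial_potential d s =
    Gamma (real d / 2) / pi powr (real d / 2) * (if d = 2 then ln s else s powr (2 - real d) / (2 - real d))"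

lemma radial_potential_derivative:
  assumes "s > 0"
  shows "(radial_potential d has_real_derivative
    Gamma (real d / 2) / pi powr (real d / 2) * s powr (1 - real d)) (at s)"
proof (cases "d = 2")
  case True
  have "((\<lambda>s. Gamma (real d / 2) / pi powr (real d / 2) * ln s) has_real_derivative
    Gamma (real d / 2) / pi powr (real d / 2) * s powr (1 - real d)) (at s)"
    using True assms by (auto intro!: derivative_eq_intros simp: powr_minus divide_inverse)
  then show ?thesis unfolding radial_potential_def[abs_def] using True by simp
next
  case False
  have "((\<lambda>s. s powr (2 - real d) / (2 - real d)) has_real_derivative
      (2 - real d) * s powr (2 - real d - 1) / (2 - real d)) (at s)"
    by (intro DERIV_cdivide has_real_derivative_powr assms)
  then have "((\<lambda>s. s powr (2 - real d) / (2 - real d)) has_real_derivative s powr (1 - real d)) (at s)"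
    using False by simp
  from DERIV_cmult[OF this, of "Gamma (real d / 2) / pi powr (real d / 2)"] show ?thesis
    unfolding radial_potential_def[abs_def] using False by simp
qed

text \<open>Tonelli for \<open>(\<sigma> / t) * gauss_radial d t \<sigma>\<close>, minus the radial derivative of the heat kernel; this treats
  the logarithmic case \<open>d = 2\<close>, where the time integral of \<open>gauss_radial\<close> itself diverges, together
  with \<open>d \<ge> 3\<close>.\<close>

lemma gauss_radial_potential:
  assumes d: "d \<ge> 1" and s: "0 < r" "r \<le> s"
  shows "((\<lambda>t. gauss_radial d t r - gauss_radial d t s) has_integral
    (radial_potential d s - radial_potential d r)) {0<..}"
proof -
  define c where "c = Gamma (real d / 2) / pi powr (real d / 2)"
  have c: "c > 0" using d by (simp add: c_def Gamma_real_pos)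
  let ?F = "\<lambda>t \<sigma>. ennreal (indicator {0<..} t * (\<sigma> / t * gauss_radial d t \<sigma>)) * indicator {r..s} \<sigma>"
  have [measurable]: "(\<lambda>(t, \<sigma>). ?F t \<sigma>) \<in> borel_measurable (lborel \<Otimes>\<^sub>M lborel)"
    unfolding gauss_radial_def by measurable
  have inner: "(\<integral>\<^sup>+\<sigma>. ?F t \<sigma> \<partial>lborel) = ennreal (indicator {0<..} t * (gauss_radial d t r - gauss_radial d t s))" for t
  proof (cases "t > 0")
    case True
    have "(\<integral>\<^sup>+\<sigma>. ennreal (\<sigma> / t * gauss_radial d t \<sigma>) * indicator {r..s} \<sigma> \<partial>lborel)
      = ennreal (- gauss_radial d t s - - gauss_radial d t r)"
    proof (rule nn_integral_FTC_Icc)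
      show "(\<lambda>\<sigma>. \<sigma> / t * gauss_radial d t \<sigma>) \<in> borel_measurable borel"
        unfolding gauss_radial_def by measurable
      show "((\<lambda>\<sigma>. - gauss_radial d t \<sigma>) has_real_derivative \<sigma> / t * gauss_radial d t \<sigma>) (at \<sigma>)" for \<sigma>
        using DERIV_minus[OF gauss_radial_derivative[OF True, of d \<sigma>]] by simp
      show "0 \<le> \<sigma> / t * gauss_radial d t \<sigma>" if "\<sigma> \<in> {r..s}" for \<sigma>
        using that s True by (simp add: gauss_radial_def)
    qed (use s in auto)
    with True show ?thesis by simp
  qed simp
  have "(\<integral>\<^sup>+t. ennreal (indicator {0<..} t * (gauss_radial d t r - gauss_radial d t s)) \<partial>lborel)
    = (\<integral>\<^sup>+t. \<integral>\<^sup>+\<sigma>. ?F t \<sigma> \<partial>lborel \<partial>lborel)"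
    by (simp only: inner)
  also have "\<dots> = (\<integral>\<^sup>+\<sigma>. \<integral>\<^sup>+t. ?F t \<sigma> \<partial>lborel \<partial>lborel)"
    by (rule lborel_pair.Fubini'[symmetric]) measurable
  also have "\<dots> = (\<integral>\<^sup>+\<sigma>. ennreal (c * \<sigma> powr (1 - real d)) * indicator {r..s} \<sigma> \<partial>lborel)"
  proof (intro nn_integral_cong)
    fix \<sigma> :: real
    show "(\<integral>\<^sup>+t. ?F t \<sigma> \<partial>lborel) = ennreal (c * \<sigma> powr (1 - real d)) * indicator {r..s} \<sigma>"
    proof (cases "\<sigma> \<in> {r..s}")
      case True
      then show ?thesis using gauss_radial_flux[OF d, of \<sigma>] s by (simp add: c_def)
    qed simp
  qed
  also have "\<dots> = ennreal (radial_potential d s - radial_potential d r)"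
  proof (rule nn_integral_FTC_Icc)
    show "(radial_potential d has_real_derivative c * \<sigma> powr (1 - real d)) (at \<sigma>)" if "\<sigma> \<in> {r..s}" for \<sigma>
      using radial_potential_derivative[of \<sigma> d] that s by (simp add: c_def)
  qed (use s c in auto)
  finally have nn: "(\<integral>\<^sup>+t. ennreal (indicator {0<..} t * (gauss_radial d t r - gauss_radial d t s)) \<partial>lborel)
    = ennreal (radial_potential d s - radial_potential d r)" .
  have mono: "radial_potential d r \<le> radial_potential d s"
  proof (rule DERIV_nonneg_imp_nondecreasing[OF s(2)])
    fix x assume "r \<le> x"
    then have "(radial_potential d has_real_derivative c * x powr (1 - real d)) (at x)"
      using radial_potential_derivative[of x d] s by (simp add: c_def)
    moreover have "0 \<le> c * x powr (1 - real d)" using c by simp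
    ultimately show "\<exists>y. (radial_potential d has_real_derivative y) (at x) \<and> 0 \<le> y" by blast
  qed
  have "((\<lambda>t. indicator {0<..} t * (gauss_radial d t r - gauss_radial d t s)) has_integral
      (radial_potential d s - radial_potential d r)) UNIV"
  proof (rule nn_integral_has_integral[OF _ _ nn])
    show "(\<lambda>t. indicator {0<..} t * (gauss_radial d t r - gauss_radial d t s)) \<in> borel_measurable borel"
      unfolding gauss_radial_def by measurable
    fix t :: real
    have "gauss_radial d t s \<le> gauss_radial d t r" if "t > 0"
    proof -
      have "r\<^sup>2 / (2 * t) \<le> s\<^sup>2 / (2 * t)" using s that by (intro divide_right_mono power_mono) auto
      then show ?thesis unfolding gauss_radial_def using that by (intro divide_right_mono) auto
    qed
    then show "0 \<le> indicator {0<..} t * (gauss_radial d t r - gauss_radial d t s)"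
      by (auto simp: indicator_def)
  qed (use mono in auto)
  also have "(\<lambda>t. indicator {0<..} t * (gauss_radial d t r - gauss_radial d t s))
     = (\<lambda>t. if t \<in> {0<..} then gauss_radial d t r - gauss_radial d t s else 0)"
    by (auto simp: fun_eq_iff)
  finally show ?thesis by (simp only: has_integral_restrict_UNIV)
qed

subsection \<open>Comparison of the lattice and Gaussian heat kernels\<close>

definition heat :: "real \<Rightarrow> int ^ 'n \<Rightarrow> real" where
  "heat t x = (\<Prod>i\<in>UNIV. heat1 t (x $ i))"

lemma lnorm_square: "(lnorm x)\<^sup>2 = (\<Sum>i\<in>UNIV. (of_int (x $ i))\<^sup>2)"
  unfolding power2_norm_eq_inner by (simp add: inner_vec_def to_real_vec_def power2_eq_square)

lemma lnorm_ge_one: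
  assumes "x \<noteq> 0"
  shows "lnorm x \<ge> 1"
proof -
  obtain i where "x $ i \<noteq> 0" using assms by (auto simp: vec_eq_iff)
  then have "1 \<le> \<bar>x $ i\<bar>" by linarith
  then have "1 \<le> \<bar>real_of_int (x $ i)\<bar>" by linarith
  then show ?thesis
    using component_le_norm_cart[of "to_real_vec x" i] by (simp add: to_real_vec_def)
qed

lemma prod_gauss1:
  "(\<Prod>i\<in>UNIV. gauss1 t (of_int (x $ i))) = gauss_radial CARD('n) t (lnorm x)" for x :: "int ^ 'n"
proof -
  have "(\<Prod>i\<in>UNIV. exp (- ((of_int (x $ i))\<^sup>2 / (2 * t)))) = exp (\<Sum>i\<in>UNIV. - ((of_int (x $ i))\<^sup>2 / (2 * t)))"
    by (rule exp_sum[symmetric]) simp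
  also have "(\<Sum>i\<in>UNIV. - ((of_int (x $ i))\<^sup>2 / (2 * t))) = - ((lnorm x)\<^sup>2 / (2 * t))"
    by (simp add: lnorm_square sum_negf sum_divide_distrib)
  finally show ?thesis by (simp add: gauss1_def gauss_radial_def prod_dividef)
qed

text \<open>Two replacements in every coordinate. From \<open>heat1\<close> to the Gaussian mean the
  relative error is \<open>1 / t^2\<close> without decay in \<open>x\<close>; from the mean to
  \<open>gauss1\<close> it is \<open>1 / t\<close>, but each factor carries a Gaussian
  weight.\<close>

lemma heat_local_clt:
  obtains K where "K > 0" "\<And>t (x :: int ^ 'n). t \<ge> 1 \<Longrightarrow>
    \<bar>heat t x - gauss_radial CARD('n) t (lnorm x)\<bar> \<le>
      K * (t powr (- real CARD('n) / 2 - 1) * exp (- ((lnorm x)\<^sup>2 / (8 * t))) + t powr (- real CARD('n) / 2 - 2))"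
proof -
  let ?d = "CARD('n)"
  obtain C1 where C1: "C1 > 0" "\<And>t k. t > 0 \<Longrightarrow> \<bar>heat1 t k\<bar> \<le> C1 / sqrt t"
    using heat1_le by metis
  obtain C2 where C2: "C2 > 0" "\<And>t k. t \<ge> 1 \<Longrightarrow> \<bar>heat1 t k - gauss1_mean t (of_int k)\<bar> \<le> C2 / sqrt t ^ 5"
    using heat1_approx by metis
  obtain C3 where C3: "C3 > 0"
    "\<And>t x. t \<ge> 1 \<Longrightarrow> \<bar>gauss1_mean t x - gauss1 t x\<bar> \<le> C3 / sqrt t ^ 3 * exp (- (x\<^sup>2 / (8 * t)))"
    "\<And>t x. t \<ge> 1 \<Longrightarrow> \<bar>gauss1_mean t x\<bar> \<le> C3 / sqrt t * exp (- (x\<^sup>2 / (8 * t)))"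
    using gauss1_mean_bounds by metis
  define C where "C = max (max C1 C2) (max C3 1)"
  have C: "C > 0" "C1 \<le> C" "C2 \<le> C" "C3 \<le> C" "1 \<le> C" by (auto simp: C_def)
  define K where "K = real ?d * C ^ ?d"
  have "\<bar>heat t x - gauss_radial ?d t (lnorm x)\<bar> \<le>
      K * (t powr (- real ?d / 2 - 1) * exp (- ((lnorm x)\<^sup>2 / (8 * t))) + t powr (- real ?d / 2 - 2))"
    if t: "t \<ge> 1" for t and x :: "int ^ 'n"
  proof -
    let ?m = "\<lambda>i. gauss1_mean t (of_int (x $ i))"
    let ?e = "\<lambda>i. exp (- ((of_int (x $ i))\<^sup>2 / (8 * t)))"
    define w where "w = sqrt t"
    have w: "w > 0" "t = w\<^sup>2" using t by (auto simp: w_def)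
    have mean: "\<bar>?m i\<bar> \<le> C / w * ?e i" for i
    proof -
      have "\<bar>?m i\<bar> \<le> C3 / w * ?e i" using C3(3)[OF t] by (simp add: w_def)
      also have "\<dots> \<le> C / w * ?e i" using C w by (intro mult_right_mono divide_right_mono) auto
      finally show ?thesis .
    qed
    have "w ^ ?d = t powr (real ?d / 2)"
      unfolding w_def using t by (intro sqrt_power_powr) simp
    then have wd: "1 / w ^ ?d = t powr (- real ?d / 2)"
      by (simp only: powr_minus_divide minus_divide_left[symmetric])
    have 1: "\<bar>(\<Prod>i\<in>UNIV. heat1 t (x $ i)) - (\<Prod>i\<in>UNIV. ?m i)\<bar> \<le> real ?d * (1 / t\<^sup>2) * (\<Prod>i\<in>(UNIV :: 'n set). C / w)"
    proof (rule prod_diff_le)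
      fix i
      show "C / w > 0" using C w by simp
      show "\<bar>heat1 t (x $ i)\<bar> \<le> C / w"
        using order_trans[OF C1(2)[of t "x $ i", folded w_def] divide_right_mono[OF C(2)]] t w by simp
      have "C / w * ?e i \<le> C / w * 1" using C w t by (intro mult_left_mono) auto
      then show "\<bar>?m i\<bar> \<le> C / w" using mean[of i] by simp
      have "\<bar>heat1 t (x $ i) - ?m i\<bar> \<le> C2 / w ^ 5" using C2(2)[OF t] by (simp add: w_def)
      also have "\<dots> \<le> C / w ^ 5" using C w by (intro divide_right_mono) auto
      also have "\<dots> = 1 / t\<^sup>2 * (C / w)" unfolding w(2) using w(1) by (simp add: eval_nat_numeral)
      finally show "\<bar>heat1 t (x $ i) - ?m i\<bar> \<le> 1 / t\<^sup>2 * (C / w)" .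
    qed simp
    have 2: "\<bar>(\<Prod>i\<in>UNIV. ?m i) - (\<Prod>i\<in>UNIV. gauss1 t (of_int (x $ i)))\<bar> \<le> real ?d * (1 / t) * (\<Prod>i\<in>UNIV. C / w * ?e i)"
    proof (rule prod_diff_le)
      fix i
      show "C / w * ?e i > 0" using C w by simp
      show "\<bar>?m i\<bar> \<le> C / w * ?e i" by (rule mean)
      have "gauss1 t (of_int (x $ i)) \<le> exp (- ((of_int (x $ i))\<^sup>2 / (2 * t))) / w"
        using gauss1_le[of t "of_int (x $ i)"] t by (simp add: w_def)
      also have "\<dots> \<le> ?e i / w"
        using t w by (intro divide_right_mono exp_le_cancel_iff[THEN iffD2] le_imp_neg_le divide_left_mono) auto
      also have "\<dots> \<le> C * ?e i / w" using C w by (intro divide_right_mono) auto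
      finally show "\<bar>gauss1 t (of_int (x $ i))\<bar> \<le> C / w * ?e i"
        using gauss1_pos[of t "of_int (x $ i)"] t by simp
      have "\<bar>?m i - gauss1 t (of_int (x $ i))\<bar> \<le> C3 / w ^ 3 * ?e i" using C3(2)[OF t] by (simp add: w_def)
      also have "\<dots> \<le> C / w ^ 3 * ?e i" using C w by (intro mult_right_mono divide_right_mono) auto
      also have "\<dots> = 1 / t * (C / w * ?e i)" unfolding w(2) using w(1) by (simp add: eval_nat_numeral)
      finally show "\<bar>?m i - gauss1 t (of_int (x $ i))\<bar> \<le> 1 / t * (C / w * ?e i)" .
    qed simp
    have e: "(\<Prod>i\<in>UNIV. ?e i) = exp (- ((lnorm x)\<^sup>2 / (8 * t)))"
    proof -
      have "(\<Prod>i\<in>UNIV. ?e i) = exp (\<Sum>i\<in>UNIV. - ((of_int (x $ i))\<^sup>2 / (8 * t)))"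
        by (rule exp_sum[symmetric]) simp
      also have "(\<Sum>i\<in>UNIV. - ((of_int (x $ i))\<^sup>2 / (8 * t))) = - ((lnorm x)\<^sup>2 / (8 * t))"
        by (simp add: lnorm_square sum_negf sum_divide_distrib)
      finally show ?thesis .
    qed
    have Cw: "(C / w) ^ ?d = C ^ ?d * t powr (- real ?d / 2)"
      using wd by (simp add: power_divide) (metis mult.right_neutral times_divide_eq_right)
    have p1: "real ?d * (1 / t\<^sup>2) * (\<Prod>i\<in>(UNIV :: 'n set). C / w) = K * t powr (- real ?d / 2 - 2)"
      using t by (simp add: Cw[simplified power_divide] power_divide K_def powr_diff)
    have p2: "real ?d * (1 / t) * (\<Prod>i\<in>UNIV. C / w * ?e i) = K * (t powr (- real ?d / 2 - 1) * exp (- ((lnorm x)\<^sup>2 / (8 * t))))"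
    proof -
      have "(\<Prod>i\<in>UNIV. C / w * ?e i) = (C / w) ^ ?d * exp (- ((lnorm x)\<^sup>2 / (8 * t)))"
        unfolding prod.distrib e by simp
      then show ?thesis unfolding Cw using t by (simp add: K_def powr_diff)
    qed
    have "\<bar>heat t x - gauss_radial ?d t (lnorm x)\<bar> \<le>
      K * t powr (- real ?d / 2 - 2) + K * (t powr (- real ?d / 2 - 1) * exp (- ((lnorm x)\<^sup>2 / (8 * t))))"
      using 1 2 unfolding p1 p2 prod_gauss1 heat_def by linarith
    then show ?thesis by (simp add: distrib_left)
  qed
  moreover have "K > 0" using C by (simp add: K_def)
  ultimately show ?thesis using that by blast
qed

text \<open>Some coordinate has \<open>x_i^2 >= |x|^2 / d\<close>; \<open>heat1_tail\<close> applies
  to it, and the other factors are at most 1.\<close>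

lemma heat_tail:
  fixes x :: "int ^ 'n"
  assumes t: "t > 0"
  shows "\<bar>heat t x\<bar> \<le> exp (- (1 / (4 * real CARD('n)) * ((lnorm x)\<^sup>2 / t))) + exp (- (1 / (2 * sqrt (real CARD('n))) * lnorm x))"
proof -
  let ?d = "real CARD('n)"
  have "\<exists>i. (lnorm x)\<^sup>2 \<le> ?d * (of_int (x $ i))\<^sup>2"
  proof (rule ccontr)
    assume "\<not> ?thesis"
    then have "(\<Sum>i\<in>(UNIV :: 'n set). ?d * (of_int (x $ i))\<^sup>2) < (\<Sum>i\<in>(UNIV :: 'n set). (lnorm x)\<^sup>2)"
      by (intro sum_strict_mono) (auto simp: not_le)
    then show False by (simp add: lnorm_square flip: sum_distrib_left)
  qed
  then obtain i where i: "(lnorm x)\<^sup>2 \<le> ?d * (of_int (x $ i))\<^sup>2" ..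
  define k where "k = \<bar>real_of_int (x $ i)\<bar>"
  have k: "(lnorm x)\<^sup>2 \<le> ?d * k\<^sup>2" "k \<ge> 0" using i by (auto simp: k_def)
  have "\<bar>heat t x\<bar> = \<bar>heat1 t (x $ i)\<bar> * (\<Prod>j\<in>UNIV - {i}. \<bar>heat1 t (x $ j)\<bar>)"
    unfolding heat_def by (subst prod.remove[of UNIV i]) (simp_all add: abs_mult abs_prod)
  also have "\<dots> \<le> \<bar>heat1 t (x $ i)\<bar> * 1"
    by (intro mult_left_mono prod_le_1) (use t heat1_le_one in auto)
  also have "\<dots> \<le> exp (- (k\<^sup>2 / (4 * t))) + exp (- (k / 2))"
    using heat1_tail[OF t, of "x $ i"] by (simp add: k_def)
  also have "exp (- (k\<^sup>2 / (4 * t))) \<le> exp (- (1 / (4 * ?d) * ((lnorm x)\<^sup>2 / t)))"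
    using k t by (simp add: field_simps)
  also have "exp (- (k / 2)) \<le> exp (- (1 / (2 * sqrt ?d) * lnorm x))"
  proof -
    have "lnorm x = sqrt ((lnorm x)\<^sup>2)" by simp
    also have "\<dots> \<le> sqrt (?d * k\<^sup>2)" using k(1) by (rule real_sqrt_le_mono)
    also have "\<dots> = sqrt ?d * k" using k by (simp add: real_sqrt_mult)
    finally show ?thesis by (simp add: field_simps)
  qed
  finally show ?thesis by simp
qed

text \<open>A majorant made of pure powers, to be used with \<open>p = d / 2\<close>, so that it
  integrates in closed form. The first term covers \<open>t <= r^2\<close>, where spatial decay
  helps; the second covers later times; the third is the error without spatial decay.\<close>

definition heat_error :: "real \<Rightarrow> real \<Rightarrow> real \<Rightarrow> real" where
  "heat_error p r t = (if t \<le> r\<^sup>2 then r powr (- 2 * p - 2) else 0)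
    + (if r\<^sup>2 \<le> t then t powr (- p - 1) else 0)
    + (if r powr (2 * p / (p + 1)) \<le> t then t powr (- p - 2) else 0)"

text \<open>For \<open>t\<close> below \<open>r powr (2p / (p+1))\<close>, with \<open>r = |x|\<close> and \<open>p = d/2\<close>, both kernels are
  negligible; above it the unweighted error term \<open>t powr (-p-2)\<close> integrates to exactly the order \<open>r powr (-2p)\<close>.\<close>

lemma heat_gauss_difference:
  obtains K where "K > 0" "\<And>t (x :: int ^ 'n). t > 0 \<Longrightarrow> x \<noteq> 0 \<Longrightarrow>
    \<bar>heat t x - gauss_radial CARD('n) t (lnorm x)\<bar> \<le> K * heat_error (real CARD('n) / 2) (lnorm x) t"
proof -
  define p where "p = real CARD('n) / 2"
  have p: "p > 0" by (simp add: p_def)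
  have d: "real CARD('n) = 2 * p" by (simp add: p_def)
  obtain K0 where K0: "K0 > 0" "\<And>t (x :: int ^ 'n). t \<ge> 1 \<Longrightarrow>
    \<bar>heat t x - gauss_radial CARD('n) t (lnorm x)\<bar> \<le>
      K0 * (t powr (- p - 1) * exp (- ((lnorm x)\<^sup>2 / (8 * t))) + t powr (- p - 2))"
  proof -
    have e: "- real CARD('n) / 2 = - p" by (simp add: p_def)
    show thesis by (rule heat_local_clt[where 'n = 'n, unfolded e, OF that])
  qed
  \<comment> \<open>The exponents are tuned to produce \<open>r powr (- 2 * p - 2)\<close>. Below
    the threshold, \<open>r^2 / t >= r powr (2 / (p + 1))\<close>, and the power
    \<open>- (p + 1)^2\<close> of the right side is exactly that. \<open>K2\<close> treats the
    exponential tail, \<open>K3\<close> the Gaussian below the threshold, \<open>K4\<close> the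
    Gaussian weight up to time \<open>r^2\<close>.\<close>
  obtain K1 where K1: "K1 > 0" "\<And>y. y > 0 \<Longrightarrow> y powr ((p + 1)\<^sup>2) * exp (- (1 / (4 * real CARD('n)) * y)) \<le> K1"
    using powr_exp_bound[of "(p + 1)\<^sup>2" "1 / (4 * real CARD('n))"] p by auto
  obtain K2 where K2: "K2 > 0" "\<And>y. y > 0 \<Longrightarrow> y powr (2 * p + 2) * exp (- (1 / (2 * sqrt (real CARD('n))) * y)) \<le> K2"
    using powr_exp_bound[of "2 * p + 2" "1 / (2 * sqrt (real CARD('n)))"] p by auto
  obtain K3 where K3: "K3 > 0" "\<And>y. y > 0 \<Longrightarrow> y powr (2 * p + 1) * exp (- (1 / 2 * y)) \<le> K3"
    using powr_exp_bound[of "2 * p + 1" "1 / 2"] p by auto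
  obtain K4 where K4: "K4 > 0" "\<And>y. y > 0 \<Longrightarrow> y powr (p + 1) * exp (- (1 / 8 * y)) \<le> K4"
    using powr_exp_bound[of "p + 1" "1 / 8"] p by auto
  define K where "K = K1 + K2 + K3 + K0 * (K4 + 1)"
  have KK: "K > 0" "K1 + K2 + K3 \<le> K" "K0 * K4 \<le> K" "K0 \<le> K"
    using K0 K1 K2 K3 K4 by (auto simp: K_def algebra_simps add_pos_pos intro!: add_nonneg_nonneg)
  have "\<bar>heat t x - gauss_radial CARD('n) t (lnorm x)\<bar> \<le> K * heat_error p (lnorm x) t"
    if t: "t > 0" and x: "x \<noteq> 0" for t and x :: "int ^ 'n"
  proof -
    define r where "r = lnorm x"
    have r: "r \<ge> 1" using lnorm_ge_one[OF x] by (simp add: r_def)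
    define T where "T = r powr (2 * p / (p + 1))"
    have T1: "T \<ge> 1" using r p by (simp add: T_def ge_one_powr_ge_zero)
    have T2: "T \<le> r\<^sup>2"
    proof -
      have "T \<le> r powr 2" unfolding T_def using r p by (intro powr_mono) (auto simp: field_simps)
      then show ?thesis using r by simp
    qed
    have y: "r\<^sup>2 / t > 0" using r t by simp
    define E where "E = r powr (- 2 * p - 2)"
    have E0: "E > 0" using r by (simp add: E_def)
    have r2: "r\<^sup>2 = r powr 2" using r by simp
    show ?thesis
    proof (cases "t < T")
      case True
      have "\<bar>heat t x\<bar> \<le> K1 * E + K2 * E"
      proof -
        have "exp (- (1 / (4 * real CARD('n)) * (r\<^sup>2 / t))) \<le> K1 * (r\<^sup>2 / t) powr (- ((p + 1)\<^sup>2))"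
        proof -
          have "exp (- (1 / (4 * real CARD('n)) * (r\<^sup>2 / t))) \<le> K1 / (r\<^sup>2 / t) powr ((p + 1)\<^sup>2)"
            using K1(2)[OF y] y by (subst pos_le_divide_eq) (auto simp: mult.commute)
          then show ?thesis unfolding powr_minus divide_inverse .
        qed
        also have "(r\<^sup>2 / t) powr (- ((p + 1)\<^sup>2)) \<le> (r powr (2 / (p + 1))) powr (- ((p + 1)\<^sup>2))"
        proof (rule powr_mono2')
          have "r powr (2 / (p + 1)) * t \<le> r powr (2 / (p + 1)) * T" using True by (intro mult_left_mono) auto
          also have "\<dots> = r powr (2 / (p + 1) + 2 * p / (p + 1))" by (simp add: T_def powr_add)
          also have "2 / (p + 1) + 2 * p / (p + 1) = 2"
            unfolding add_divide_distrib[symmetric] using p by (simp add: divide_eq_eq)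
          finally show "r powr (2 / (p + 1)) \<le> r\<^sup>2 / t" using t r by (simp add: field_simps)
        qed (use r in auto)
        also have "\<dots> = E"
        proof -
          have "2 / q * (- (q\<^sup>2)) = - (2 * q)" if "q > 0" for q :: real
            using that by (simp add: power2_eq_square)
          from this[of "p + 1"] show ?thesis unfolding powr_powr E_def using p by simp
        qed
        finally have 1: "exp (- (1 / (4 * real CARD('n)) * (r\<^sup>2 / t))) \<le> K1 * E" using K1 by simp
        have "r > 0" using r by simp
        then have "exp (- (1 / (2 * sqrt (real CARD('n))) * r)) \<le> K2 / r powr (2 * p + 2)"
          using K2(2)[of r] by (subst pos_le_divide_eq) (auto simp: mult.commute)
        then have "exp (- (1 / (2 * sqrt (real CARD('n))) * r)) \<le> K2 * r powr (- (2 * p + 2))"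
          unfolding powr_minus divide_inverse .
        also have "- (2 * p + 2) = - 2 * p - 2" by simp
        also have "r powr \<dots> = E" by (simp add: E_def)
        finally have 2: "exp (- (1 / (2 * sqrt (real CARD('n))) * r)) \<le> K2 * E" .
        show ?thesis using heat_tail[OF t, of x] 1 2 unfolding r_def by linarith
      qed
      moreover have "\<bar>gauss_radial CARD('n) t r\<bar> \<le> K3 * E"
      proof -
        have "1 * t \<le> 2 * pi * t" using t pi_ge_two by (intro mult_right_mono) auto
        then have "sqrt t ^ CARD('n) \<le> sqrt (2 * pi * t) ^ CARD('n)"
          using t by (intro power_mono real_sqrt_le_mono) auto
        moreover have "0 < sqrt (2 * pi * t) ^ CARD('n) * sqrt t ^ CARD('n)"
          using t mult_pos_pos[OF pi_gt_zero t] by (intro mult_pos_pos zero_less_power real_sqrt_gt_zero) simp_all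
        ultimately have "exp (- (r\<^sup>2 / (2 * t))) / sqrt (2 * pi * t) ^ CARD('n) \<le> exp (- (r\<^sup>2 / (2 * t))) / sqrt t ^ CARD('n)"
          by (rule divide_left_mono[OF _ exp_ge_zero])
        moreover have "\<bar>gauss_radial CARD('n) t r\<bar> = exp (- (r\<^sup>2 / (2 * t))) / sqrt (2 * pi * t) ^ CARD('n)"
          unfolding gauss_radial_def using t by (intro abs_of_nonneg divide_nonneg_nonneg zero_le_power real_sqrt_ge_zero) simp_all
        ultimately have "\<bar>gauss_radial CARD('n) t r\<bar> \<le> exp (- (r\<^sup>2 / (2 * t))) / sqrt t ^ CARD('n)"
          by (simp only:)
        also have "\<dots> = exp (- (1 / 2 * (r\<^sup>2 / t))) * t powr (- p)"
        proof -
          have 1: "sqrt t ^ CARD('n) = t powr p" unfolding p_def by (rule sqrt_power_powr[OF t])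
          have 2: "r\<^sup>2 / (2 * t) = 1 / 2 * (r\<^sup>2 / t)" by simp
          show ?thesis unfolding 1 2 powr_minus_divide by simp
        qed
        also have "\<dots> \<le> (K3 * (r\<^sup>2 / t) powr (- (2 * p + 1))) * t powr (- p)"
        proof (rule mult_right_mono)
          have "exp (- (1 / 2 * (r\<^sup>2 / t))) \<le> K3 / (r\<^sup>2 / t) powr (2 * p + 1)"
            using K3(2)[OF y] y by (subst pos_le_divide_eq) (auto simp: mult.commute)
          then show "exp (- (1 / 2 * (r\<^sup>2 / t))) \<le> K3 * (r\<^sup>2 / t) powr (- (2 * p + 1))"
            unfolding powr_minus divide_inverse .
        qed simp
        also have "\<dots> = K3 * (r powr (- 4 * p - 2) * t powr (p + 1))"
        proof -
          have "(r\<^sup>2 / t) powr (- (2 * p + 1)) = r powr (2 * (- (2 * p + 1))) / t powr (- (2 * p + 1))"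
            unfolding r2 using r t by (simp only: powr_divide powr_powr)
          also have "\<dots> * t powr (- p) = r powr (2 * (- (2 * p + 1))) * t powr (- (- (2 * p + 1)) + - p)"
            unfolding powr_add powr_minus[of t "- (2 * p + 1)"] by (simp add: divide_inverse)
          also have "- (- (2 * p + 1)) + - p = p + 1" by simp
          also have "2 * (- (2 * p + 1)) = - 4 * p - 2" by simp
          finally show ?thesis by (simp only: mult.assoc)
        qed
        also have "\<dots> \<le> K3 * (r powr (- 4 * p - 2) * T powr (p + 1))"
          using True t K3 p by (intro mult_left_mono powr_mono2) auto
        also have "T powr (p + 1) = r powr (2 * p)"
          unfolding T_def powr_powr using p by simp
        also have "r powr (- 4 * p - 2) * r powr (2 * p) = E"
          unfolding E_def powr_add[symmetric] by simp
        finally show ?thesis .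
      qed
      ultimately have "\<bar>heat t x - gauss_radial CARD('n) t r\<bar> \<le> (K1 + K2 + K3) * E"
        by (simp add: algebra_simps)
      also have "\<dots> \<le> K * E" using KK E0 by (intro mult_right_mono) auto
      also have "\<dots> \<le> K * heat_error p r t"
        using KK True T2 E0 by (intro mult_left_mono) (auto simp: heat_error_def E_def)
      finally show ?thesis by (simp add: r_def)
    next
      case False
      then have t1: "t \<ge> 1" using T1 by simp
      have b: "\<bar>heat t x - gauss_radial CARD('n) t r\<bar> \<le> K0 * (t powr (- p - 1) * exp (- (r\<^sup>2 / (8 * t)))) + K0 * t powr (- p - 2)"
        using K0(2)[OF t1, of x] by (simp add: r_def distrib_left)
      have 2: "K0 * t powr (- p - 2) \<le> K * t powr (- p - 2)" using KK by (intro mult_right_mono) auto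
      have "K0 * (t powr (- p - 1) * exp (- (r\<^sup>2 / (8 * t)))) \<le> K * ((if t \<le> r\<^sup>2 then E else 0) + (if r\<^sup>2 \<le> t then t powr (- p - 1) else 0))"
      proof (cases "t \<le> r\<^sup>2")
        case True
        have "exp (- (1 / 8 * (r\<^sup>2 / t))) \<le> K4 / (r\<^sup>2 / t) powr (p + 1)"
          using K4(2)[OF y] y by (subst pos_le_divide_eq) (auto simp: mult.commute)
        then have "t powr (- p - 1) * exp (- (1 / 8 * (r\<^sup>2 / t))) \<le> t powr (- p - 1) * (K4 / (r\<^sup>2 / t) powr (p + 1))"
          by (rule mult_left_mono) simp
        also have "\<dots> = K4 * E"
        proof -
          have e1: "(r\<^sup>2 / t) powr (p + 1) = r powr (2 * (p + 1)) / t powr (p + 1)"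
            unfolding r2 using r t by (simp only: powr_divide powr_powr)
          have e2: "t powr (- p - 1) = inverse (t powr (p + 1))" by (simp flip: powr_minus)
          have e3: "E = inverse (r powr (2 * (p + 1)))"
          proof -
            have "- 2 * p - 2 = - (2 * (p + 1))" by simp
            then show ?thesis unfolding E_def by (simp only: powr_minus)
          qed
          have "inverse a * (K4 / (b / a)) = K4 * inverse b" if "a \<noteq> 0" for a b :: real
            using that by (simp add: divide_inverse)
          then show ?thesis unfolding e1 e2 e3 using t by simp
        qed
        finally have "K0 * (t powr (- p - 1) * exp (- (1 / 8 * (r\<^sup>2 / t)))) \<le> K0 * (K4 * E)"
          using K0 by (intro mult_left_mono) auto
        also have "\<dots> = (K0 * K4) * E" by simp
        also have "\<dots> \<le> K * E" using KK E0 by (intro mult_right_mono) auto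
        also have "\<dots> \<le> K * ((if t \<le> r\<^sup>2 then E else 0) + (if r\<^sup>2 \<le> t then t powr (- p - 1) else 0))"
          using True KK by (intro mult_left_mono) auto
        finally show ?thesis by simp
      next
        case False
        have "K0 * (t powr (- p - 1) * exp (- (r\<^sup>2 / (8 * t)))) \<le> K * (t powr (- p - 1) * 1)"
          using KK K0 t by (intro mult_mono) auto
        then show ?thesis using False by simp
      qed
      with b 2 have "\<bar>heat t x - gauss_radial CARD('n) t r\<bar> \<le>
         K * ((if t \<le> r\<^sup>2 then E else 0) + (if r\<^sup>2 \<le> t then t powr (- p - 1) else 0)) + K * t powr (- p - 2)"
        by linarith
      also have "\<dots> = K * heat_error p r t"
        using False unfolding heat_error_def E_def T_def[symmetric] by (simp add: distrib_left)
      finally show ?thesis by (simp add: r_def)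
    qed
  qed
  then show ?thesis using that[of K] KK by (simp add: p_def)
qed

lemma has_integral_upto:
  fixes b c :: real
  assumes "b > 0"
  shows "((\<lambda>t. if t \<le> b then c else 0) has_integral b * c) {0<..}"
proof -
  have "((\<lambda>t. c) has_integral b * c) {0..b}" using has_integral_const_real[of c 0 b] assms by simp
  then have "((\<lambda>t. c) has_integral b * c) {0<..b}"
    by (rule has_integral_spike_set_eq[THEN iffD1, rotated 2]) (auto intro: negligible_subset[of "{0}"])
  then have "((\<lambda>t. if t \<in> {0<..b} then c else 0) has_integral b * c) {0<..}"
    by (subst has_integral_restrict) auto
  then show ?thesis by (rule has_integral_eq[rotated]) auto
qed

lemma has_integral_powr_from:
  fixes a e :: real
  assumes "a > 0" "e < -1"
  shows "((\<lambda>t. if a \<le> t then t powr e else 0) has_integral - (a powr (e + 1)) / (e + 1)) {0<..}"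
proof -
  have "((\<lambda>t. if t \<in> {a..} then t powr e else 0) has_integral - (a powr (e + 1)) / (e + 1)) {0<..}"
    using has_integral_powr_to_inf[OF assms(2,1)] assms by (subst has_integral_restrict) auto
  then show ?thesis by simp
qed

lemma heat_error_integral:
  assumes p: "p > 0" and r: "r \<ge> 1"
  shows "(heat_error p r has_integral (1 + 1 / p + 1 / (p + 1)) * r powr (- 2 * p)) {0<..}"
proof -
  let ?T = "r powr (2 * p / (p + 1))"
  have r2: "r\<^sup>2 = r powr 2" using r by simp
  have "(heat_error p r has_integral r\<^sup>2 * r powr (- 2 * p - 2)
      + - ((r\<^sup>2) powr (- p - 1 + 1)) / (- p - 1 + 1) + - (?T powr (- p - 2 + 1)) / (- p - 2 + 1)) {0<..}"
    unfolding heat_error_def[abs_def]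
    by (intro has_integral_add has_integral_upto has_integral_powr_from) (use p r in auto)
  also have "r\<^sup>2 * r powr (- 2 * p - 2) = r powr (- 2 * p)"
    unfolding r2 powr_add[symmetric] by simp
  also have "- ((r\<^sup>2) powr (- p - 1 + 1)) / (- p - 1 + 1) = 1 / p * r powr (- 2 * p)"
    unfolding r2 powr_powr by simp
  also have "- (?T powr (- p - 2 + 1)) / (- p - 2 + 1) = 1 / (p + 1) * r powr (- 2 * p)"
  proof -
    have "2 * p / (p + 1) * (- p - 2 + 1) = - 2 * p" using p by (simp add: field_simps)
    then have 1: "?T powr (- p - 2 + 1) = r powr (- 2 * p)" unfolding powr_powr by simp
    have 2: "- p - 2 + 1 = - (p + 1)" by simp
    have 3: "- a / - b = 1 / b * a" for a b :: real by simp
    show ?thesis unfolding 1 unfolding 2 by (rule 3)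
  qed
  finally show ?thesis by (simp add: algebra_simps)
qed

subsection \<open>The potential kernel of the lattice\<close>

text \<open>Each coordinate jumps at rate 1, so the product walk has total rate \<open>d\<close>;
  this is the factor in front of the normalised \<open>lap\<close>.\<close>

lemma heat_has_derivative:
  "((\<lambda>t. heat t x) has_real_derivative real CARD('n) * lap (heat t) x) (at t)" for x :: "int ^ 'n"
proof -
  let ?P = "\<lambda>i. \<Prod>j\<in>UNIV - {i}. heat1 t (x $ j)"
  have shift: "heat t (x + axis i 1) = heat1 t (x $ i + 1) * ?P i" "heat t (x - axis i 1) = heat1 t (x $ i - 1) * ?P i"
    "heat t x = heat1 t (x $ i) * ?P i" for i
    unfolding heat_def by (subst prod.remove[of UNIV i]; simp add: axis_def)+
  have "((\<lambda>t. heat t x) has_real_derivative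
     (\<Sum>i\<in>UNIV. (heat1 t (x $ i + 1) + heat1 t (x $ i - 1) - 2 * heat1 t (x $ i)) / 2 * ?P i)) (at t)"
    unfolding heat_def by (intro has_field_derivative_prod heat1_has_derivative)
  also have "(\<Sum>i\<in>UNIV. (heat1 t (x $ i + 1) + heat1 t (x $ i - 1) - 2 * heat1 t (x $ i)) / 2 * ?P i)
    = (\<Sum>i\<in>UNIV. (heat t (x + axis i 1) + heat t (x - axis i 1)) / 2 - heat t x)"
  proof (intro sum.cong refl)
    fix i
    have "(a + b - 2 * c) / 2 * q = (a * q + b * q) / 2 - c * q" for a b c q :: real
      by (simp add: field_simps)
    then show "(heat1 t (x $ i + 1) + heat1 t (x $ i - 1) - 2 * heat1 t (x $ i)) / 2 * ?P i
      = (heat t (x + axis i 1) + heat t (x - axis i 1)) / 2 - heat t x"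
      unfolding shift(1,2) shift(3)[of i] .
  qed
  also have "\<dots> = real CARD('n) * lap (heat t) x"
    by (simp add: lap_def sum_subtractf right_diff_distrib flip: sum_divide_distrib)
  finally show ?thesis .
qed

lemma heat_zero: "heat 0 x = point_mass 0 x"
proof (cases "x = 0")
  case False
  then obtain i where "x $ i \<noteq> 0" by (auto simp: vec_eq_iff)
  then have "heat1 0 (x $ i) = 0" by (simp add: heat1_zero)
  then show ?thesis using False by (auto simp: heat_def)
qed (simp add: heat_def heat1_zero)

lemma continuous_heat: "continuous_on S (\<lambda>t. heat t x)"
  using heat_has_derivative[of x] by (meson DERIV_continuous_on has_field_derivative_at_within)

lemma heat_le_one: "t \<ge> 0 \<Longrightarrow> \<bar>heat t x\<bar> \<le> 1"
  unfolding heat_def abs_prod by (intro prod_le_1) (auto simp: heat1_le_one)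

text \<open>The cancellation in the second bound gains a factor \<open>1 / t\<close>. This makes the
  difference integrable at infinity even for \<open>d = 2\<close>, where the bound on the kernel
  itself is not.\<close>

lemma heat_bounds:
  obtains C where "C > 0" "\<And>t (x :: int ^ 'n). t > 0 \<Longrightarrow> \<bar>heat t x\<bar> \<le> C * t powr (- real CARD('n) / 2)"
    "\<And>t (x :: int ^ 'n). t > 0 \<Longrightarrow> \<bar>heat t (0 :: int ^ 'n) - heat t x\<bar> \<le> C * (lnorm x)\<^sup>2 * t powr (- real CARD('n) / 2 - 1)"
proof -
  let ?d = "CARD('n)"
  obtain C where C: "C > 0" "\<And>t k. t > 0 \<Longrightarrow> \<bar>heat1 t k\<bar> \<le> C / sqrt t"
    "\<And>t k. t > 0 \<Longrightarrow> \<bar>heat1 t 0 - heat1 t k\<bar> \<le> C * (of_int k)\<^sup>2 / sqrt t ^ 3"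
    using heat1_le by metis
  have pw: "(C / sqrt t) ^ ?d = C ^ ?d * t powr (- real ?d / 2)" if "t > 0" for t
  proof -
    have "sqrt t ^ ?d = t powr (real ?d / 2)" using that by (rule sqrt_power_powr)
    then show ?thesis
      unfolding power_divide by (simp only: powr_minus divide_inverse minus_divide_left[symmetric, unfolded divide_inverse] mult_minus_left)
  qed
  have 1: "\<bar>heat t x\<bar> \<le> (real ?d * C ^ ?d) * t powr (- real ?d / 2)" if t: "t > 0" for t and x :: "int ^ 'n"
  proof -
    have "\<bar>heat t x\<bar> \<le> (\<Prod>i\<in>(UNIV :: 'n set). C / sqrt t)"
      unfolding heat_def abs_prod by (intro prod_mono conjI C(2) t) simp
    also have "\<dots> = C ^ ?d * t powr (- real ?d / 2)" using pw[OF t] by simp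
    also have "\<dots> \<le> (real ?d * C ^ ?d) * t powr (- real ?d / 2)"
    proof (rule mult_right_mono)
      have "1 * C ^ ?d \<le> real ?d * C ^ ?d" using C by (intro mult_right_mono) (simp_all add: Suc_le_eq)
      then show "C ^ ?d \<le> real ?d * C ^ ?d" by simp
    qed simp
    finally show ?thesis .
  qed
  have 2: "\<bar>heat t (0 :: int ^ 'n) - heat t x\<bar> \<le> (real ?d * C ^ ?d) * (lnorm x)\<^sup>2 * t powr (- real ?d / 2 - 1)" if t: "t > 0" for t and x :: "int ^ 'n"
  proof -
    have "\<bar>(\<Prod>i\<in>(UNIV :: 'n set). heat1 t 0) - (\<Prod>i\<in>UNIV. heat1 t (x $ i))\<bar> \<le> real ?d * ((lnorm x)\<^sup>2 / t) * (\<Prod>i\<in>(UNIV :: 'n set). C / sqrt t)"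
    proof (rule prod_diff_le)
      fix i
      show "C / sqrt t > 0" using C t by simp
      have "(of_int (x $ i))\<^sup>2 \<le> (lnorm x)\<^sup>2"
        unfolding lnorm_square by (rule member_le_sum) auto
      then have "C * (of_int (x $ i))\<^sup>2 / sqrt t ^ 3 \<le> C * (lnorm x)\<^sup>2 / sqrt t ^ 3"
        using C t by (intro divide_right_mono mult_left_mono) auto
      also have "\<dots> = (lnorm x)\<^sup>2 / t * (C / sqrt t)"
        using t by (simp add: power3_eq_cube field_simps)
      finally show "\<bar>heat1 t 0 - heat1 t (x $ i)\<bar> \<le> (lnorm x)\<^sup>2 / t * (C / sqrt t)"
        using C(3)[OF t, of "x $ i"] by simp
    qed (auto intro: C(2) t)
    also have "(\<Prod>i\<in>(UNIV :: 'n set). C / sqrt t) = C ^ ?d * t powr (- real ?d / 2)" using pw[OF t] by simp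
    also have "real ?d * ((lnorm x)\<^sup>2 / t) * (C ^ ?d * t powr (- real ?d / 2)) = (real ?d * C ^ ?d) * (lnorm x)\<^sup>2 * t powr (- real ?d / 2 - 1)"
      using t by (simp add: powr_diff)
    finally show ?thesis by (simp add: heat_def)
  qed
  show ?thesis by (rule that[OF _ 1 2]) (use C in auto)
qed

lemma heat_tendsto_zero: "((\<lambda>t. heat t x) \<longlongrightarrow> 0) at_top" for x :: "int ^ 'n"
proof -
  obtain C where C: "C > 0" "\<And>t (x :: int ^ 'n). t > 0 \<Longrightarrow> \<bar>heat t x\<bar> \<le> C * t powr (- real CARD('n) / 2)"
    using heat_bounds by metis
  have "((\<lambda>t. C * t powr (- real CARD('n) / 2)) \<longlongrightarrow> C * 0) at_top"
    by (intro tendsto_intros tendsto_neg_powr filterlim_ident) simp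
  then have lim: "((\<lambda>t. C * t powr (- real CARD('n) / 2)) \<longlongrightarrow> 0) at_top" by simp
  have "eventually (\<lambda>t. norm (heat t x) \<le> C * t powr (- real CARD('n) / 2)) at_top"
    using eventually_gt_at_top[of 0] by eventually_elim (use C(2) in simp)
  then show ?thesis using lim by (rule Lim_null_comparison)
qed

lemma heat_difference_integrable:
  "(\<lambda>t. heat t (0 :: int ^ 'n) - heat t x) absolutely_integrable_on {0<..}" for x :: "int ^ 'n"
proof -
  obtain C where C: "C > 0"
    "\<And>t (x :: int ^ 'n). t > 0 \<Longrightarrow> \<bar>heat t (0 :: int ^ 'n) - heat t x\<bar> \<le> C * (lnorm x)\<^sup>2 * t powr (- real CARD('n) / 2 - 1)"
    using heat_bounds by metis
  let ?g = "\<lambda>t. (if t \<le> 1 then 2 else 0) + C * (lnorm x)\<^sup>2 * (if 1 \<le> t then t powr (- real CARD('n) / 2 - 1) else 0)"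
  show ?thesis
  proof (rule continuous_bounded_integral(1))
    show "continuous_on {0<..} (\<lambda>t. heat t (0 :: int ^ 'n) - heat t x)"
      by (intro continuous_on_diff continuous_heat)
    have "(?g has_integral 1 * 2 + C * (lnorm x)\<^sup>2 * (- (1 powr (- real CARD('n) / 2 - 1 + 1)) / (- real CARD('n) / 2 - 1 + 1))) {0<..}"
      by (intro has_integral_add has_integral_mult_right has_integral_upto has_integral_powr_from) auto
    then show "?g integrable_on {0<..}" by (rule has_integral_integrable)
    fix t :: real assume t: "t > 0"
    show "\<bar>heat t (0 :: int ^ 'n) - heat t x\<bar> \<le> ?g t"
    proof (cases "t \<le> 1")
      case True
      have "\<bar>heat t (0 :: int ^ 'n) - heat t x\<bar> \<le> 2"
        using heat_le_one[of t "0 :: int ^ 'n"] heat_le_one[of t x] t by (simp add: abs_le_iff)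
      moreover have "0 \<le> C * (lnorm x)\<^sup>2 * (if 1 \<le> t then t powr (- real CARD('n) / 2 - 1) else 0)"
        using C by simp
      ultimately show ?thesis using True by simp
    next
      case False
      then show ?thesis using C(2)[OF t, of x] by simp
    qed
  qed
qed

text \<open>The potential kernel of simple random walk. Subtracting from the value at the origin
  makes the integral converge also in the recurrent case; the factor \<open>CARD('n)\<close>
  compensates the total jump rate.\<close>

definition potential :: "int ^ 'n \<Rightarrow> real" where
  "potential x = real CARD('n) * integral {0<..} (\<lambda>t. heat t (0 :: int ^ 'n) - heat t x)"

text \<open>Under the integral, the Laplacian of the difference is minus the time derivative of the
  kernel divided by \<open>d\<close>, so the integral reduces to the initial value
  \<open>heat 0 x\<close>.\<close>

lemma lap_potential: "lap potential x = point_mass 0 x" for x :: "int ^ 'n"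
proof -
  let ?d = "real CARD('n)"
  let ?h = "\<lambda>y t. heat t (0 :: int ^ 'n) - heat t y"
  have I: "(?h y has_integral potential y / ?d) {0<..}" for y :: "int ^ 'n"
    using heat_difference_integrable[of y] by (simp add: potential_def set_lebesgue_integral_eq_integral(1) integrable_integral)
  have "((\<lambda>t. lap (\<lambda>y. ?h y t) x) has_integral lap (\<lambda>y. potential y / ?d) x) {0<..}"
    unfolding lap_def by (intro has_integral_diff has_integral_divide has_integral_sum has_integral_add I) simp
  moreover have "lap (\<lambda>y. potential y / ?d) x = lap potential x / ?d"
    using lap_cmult[of "1 / ?d" potential x] by simp
  moreover have "lap (\<lambda>y. ?h y t) x = - lap (heat t) x" for t
    by (simp add: lap_diff lap_const)
  ultimately have "((\<lambda>t. - lap (heat t) x) has_integral lap potential x / ?d) {0<..}" by simp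
  from has_integral_mult_right[OF this, of "- ?d"]
  have J: "((\<lambda>t. ?d * lap (heat t) x) has_integral - lap potential x) {0<..}" by simp
  have "(\<lambda>t. - ?d * lap (\<lambda>y. ?h y t) x) absolutely_integrable_on {0<..}"
    unfolding lap_def
    by (intro set_integrable_mult_right set_integral_diff(1) set_integrable_divide absolutely_integrable_sum
        set_integral_add(1) heat_difference_integrable) auto
  then have "(\<lambda>t. ?d * lap (heat t) x) absolutely_integrable_on {0<..}"
    by (simp add: \<open>\<And>t. lap (\<lambda>y. ?h y t) x = - lap (heat t) x\<close>)
  from integral_derivative_to_inf[OF _ this heat_tendsto_zero, of x] heat_has_derivative
  have "integral {0<..} (\<lambda>t. ?d * lap (heat t) x) = - heat 0 x" by blast
  then show ?thesis using integral_unique[OF J] heat_zero[of x] by simp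
qed

text \<open>In a difference between two sites the term \<open>heat t 0\<close> cancels. Each kernel
  is then compared with its own Gaussian, and the integral of \<open>heat_error\<close> bounds each
  discrepancy.\<close>

lemma potential_asymptotics:
  obtains C where "C > 0" "\<And>(x :: int ^ 'n) (y :: int ^ 'n). x \<noteq> 0 \<Longrightarrow> y \<noteq> 0 \<Longrightarrow>
    \<bar>potential x - potential y - real CARD('n) * (radial_potential CARD('n) (lnorm x) - radial_potential CARD('n) (lnorm y))\<bar>
      \<le> C * (lnorm x powr (- real CARD('n)) + lnorm y powr (- real CARD('n)))"
proof -
  let ?d = "CARD('n)"
  define p where "p = real ?d / 2"
  have p: "p > 0" by (simp add: p_def)
  obtain K where K: "K > 0" "\<And>t (x :: int ^ 'n). t > 0 \<Longrightarrow> x \<noteq> 0 \<Longrightarrow>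
    \<bar>heat t x - gauss_radial ?d t (lnorm x)\<bar> \<le> K * heat_error p (lnorm x) t"
    using heat_gauss_difference unfolding p_def by metis
  define L where "L = K * (1 + 1 / p + 1 / (p + 1))"
  have L: "L > 0" using K p by (simp add: L_def add_pos_pos)
  let ?e = "\<lambda>x t. heat t x - gauss_radial ?d t (lnorm x)"
  have E: "?e x absolutely_integrable_on {0<..}" "\<bar>integral {0<..} (?e x)\<bar> \<le> L * lnorm x powr (- real ?d)"
    if x: "x \<noteq> 0" for x :: "int ^ 'n"
  proof -
    have c: "continuous_on {0<..} (?e x)"
      unfolding gauss_radial_def
      by (intro continuous_on_diff continuous_heat continuous_intros) auto
    have g: "((\<lambda>t. K * heat_error p (lnorm x) t) has_integral K * ((1 + 1 / p + 1 / (p + 1)) * lnorm x powr (- 2 * p))) {0<..}"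
      by (intro has_integral_mult_right heat_error_integral p lnorm_ge_one x)
    note b = continuous_bounded_integral[OF c has_integral_integrable[OF g] K(2)[OF _ x]]
    show "?e x absolutely_integrable_on {0<..}" by (rule b(1))
    show "\<bar>integral {0<..} (?e x)\<bar> \<le> L * lnorm x powr (- real ?d)"
    proof -
      have e: "- 2 * p = - real ?d" by (simp add: p_def)
      show ?thesis using b(2) unfolding integral_unique[OF g] e L_def by (simp only: mult.assoc)
    qed
  qed
  have rad: "((\<lambda>t. gauss_radial ?d t r - gauss_radial ?d t s) has_integral
    (radial_potential ?d s - radial_potential ?d r)) {0<..}" if "r > 0" "s > 0" for r s
  proof (cases "r \<le> s")
    case True
    then show ?thesis using gauss_radial_potential[of ?d r s] that by (simp add: Suc_le_eq)
  next
    case False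
    then have "((\<lambda>t. - (gauss_radial ?d t s - gauss_radial ?d t r)) has_integral
      - (radial_potential ?d r - radial_potential ?d s)) {0<..}"
      using gauss_radial_potential[of ?d s r] that by (intro has_integral_neg) (simp add: Suc_le_eq)
    then show ?thesis by simp
  qed
  have main: "\<bar>potential x - potential y - real ?d * (radial_potential ?d (lnorm x) - radial_potential ?d (lnorm y))\<bar>
      \<le> (real ?d * L) * (lnorm x powr (- real ?d) + lnorm y powr (- real ?d))"
    if x: "x \<noteq> 0" and y: "y \<noteq> 0" for x y :: "int ^ 'n"
  proof -
    have pos: "lnorm x > 0" "lnorm y > 0" using lnorm_ge_one[OF x] lnorm_ge_one[OF y] by auto
    let ?I = "\<lambda>f. integral {0<..} f :: real"
    have h: "(\<lambda>t. heat t (0 :: int ^ 'n) - heat t z) integrable_on {0<..}" for z :: "int ^ 'n"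
      by (rule set_lebesgue_integral_eq_integral(1)[OF heat_difference_integrable])
    have e: "?e z integrable_on {0<..}" if "z \<noteq> 0" for z :: "int ^ 'n"
      by (rule set_lebesgue_integral_eq_integral(1)[OF E(1)[OF that]])
    have A: "((\<lambda>t. ((heat t (0 :: int ^ 'n) - heat t x) - (heat t (0 :: int ^ 'n) - heat t y)) - (gauss_radial ?d t (lnorm y) - gauss_radial ?d t (lnorm x)))
      has_integral ((?I (\<lambda>t. heat t (0 :: int ^ 'n) - heat t x) - ?I (\<lambda>t. heat t (0 :: int ^ 'n) - heat t y))
         - (radial_potential ?d (lnorm x) - radial_potential ?d (lnorm y)))) {0<..}"
      by (intro has_integral_diff integrable_integral h rad pos)
    have B: "(\<lambda>t. ((heat t (0 :: int ^ 'n) - heat t x) - (heat t (0 :: int ^ 'n) - heat t y)) - (gauss_radial ?d t (lnorm y) - gauss_radial ?d t (lnorm x)))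
       = (\<lambda>t. ?e y t - ?e x t)" by (simp add: fun_eq_iff)
    have D: "((\<lambda>t. ?e y t - ?e x t) has_integral (?I (?e y) - ?I (?e x))) {0<..}"
      by (intro has_integral_diff integrable_integral e x y)
    have "(?I (\<lambda>t. heat t (0 :: int ^ 'n) - heat t x) - ?I (\<lambda>t. heat t (0 :: int ^ 'n) - heat t y))
         - (radial_potential ?d (lnorm x) - radial_potential ?d (lnorm y)) = ?I (?e y) - ?I (?e x)"
      by (rule has_integral_unique[OF A[unfolded B] D])
    then have "potential x - potential y - real ?d * (radial_potential ?d (lnorm x) - radial_potential ?d (lnorm y))
       = real ?d * (?I (?e y) - ?I (?e x))"
      unfolding potential_def by (simp only: right_diff_distrib[symmetric])
    moreover have "\<bar>real ?d * (?I (?e y) - ?I (?e x))\<bar> \<le> real ?d * (L * lnorm y powr (- real ?d) + L * lnorm x powr (- real ?d))"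
    proof -
      have "\<bar>?I (?e y) - ?I (?e x)\<bar> \<le> L * lnorm y powr (- real ?d) + L * lnorm x powr (- real ?d)"
        using E(2)[OF x] E(2)[OF y] by linarith
      then show ?thesis unfolding abs_mult by (simp add: mult_left_mono)
    qed
    ultimately show ?thesis by (simp add: algebra_simps)
  qed
  show ?thesis
  proof (rule that)
    show "0 < real ?d * L" using L by simp
  qed (rule main)
qed

text \<open>Rewrites the derivative of \<open>d\<close> times \<open>radial_potential\<close> as
  \<open>2 / omega * s powr (1 - d)\<close>. For the mass \<open>omega * R ^ d\<close> the radial
  profile of \<open>obstacle\<close> is therefore stationary at \<open>R\<close>.\<close>

lemma omega_eq: "2 / omega TYPE('n::finite) = real CARD('n) * (Gamma (real CARD('n) / 2) / pi powr (real CARD('n) / 2))"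
proof -
  define p where "p = real CARD('n) / 2"
  have p: "p > 0" by (simp add: p_def)
  have "omega TYPE('n) = unit_ball_vol (real CARD('n))"
    unfolding omega_def using content_ball[of 1 "0 :: real ^ 'n"] by simp
  also have "\<dots> = pi powr p / (p * Gamma p)"
  proof -
    have "p \<notin> \<int>\<^sub>\<le>\<^sub>0" using p by (auto elim!: nonpos_Ints_cases)
    from Gamma_plus1[OF this] show ?thesis by (simp only: unit_ball_vol_def p_def[symmetric])
  qed
  finally have 1: "omega TYPE('n) = pi powr p / (p * Gamma p)" .
  have 2: "real CARD('n) = 2 * p" by (simp add: p_def)
  show ?thesis unfolding 1 p_def[symmetric] unfolding 2 using p Gamma_real_pos[OF p] by simp
qed

lemma omega_pos: "omega TYPE('n::finite) > 0"
  unfolding omega_def using content_ball_pos[of 1 "0 :: real ^ 'n"] by simp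

subsection \<open>Comparison with the obstacle function\<close>

text \<open>Everything is read off from \<open>g' s = 2 * s * (1 - (R / s) ^ d)\<close>. The last
  bound lets a lattice site in the ring between \<open>R\<close> and \<open>R + 1\<close> stand in
  for the radius \<open>R\<close>.\<close>

lemma profile_bounds:
  fixes N :: "real \<Rightarrow> real" and R :: real and d :: nat
  assumes d: "d \<ge> 2" and w: "w > 0" and R: "R > 0"
    and N: "\<And>s. s > 0 \<Longrightarrow> (N has_real_derivative 2 / w * s powr (1 - real d)) (at s)"
  defines "g \<equiv> \<lambda>s. s\<^sup>2 - (w * R ^ d) * N s"
  shows "0 < s \<Longrightarrow> s \<le> R \<Longrightarrow> g R + 2 * (R - s)\<^sup>2 \<le> g s"
    and "R \<le> s \<Longrightarrow> g R \<le> g s"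
    and "R \<le> s \<Longrightarrow> s \<le> R + 1 \<Longrightarrow> g s \<le> g R + 2 * real d"
proof -
  have D: "(g has_real_derivative 2 * s * (1 - (R / s) ^ d)) (at s)" if s: "s > 0" for s
  proof -
    have "(g has_real_derivative 2 * s - (w * R ^ d) * (2 / w * s powr (1 - real d))) (at s)"
      unfolding g_def by (auto intro!: derivative_eq_intros N s)
    also have "2 * s - (w * R ^ d) * (2 / w * s powr (1 - real d)) = 2 * s * (1 - (R / s) ^ d)"
      using s w by (simp add: powr_diff powr_realpow power_divide field_simps)
    finally show ?thesis .
  qed
  show "g R + 2 * (R - s)\<^sup>2 \<le> g s" if s: "0 < s" "s \<le> R"
  proof -
    have "g R - 2 * (R - R)\<^sup>2 \<le> g s - 2 * (R - s)\<^sup>2"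
    proof (rule DERIV_nonpos_imp_nonincreasing[OF s(2)])
      fix x assume x: "s \<le> x" "x \<le> R"
      have x0: "x > 0" using x s by simp
      have "((\<lambda>s. g s - 2 * (R - s)\<^sup>2) has_real_derivative 2 * x * (1 - (R / x) ^ d) + 4 * (R - x)) (at x)"
        using D[OF x0] by (auto intro!: derivative_eq_intros)
      moreover have "2 * x * (1 - (R / x) ^ d) + 4 * (R - x) \<le> 0"
      proof -
        \<comment> \<open>Here \<open>d \<ge> 2\<close> enters: \<open>(R / x) ^ d\<close> dominates
          the square, whose tangent line at 1 gives a slope of at most
          \<open>- 4 * (R - x)\<close>.\<close>
        have "1 + 2 * (R / x - 1) \<le> (R / x)\<^sup>2"
          using zero_le_power2[of "R / x - 1"] by (simp add: power2_eq_square algebra_simps)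
        also have "\<dots> \<le> (R / x) ^ d" using x x0 d by (intro power_increasing) auto
        finally have "2 * x * (1 + 2 * (R / x - 1)) \<le> 2 * x * (R / x) ^ d"
          using x0 by (intro mult_left_mono) auto
        then show ?thesis using x0 by (simp add: algebra_simps)
      qed
      ultimately show "\<exists>y. ((\<lambda>s. g s - 2 * (R - s)\<^sup>2) has_real_derivative y) (at x) \<and> y \<le> 0" by blast
    qed
    then show ?thesis by simp
  qed
  show "g R \<le> g s" if s: "R \<le> s"
  proof (rule DERIV_nonneg_imp_nondecreasing[OF s])
    fix x assume x: "R \<le> x"
    have x0: "x > 0" using x R by simp
    have "(R / x) ^ d \<le> 1" using x x0 R by (intro power_le_one) auto
    then have "2 * x * (1 - (R / x) ^ d) \<ge> 0" using x0 by simp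
    with D[OF x0] show "\<exists>y. (g has_real_derivative y) (at x) \<and> 0 \<le> y" by blast
  qed
  show "g s \<le> g R + 2 * real d" if s: "R \<le> s" "s \<le> R + 1"
  proof -
    have "g s - 2 * real d * s \<le> g R - 2 * real d * R"
    proof (rule DERIV_nonpos_imp_nonincreasing[OF s(1)])
      fix x assume x: "R \<le> x" "x \<le> s"
      have x0: "x > 0" using x R by simp
      have "((\<lambda>s. g s - 2 * real d * s) has_real_derivative 2 * x * (1 - (R / x) ^ d) - 2 * real d) (at x)"
        using D[OF x0] by (auto intro!: derivative_eq_intros)
      moreover have "2 * x * (1 - (R / x) ^ d) - 2 * real d \<le> 0"
      proof -
        \<comment> \<open>Bernoulli's inequality bounds the slope by \<open>2 d (x - R)\<close>,
          hence by \<open>2 d\<close> across the ring.\<close>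
        have "1 + real d * (R / x - 1) \<le> (1 + (R / x - 1)) ^ d"
          using R x0 by (intro Bernoulli_inequality) simp
        then have "1 - (R / x) ^ d \<le> real d * (1 - R / x)" by (simp add: algebra_simps)
        then have "2 * x * (1 - (R / x) ^ d) \<le> 2 * x * (real d * (1 - R / x))"
          using x0 by (intro mult_left_mono) auto
        also have "\<dots> = 2 * real d * (x - R)" using x0 by (simp add: field_simps)
        also have "\<dots> \<le> 2 * real d * 1" using x s by (intro mult_left_mono) auto
        finally show ?thesis by simp
      qed
      ultimately show "\<exists>y. ((\<lambda>s. g s - 2 * real d * s) has_real_derivative y) (at x) \<and> y \<le> 0" by blast
    qed
    moreover have "2 * real d * s \<le> 2 * real d * (R + 1)" using s by (intro mult_left_mono) auto
    ultimately show ?thesis by (simp add: algebra_simps)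
  qed
qed

definition obstacle :: "real \<Rightarrow> int ^ 'n \<Rightarrow> real" where
  "obstacle M x = (lnorm x)\<^sup>2 - M * potential x"

lemma lap_obstacle: "lap (obstacle M) x = 1 - M * point_mass 0 x" for x :: "int ^ 'n"
proof -
  have "lap (\<lambda>x. (lnorm x)\<^sup>2) x = 1" using lap_norm_square[of 0 x] by simp
  then show ?thesis unfolding obstacle_def[abs_def] by (simp only: lap_diff lap_cmult lap_potential)
qed

text \<open>The site \<open>z\<close> in the ring replaces the minimum at radius \<open>R\<close>,
  where there may be no lattice site. Sites beyond \<open>R / 4\<close> are handled by the kernel
  asymptotics, inner ones by the maximum principle. The gain is \<open>(R - lnorm x)^2 / 4\<close>
  because this much holds down to the origin.\<close>

lemma obstacle_bounds:
  assumes d: "CARD('n::finite) \<ge> 2"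
  obtains B where "B > 0"
    "\<And>R M (x :: int ^ 'n) (z :: int ^ 'n). R \<ge> 1 \<Longrightarrow> M = omega TYPE('n) * R ^ CARD('n) \<Longrightarrow> R \<le> lnorm z \<Longrightarrow> lnorm z \<le> R + 1 \<Longrightarrow>
      obstacle M z - B \<le> obstacle M x"
    "\<And>R M (x :: int ^ 'n) (z :: int ^ 'n). R \<ge> 8 \<Longrightarrow> M = omega TYPE('n) * R ^ CARD('n) \<Longrightarrow> R \<le> lnorm z \<Longrightarrow> lnorm z \<le> R + 1 \<Longrightarrow>
      lnorm x \<le> R \<Longrightarrow> obstacle M z - B + (R - lnorm x)\<^sup>2 / 4 \<le> obstacle M x"
proof -
  let ?d = "CARD('n)"
  define w where "w = omega TYPE('n)"
  have w: "w > 0" using omega_pos by (simp add: w_def)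
  define N where "N s = real ?d * radial_potential ?d s" for s
  have N: "(N has_real_derivative 2 / w * s powr (1 - real ?d)) (at s)" if "s > 0" for s
    using DERIV_cmult[OF radial_potential_derivative[OF that, of ?d], of "real ?d"]
    unfolding N_def[abs_def] w_def omega_eq by (simp add: mult.assoc)
  obtain C where C: "C > 0" "\<And>(x :: int ^ 'n) (y :: int ^ 'n). x \<noteq> 0 \<Longrightarrow> y \<noteq> 0 \<Longrightarrow>
    \<bar>potential x - potential y - (N (lnorm x) - N (lnorm y))\<bar> \<le> C * (lnorm x powr (- real ?d) + lnorm y powr (- real ?d))"
    using potential_asymptotics[where 'n = 'n] unfolding N_def right_diff_distrib by metis
  \<comment> \<open>\<open>4 ^ d\<close> bounds \<open>R ^ d * |y| powr (-d)\<close> for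
    \<open>|y| >= R / 4\<close> and occurs once for each of the two sites; \<open>2 d\<close> is the
    growth of the profile across the ring.\<close>
  define B where "B = w * (C * (2 * 4 ^ ?d)) + 2 * real ?d"
  have B: "B > 0" using w C by (simp add: B_def add_pos_nonneg)
  have far: "obstacle M z - B + (if lnorm x \<le> R then 2 * (R - lnorm x)\<^sup>2 else 0) \<le> obstacle M x"
    if R: "R \<ge> 1" and M: "M = w * R ^ ?d" and z: "R \<le> lnorm z" "lnorm z \<le> R + 1" and x: "R / 4 \<le> lnorm x"
    for R M and x z :: "int ^ 'n"
  proof -
    define g where "g s = s\<^sup>2 - (w * R ^ ?d) * N s" for s
    have R0: "R > 0" using R by simp
    note prof = profile_bounds[OF d w R0 N, folded g_def]
    have pos: "lnorm x > 0" "lnorm z > 0" using x z R by auto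
    then have nz: "x \<noteq> 0" "z \<noteq> 0" by (auto simp: to_real_vec_zero)
    have powr: "R ^ ?d * lnorm y powr (- real ?d) \<le> 4 ^ ?d" if "R / 4 \<le> lnorm y" for y :: "int ^ 'n"
    proof -
      have y: "lnorm y > 0" using that R by linarith
      have "R ^ ?d * lnorm y powr (- real ?d) = (R / lnorm y) ^ ?d"
      proof -
        have "R ^ n * a powr (- real n) = (R / a) ^ n" if "a > 0" for a :: real and n
          using that by (simp add: powr_minus powr_realpow divide_inverse power_mult_distrib power_inverse)
        then show ?thesis using y by blast
      qed
      also have "\<dots> \<le> 4 ^ ?d"
      proof (rule power_mono)
        show "R / lnorm y \<le> 4" unfolding pos_divide_le_eq[OF y] using that by simp
      qed (use R in simp)
      finally show ?thesis .
    qed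
    have "\<bar>(obstacle M x - obstacle M z) - (g (lnorm x) - g (lnorm z))\<bar>
        = \<bar>M * (potential x - potential z - (N (lnorm x) - N (lnorm z)))\<bar>"
      unfolding obstacle_def g_def M[symmetric] by (simp add: algebra_simps)
    also have "\<dots> \<le> M * (C * (lnorm x powr (- real ?d) + lnorm z powr (- real ?d)))"
      unfolding abs_mult using C(2)[OF nz] w R M by (intro mult_mono) auto
    also have "\<dots> = w * (C * (R ^ ?d * lnorm x powr (- real ?d) + R ^ ?d * lnorm z powr (- real ?d)))"
      by (simp add: M algebra_simps)
    also have "\<dots> \<le> w * (C * (4 ^ ?d + 4 ^ ?d))"
      using w C x z R by (intro mult_left_mono add_mono powr) auto
    finally have "\<bar>(obstacle M x - obstacle M z) - (g (lnorm x) - g (lnorm z))\<bar> \<le> B - 2 * real ?d"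
      by (simp add: B_def)
    moreover have "g (lnorm z) \<le> g R + 2 * real ?d" by (rule prof(3)[OF _ z])
    moreover have "g R + (if lnorm x \<le> R then 2 * (R - lnorm x)\<^sup>2 else 0) \<le> g (lnorm x)"
      using prof(1)[OF _ pos(1)] prof(2)[of "lnorm x"] by simp
    ultimately show ?thesis by linarith
  qed
  \<comment> \<open>Inside \<open>R / 4\<close> the error term is not bounded. As
    \<open>M * potential\<close> is subharmonic, the site can be exchanged for one just outside
    radius \<open>R / 4\<close>, at the cost of the squared norm of the latter.\<close>
  have near: "\<exists>v :: int ^ 'n. R / 4 \<le> lnorm v \<and> lnorm v \<le> R / 4 + 1 \<and> obstacle M v - (R / 4 + 1)\<^sup>2 \<le> obstacle M x"
    if R: "R \<ge> 1" and M: "M = w * R ^ ?d" and x: "lnorm x < R / 4" for R M and x :: "int ^ 'n"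
  proof -
    let ?A = "{y :: int ^ 'n. lnorm y < R / 4}"
    have M0: "M \<ge> 0" using M w R by simp
    have fin: "finite ?A" by (rule finite_subset[OF _ finite_lattice_ball[of "R / 4"]]) auto
    have xA: "x \<in> ?A" using x by simp
    have sub: "lap (\<lambda>y. M * potential y) y \<ge> 0" if "y \<in> ?A" for y :: "int ^ 'n"
      using M0 by (simp add: lap_cmult lap_potential)
    obtain v y i where v: "v \<notin> ?A" "y \<in> ?A" "v = y + axis i 1 \<or> v = y - axis i 1"
      "M * potential x \<le> M * potential v"
      by (rule maximum_principle[OF fin xA sub])
    have v': "R / 4 \<le> lnorm v" "lnorm v \<le> R / 4 + 1"
      using v lnorm_step[OF v(3)] by auto
    then have "(lnorm v)\<^sup>2 \<le> (R / 4 + 1)\<^sup>2" by (intro power_mono) auto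
    then have "obstacle M v - (R / 4 + 1)\<^sup>2 \<le> obstacle M x"
      using v(4) zero_le_power2[of "lnorm x"] unfolding obstacle_def by linarith
    with v' show ?thesis by blast
  qed
  have 1: "obstacle M z - (B + 9) \<le> obstacle M x"
    and 2: "8 \<le> R \<Longrightarrow> lnorm x \<le> R \<Longrightarrow> obstacle M z - (B + 9) + (R - lnorm x)\<^sup>2 / 4 \<le> obstacle M x"
    if R: "R \<ge> 1" and M: "M = w * R ^ ?d" and z: "R \<le> lnorm z" "lnorm z \<le> R + 1" for R M and x z :: "int ^ 'n"
  proof -
    consider "R / 4 \<le> lnorm x" | "lnorm x < R / 4" by linarith
    then have "obstacle M z - (B + 9) \<le> obstacle M x \<and>
       (8 \<le> R \<and> lnorm x \<le> R \<longrightarrow> obstacle M z - (B + 9) + (R - lnorm x)\<^sup>2 / 4 \<le> obstacle M x)"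
    proof cases
      case 1
      define q where "q = (R - lnorm x)\<^sup>2"
      have "0 \<le> q" by (simp add: q_def)
      then show ?thesis using far[OF R M z 1, folded q_def] unfolding q_def[symmetric]
        by (auto split: if_splits)
    next
      case 2
      from near[OF R M 2] obtain v :: "int ^ 'n" where v: "R / 4 \<le> lnorm v" "lnorm v \<le> R / 4 + 1"
        "obstacle M v - (R / 4 + 1)\<^sup>2 \<le> obstacle M x" by blast
      note f = far[OF R M z v(1)]
      show ?thesis
      \<comment> \<open>For \<open>R \<ge> 8\<close> the gain
        \<open>2 (R - |v|)^2 >= R^2 / 2\<close> pays for the cost
        \<open>(R / 4 + 1)^2 <= R^2 / 4\<close> and leaves \<open>R^2 / 4\<close>. For smaller
        \<open>R\<close> the cost is at most 9, which is the 9 in \<open>B + 9\<close>.\<close>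
      proof (cases "8 \<le> R")
        case True
        have "R / 2 \<le> R - lnorm v" using v True by simp
        then have "(R / 2)\<^sup>2 \<le> (R - lnorm v)\<^sup>2" using R by (intro power_mono) auto
        then have a: "R\<^sup>2 / 4 \<le> (R - lnorm v)\<^sup>2" by (simp add: power_divide)
        have "(R / 4 + 1)\<^sup>2 \<le> (R / 2)\<^sup>2" using True by (intro power_mono) auto
        then have b: "(R / 4 + 1)\<^sup>2 \<le> R\<^sup>2 / 4" by (simp add: power_divide)
        have "(R - lnorm x)\<^sup>2 \<le> R\<^sup>2" using 2 R by (intro power_mono) auto
        then have "(R - lnorm x)\<^sup>2 / 4 \<le> R\<^sup>2 / 4" by simp
        moreover have "0 \<le> (R - lnorm x)\<^sup>2 / 4" by simp
        moreover have "obstacle M z - B + 2 * (R - lnorm v)\<^sup>2 \<le> obstacle M v"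
          using f v True by simp
        ultimately have "obstacle M z - (B + 9) \<le> obstacle M x"
          "obstacle M z - (B + 9) + (R - lnorm x)\<^sup>2 / 4 \<le> obstacle M x"
          using a b v(3) by linarith+
        then show ?thesis by simp
      next
        case False
        have "(R / 4 + 1)\<^sup>2 \<le> 9" using power_mono[of "R / 4 + 1" 3 2] False R by simp
        moreover have "0 \<le> (if lnorm v \<le> R then 2 * (R - lnorm v)\<^sup>2 else 0)" by simp
        ultimately have "obstacle M z - (B + 9) \<le> obstacle M x" using f v(3) by linarith
        with False show ?thesis by simp
      qed
    qed
    then show "obstacle M z - (B + 9) \<le> obstacle M x"
      and "8 \<le> R \<Longrightarrow> lnorm x \<le> R \<Longrightarrow> obstacle M z - (B + 9) + (R - lnorm x)\<^sup>2 / 4 \<le> obstacle M x"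
      by auto
  qed
  show ?thesis
    by (rule that[of "B + 9"]) (use B 1 2 in \<open>auto simp: w_def\<close>)
qed

text \<open>If \<open>\<mu> x = 1\<close>, the function \<open>u y - |y - x|\<^sup>2\<close> is harmonic where \<open>\<mu> = 1\<close>, so \<open>u\<close> must reach
  \<open>\<rho>\<^sup>2\<close> at distance about \<open>\<rho>\<close> from \<open>x\<close>.\<close>

lemma occupied_sites_near:
  fixes u \<mu> :: "int ^ 'n \<Rightarrow> real"
  assumes u: "\<And>x. 0 \<le> u x" "\<And>x. 0 < u x \<Longrightarrow> \<mu> x = 1" and mu: "\<And>x. \<mu> x = m * point_mass 0 x + lap u x"
    and fin: "finite {x. \<mu> x = 1}" and R: "R \<ge> 0" and C: "\<And>y. R \<le> lnorm y \<Longrightarrow> u y \<le> C"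
    and rho: "0 < \<rho>" "C < \<rho>\<^sup>2" and x: "\<mu> x = 1"
  shows "lnorm x < R + \<rho> + 1"
proof (rule ccontr)
  assume "\<not> lnorm x < R + \<rho> + 1"
  then have big: "R + \<rho> + 1 \<le> lnorm x" by simp
  let ?A = "{y. lnorm (y - x) < \<rho> \<and> \<mu> y = 1}"
  let ?f = "\<lambda>y. u y - (lnorm (y - x))\<^sup>2"
  have fx: "?f x = u x" by (simp add: to_real_vec_zero)
  have far: "lnorm y \<ge> lnorm x - lnorm (y - x)" for y
    using norm_triangle_ineq2[of "to_real_vec x" "to_real_vec y"]
    by (simp add: to_real_vec_diff norm_minus_commute)
  have sub: "lap ?f y \<ge> 0" if "y \<in> ?A" for y
  proof -
    have "lnorm y > 0" using far[of y] that big R by auto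
    then have "y \<noteq> 0" by (auto simp: to_real_vec_zero)
    then have "lap u y = 1" using mu[of y] that by simp
    then show ?thesis by (simp only: lap_diff lap_norm_square)
  qed
  have finA: "finite ?A" using fin by (rule finite_subset[rotated]) auto
  have xA: "x \<in> ?A" using x rho by (simp add: to_real_vec_zero)
  obtain z y i where z: "z \<notin> ?A" "y \<in> ?A" "z = y + axis i 1 \<or> z = y - axis i 1" "?f x \<le> ?f z"
    by (rule maximum_principle[OF finA xA sub])
  \<comment> \<open>\<open>z\<close> is within \<open>\<rho> + 1\<close> of \<open>x\<close>, hence
    still at distance at least \<open>R\<close> from the origin, where \<open>u\<close> is bounded
    by \<open>C\<close>.\<close>
  have "lnorm (z - x) \<le> lnorm (y - x) + 1"
    using lnorm_step[of "z - x" "y - x" i] z(3) by (auto simp: algebra_simps)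
  then have "R \<le> lnorm z" using far[of z] z(2) big by simp
  then have uz: "u z \<le> C" by (rule C)
  have ge: "(lnorm (z - x))\<^sup>2 \<le> u z" using z(4) u(1)[of x] unfolding fx by linarith
  show False
  proof (cases "\<mu> z = 1")
    case True
    then have "\<rho> \<le> lnorm (z - x)" using z(1) by simp
    then have "\<rho>\<^sup>2 \<le> (lnorm (z - x))\<^sup>2" using rho by (intro power_mono) auto
    then show False using ge uz rho by linarith
  next
    case False
    \<comment> \<open>Where the odometer vanishes, \<open>z\<close> can only be \<open>x\<close>
      itself, but \<open>x\<close> is occupied.\<close>
    then have "u z = 0" using u(1)[of z] u(2)[of z] by fastforce
    then have "lnorm (z - x) = 0" using ge by simp
    then have "z = x" unfolding lnorm_zero_iff by simp
    then show False using False x by simp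
  qed
qed

section \<open>Assembly of the two inclusions\<close>

theorem theorem3p3:
  assumes "CARD('n::finite) \<ge> 2"
  shows "\<exists>c c' :: real. \<forall>(m::real) (s :: nat \<Rightarrow> int ^ 'n) (\<mu> :: int ^ 'n \<Rightarrow> real).
     m \<ge> 0 \<longrightarrow> visits_all s \<longrightarrow> (\<forall>x. (\<lambda>k. sandpile m s k x) \<longlonglongrightarrow> \<mu> x) \<longrightarrow>
     (let r = (m / omega TYPE('n)) powr (1 / real CARD('n)) in
        lattice_ball (r - c) \<subseteq> {x. \<mu> x = 1} \<and> {x. \<mu> x = 1} \<subseteq> lattice_ball (r + c'))"
proof -
  let ?d = "CARD('n)"
  define w where "w = omega TYPE('n)"
  have w: "w > 0" using omega_pos by (simp add: w_def)
  obtain B where B: "B > 0" and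
    B1: "\<And>R M (x :: int ^ 'n) (z :: int ^ 'n). R \<ge> 1 \<Longrightarrow> M = w * R ^ ?d \<Longrightarrow> R \<le> lnorm z \<Longrightarrow> lnorm z \<le> R + 1 \<Longrightarrow>
      obstacle M z - B \<le> obstacle M x" and
    B2: "\<And>R M (x :: int ^ 'n) (z :: int ^ 'n). R \<ge> 8 \<Longrightarrow> M = w * R ^ ?d \<Longrightarrow> R \<le> lnorm z \<Longrightarrow> lnorm z \<le> R + 1 \<Longrightarrow>
      lnorm x \<le> R \<Longrightarrow> obstacle M z - B + (R - lnorm x)\<^sup>2 / 4 \<le> obstacle M x"
    using obstacle_bounds[OF assms] unfolding w_def by metis
  \<comment> \<open>Chosen so that \<open>\<rho>^2\<close> exceeds \<open>2 * B\<close>, the bound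
    on the odometer at distances from \<open>R\<close> on.\<close>
  define \<rho> where "\<rho> = 2 * B + 1"
  have rho: "\<rho> > 0" "2 * B < \<rho>\<^sup>2" using B by (auto simp: \<rho>_def power2_eq_square algebra_simps add_pos_pos)
  \<comment> \<open>A nonempty inner ball then forces \<open>r >= 8\<close>, as \<open>B2\<close>
    needs, and a depth of at least \<open>c\<close> gives
    \<open>(R - lnorm x)^2 / 4 >= c / 4 = B + 2\<close>.\<close>
  define c where "c = 8 + 4 * B"
  have main: "lattice_ball (r - c) \<subseteq> {x. \<mu> x = 1} \<and> {x. \<mu> x = 1} \<subseteq> lattice_ball (r + (\<rho> + 2))"
    if m: "m \<ge> 0" and vis: "visits_all s" and lim: "\<And>x. (\<lambda>k. sandpile m s k x) \<longlonglongrightarrow> \<mu> x"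
      and r: "r = (m / w) powr (1 / real ?d)" for m r and s :: "nat \<Rightarrow> int ^ 'n" and \<mu>
  proof -
    have r0: "r \<ge> 0" using r by simp
    have rd: "m = w * r ^ ?d"
    proof (cases "m = 0")
      case False
      then have "r ^ ?d = (m / w) powr (1 / real ?d * real ?d)"
        using m w by (simp add: r powr_powr flip: powr_realpow)
      then show ?thesis using False m w by simp
    qed (simp add: r)
    \<comment> \<open>The comparison needs a radius of at least 1. Small masses are dominated by the
      mass \<open>M >= m\<close> of radius \<open>R\<close>, and \<open>R <= r + 1\<close> is
      absorbed in the outer constant \<open>\<rho> + 2\<close>.\<close>
    define R where "R = max r 1"
    have R: "R \<ge> 1" "r \<le> R" "R \<le> r + 1" using r0 by (auto simp: R_def)
    define M where "M = w * R ^ ?d"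
    have mM: "m \<le> M" unfolding rd M_def using w R r0 by (intro mult_left_mono power_mono) auto
    fix i0 :: 'n
    \<comment> \<open>A lattice site in the ring, on a coordinate axis; \<open>obstacle M z0\<close>
      serves as the reference value for the minimum.\<close>
    define z0 :: "int ^ 'n" where "z0 = axis i0 \<lceil>R\<rceil>"
    have "to_real_vec z0 = of_int \<lceil>R\<rceil> *\<^sub>R axis i0 1"
      by (auto simp: z0_def to_real_vec_def axis_def vec_eq_iff)
    moreover have "norm (axis i0 1 :: real ^ 'n) = 1" by simp
    ultimately have "lnorm z0 = of_int \<lceil>R\<rceil>" using R by simp
    then have z0: "R \<le> lnorm z0" "lnorm z0 \<le> R + 1" by linarith+
    define U where "U x = obstacle M x + (B - obstacle M z0)" for x :: "int ^ 'n"
    have U: "U x \<ge> 0" "m * point_mass 0 x + lap U x \<le> 1" for x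
    proof -
      show "U x \<ge> 0" using B1[OF R(1) M_def z0, of x] by (simp add: U_def)
      have "lap U x = 1 - M * point_mass 0 x"
        unfolding U_def[abs_def] by (simp only: lap_add lap_const lap_obstacle add_0_right)
      then show "m * point_mass 0 x + lap U x \<le> 1" using mM by simp
    qed
    obtain u where u: "\<And>x. 0 \<le> u x" and mu: "\<And>x. \<mu> x = m * point_mass 0 x + lap u x"
      and mu01: "\<And>x. 0 \<le> \<mu> x" "\<And>x. \<mu> x \<le> 1" and u1: "\<And>x. 0 < u x \<Longrightarrow> \<mu> x = 1"
      and least: "\<And>V x. (\<And>x. V x \<ge> 0) \<Longrightarrow> (\<And>x. m * point_mass 0 x + lap V x \<le> 1) \<Longrightarrow> u x \<le> V x"
      and fin: "finite {x. \<mu> x = 1}"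
      using sandpile_limit[OF m vis lim U] by metis
    \<comment> \<open>\<open>u\<close> lies below \<open>U\<close>, one \<open>B\<close> is the
      shift in \<open>U\<close>, and the other compares the obstacle at two sites of the
      ring.\<close>
    have ring: "u z \<le> 2 * B" if "R \<le> lnorm z" "lnorm z \<le> R + 1" for z
    proof -
      have "u z \<le> U z" by (rule least[OF U])
      then show ?thesis using B1[OF R(1) M_def that, of z0] by (simp add: U_def)
    qed
    \<comment> \<open>Away from the origin \<open>u\<close> is subharmonic, and its support is
      finite. A large value beyond the ring would propagate inwards to an exit site with
      \<open>u > 0\<close>, which must lie in the ring.\<close>
    have outside: "u y \<le> 2 * B" if y: "R \<le> lnorm y" for y
    proof (rule ccontr)
      assume "\<not> u y \<le> 2 * B"
      then have uy: "u y > 2 * B" by simp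
      let ?A = "{y. lnorm y > R + 1 \<and> u y > 0}"
      have finA: "finite ?A" using fin by (rule finite_subset[rotated]) (use u1 in auto)
      have yA: "y \<in> ?A" using uy ring[OF y] B by force
      have sub: "lap u x \<ge> 0" if "x \<in> ?A" for x
      proof -
        have "x \<noteq> 0" using that R by (auto simp: to_real_vec_zero)
        then show ?thesis using mu[of x] mu01(1)[of x] by simp
      qed
      obtain z x i where z: "z \<notin> ?A" "x \<in> ?A" "z = x + axis i 1 \<or> z = x - axis i 1" "u y \<le> u z"
        by (rule maximum_principle[OF finA yA sub])
      have "u z > 0" using z(4) uy B by simp
      then have "lnorm z \<le> R + 1" using z(1) by simp
      moreover have "R + 1 < lnorm x" using z(2) by simp
      then have "R \<le> lnorm z" using lnorm_step[OF z(3)] by linarith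
      ultimately show False using ring[of z] z(4) uy by simp
    qed
    have "{x. \<mu> x = 1} \<subseteq> lattice_ball (r + (\<rho> + 2))"
    proof
      fix x assume "x \<in> {x. \<mu> x = 1}"
      then have "\<mu> x = 1" by simp
      from occupied_sites_near[OF u u1 mu fin _ outside rho this] have "lnorm x < R + \<rho> + 1"
        using R by simp
      then show "x \<in> lattice_ball (r + (\<rho> + 2))" using R by (simp add: lattice_ball_def)
    qed
    moreover have "lattice_ball (r - c) \<subseteq> {x. \<mu> x = 1}"
    proof
      fix x :: "int ^ 'n" assume "x \<in> lattice_ball (r - c)"
      then have x: "lnorm x < r - c" by (simp add: lattice_ball_def)
      then have rc: "r > c" using norm_ge_zero[of "to_real_vec x"] by linarith
      then have r8: "r \<ge> 8" using B by (simp add: c_def)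
      \<comment> \<open>With equal masses the point masses at the origin cancel, and the Laplacian
        of \<open>?f\<close> below is \<open>1 - \<mu> \<ge> 0\<close> everywhere.\<close>
      then have Rr: "R = r" and Mm: "M = m" by (auto simp: R_def M_def rd max_def)
      let ?A = "{y :: int ^ 'n. lnorm y < R}"
      let ?f = "\<lambda>y. obstacle M y - u y"
      have finA: "finite ?A" by (rule finite_subset[OF _ finite_lattice_ball[of R]]) auto
      have sub: "lap ?f y \<ge> 0" if "y \<in> ?A" for y
        using mu[of y] mu01(2)[of y] by (simp add: lap_diff lap_obstacle Mm)
      have xA: "x \<in> ?A" using x B by (simp add: Rr c_def)
      obtain z y i where z: "z \<notin> ?A" "y \<in> ?A" "z = y + axis i 1 \<or> z = y - axis i 1" "?f x \<le> ?f z"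
        by (rule maximum_principle[OF finA xA sub])
      have zR: "R \<le> lnorm z" "lnorm z \<le> R + 1" using z lnorm_step[OF z(3)] by auto
      have "c * 1 \<le> c * c" using B by (intro mult_left_mono) (auto simp: c_def)
      also have "c * c \<le> (R - lnorm x) * (R - lnorm x)"
        using x B by (intro mult_mono) (auto simp: Rr c_def)
      finally have "B < (R - lnorm x)\<^sup>2 / 4" by (simp add: power2_eq_square c_def)
      moreover have "obstacle M z - B + (R - lnorm x)\<^sup>2 / 4 \<le> obstacle M x"
        using B2[OF _ M_def zR, of x] r8 x B by (simp add: Rr c_def)
      \<comment> \<open>Since \<open>u z \<ge> 0\<close>, the inequality
        \<open>?f x \<le> ?f z\<close> transfers this strict drop to \<open>u x > 0\<close>.\<close>
      ultimately have "obstacle M z < obstacle M x" by linarith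
      then have "u x > 0" using z(4) u[of z] by linarith
      then show "x \<in> {x. \<mu> x = 1}" using u1 by simp
    qed
    ultimately show ?thesis by blast
  qed
  show ?thesis
    by (rule exI[of _ c], rule exI[of _ "\<rho> + 2"])
      (unfold Let_def, intro allI impI main, auto simp: w_def)
qed

end
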